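(* Let $\mathfrak m$ be a Borel measure on $S\setminus\{\mathfrak 0\}$ with $\mathfrak m(S\setminus\{\mathfrak 0\})=\infty$, with no mass at the points $(i,\infty)$, $i\in\mathcal K$, and with $\int (1\wedge |x|)\,\mathfrak m(\mathrm dx)<\infty$; let $\alpha,\gamma\ge 0$ and $\beta=(\beta_i)_{i\in\mathcal K}$ with $\beta_i\ge 0$. Then the operator $\mathfrak G_{\alpha,\beta,\gamma,\mathfrak m}$ is a Feller generator in $\mathfrak C(S)$, and its resolvent is given by $$(\lambda-\mathfrak G_{\alpha,\beta,\gamma,\mathfrak m})^{-1}g=R_\lambda^0 g+\overline C(g)\,\ell_\lambda^0,\qquad \lambda>0,\ g\in\mathfrak C(S),$$ where $$\overline C(g)=\frac{\int_S R_\lambda^0 g\,\mathrm d\mathfrak m+C(g)}{\gamma+\lambda\int_S R^0_\lambda 1_S\,\mathrm d\mathfrak m+\lambda C(1_S)},\qquad C(g)=2\sqrt{2\lambda}\sum_{i\in\mathcal K}\beta_iC_i(g)+\alpha g(\mathfrak 0).$$ Moreover, as $\varepsilon\to0+$, $e^{t\mathfrak G_\varepsilon}\to e^{t\mathfrak G_{\alpha,\beta,\gamma,\mathfrak m}}$ strongly on $\mathfrak C(S)$ and uniformly for $t$ in compact intervals, where $\mathfrak G_\varepsilon=\mathfrak G_{\alpha,\beta(\varepsilon),\gamma,\delta(\varepsilon)\mu_\varepsilon}$.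
   Context: Fix an integer $k\ge2$ and $\mathcal K=\{1,\dots,k\}$. $S$ is the compactified star graph: the union of $k$ copies $\{i\}\times[0,\infty]$, $i\in\mathcal K$, of $[0,\infty]$ with all left ends identified to one point $\mathfrak 0$ (the center). For $x=(i,y)\in S$, $|x|=y$ is the distance from the center. $\mathfrak C(S)$ is the space of continuous real functions on $S$ with the supremum norm; $f\in\mathfrak C(S)$ is identified with $(f_i)_{i\in\mathcal K}$, $f_i(y)=f(i,y)$, where $f_i$ is continuous on $[0,\infty]$ and $f_i(0)=f(\mathfrak 0)$ for all $i$. $\mathfrak C^2(S)$ consists of $f\in\mathfrak C(S)$ such that each $f_i$ is twice continuously differentiable on $[0,\infty)$ (one-sided at $0$), $f_i''$ has a finite limit at $\infty$, and $f_i''(0)=f_j''(0)$ for all $i,j$ (common value $f''(\mathfrak 0)$). $\Delta f=\tfrac12 f''$ for $f\in\mathfrak C^2(S)$. For $\alpha,\gamma,\beta_i\ge0$ and a Borel measure $\mathfrak m$ on $S\setminus\{\mathfrak 0\}$ with $\int(1\wedge|x|)\mathfrak m(\mathrm dx)<\infty$, $\mathfrak G_{\alpha,\beta,\gamma,\mathfrak m}$ is the restriction of $\Delta$ to those $f\in\mathfrak C^2(S)$ for which $$\tfrac\alpha2 f''(\mathfrak 0)-\sum_{i\in\mathcal K}\beta_if_i'(0)+\gamma f(\mathfrak 0)=\int_{S\setminus\{\mathfrak 0\}}[f(x)-f(\mathfrak 0)]\,\mathfrak m(\mathrm dx).$$ A Feller semigroup is a strongly continuous semigroup of positive contraction operators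 in $\mathfrak C(S)$ (conservativeness is not required); a Feller generator is the generator of such a semigroup, and $e^{t\mathfrak G}$ denotes the semigroup generated by $\mathfrak G$. For $\lambda>0$, $g\in\mathfrak C(S)$, $i\in\mathcal K$, $x\ge0$: $C_i(g)=\frac1{\sqrt{2\lambda}}\int_0^\infty e^{-\sqrt{2\lambda}y}g_i(y)\,\mathrm dy$; $(R^0_\lambda g)_i(x)=\frac1{\sqrt{2\lambda}}\int_0^\infty\big(e^{-\sqrt{2\lambda}|x-y|}-e^{-\sqrt{2\lambda}(x+y)}\big)g_i(y)\,\mathrm dy$; $(\ell^0_\lambda)_i(x)=e^{-\sqrt{2\lambda}x}$ (all extended to $x=\infty$ by limits). Approximation: for $\varepsilon>0$ (small enough that $\mathfrak m(\Gamma_\varepsilon)>0$), $\Gamma_\varepsilon=\{x\in S:|x|\ge\varepsilon\}$, $\delta(\varepsilon)=\mathfrak m(\Gamma_\varepsilon)<\infty$, $\mu_\varepsilon(\cdot)=\mathfrak m(\cdot\cap\Gamma_\varepsilon)/\mathfrak m(\Gamma_\varepsilon)$, and $\beta(\varepsilon)=(\beta_i(\varepsilon))_{i\in\mathcal K}$ are vectors with $\beta_i(\varepsilon)>0$ and $\lim_{\varepsilon\to0+}\beta_i(\varepsilon)=\beta_i$, $i\in\mathcal K$. The operators $\mathfrak G_\varepsilon$ are known to be Feller generators. *)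

theory Defs
  imports "HOL-Analysis.Analysis"
begin

section \<open>The compactified star graph\<close>

text \<open>The edges are indexed by a finite type. Each edge is a copy of the interval from
  0 to infinity, which is the type \<^typ>\<open>ennreal\<close> with its order topology.\<close>

definition star_rel :: "'k \<times> ennreal \<Rightarrow> 'k \<times> ennreal \<Rightarrow> bool" where
  "star_rel p q \<longleftrightarrow> p = q \<or> (snd p = 0 \<and> snd q = 0)"

quotient_type 'k star_graph = "'k \<times> ennreal" / star_rel
  by (rule equivpI) (auto simp: star_rel_def reflp_def symp_def transp_def)

lift_definition star_pt :: "'k \<Rightarrow> ennreal \<Rightarrow> 'k star_graph" is "\<lambda>i y. (i, y)" .

definition center :: "'k star_graph" where
  "center = star_pt undefined 0"

lift_definition star_norm :: "'k star_graph \<Rightarrow> ennreal" is snd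
  by (auto simp: star_rel_def)

lemma star_pt_eq_iff: "star_pt i x = star_pt j y \<longleftrightarrow> (i = j \<and> x = y) \<or> (x = 0 \<and> y = 0)"
  by transfer (auto simp: star_rel_def)

lemma star_pt_0 [simp]: "star_pt i 0 = center"
  by (simp add: center_def star_pt_eq_iff)

lemma star_norm_star_pt [simp]: "star_norm (star_pt i y) = y"
  by transfer simp

lemma star_graph_exhaust: obtains i y where "x = star_pt i y"
  by transfer (auto simp: star_rel_def)

text \<open>The quotient topology of the disjoint union of the edges.\<close>

instantiation star_graph :: (type) topological_space
begin

definition open_star_graph :: "'a star_graph set \<Rightarrow> bool" where
  "open_star_graph U \<longleftrightarrow> (\<forall>i. open {y. star_pt i y \<in> U})"

instance
proof
  show "open (UNIV :: 'a star_graph set)"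
    by (simp add: open_star_graph_def)
next
  fix U V :: "'a star_graph set"
  assume "open U" "open V"
  then show "open (U \<inter> V)"
    by (auto simp: open_star_graph_def Collect_conj_eq)
next
  fix K :: "'a star_graph set set"
  assume K: "\<forall>U\<in>K. open U"
  have "{y. star_pt i y \<in> \<Union>K} = (\<Union>U\<in>K. {y. star_pt i y \<in> U})" for i
    by auto
  with K show "open (\<Union>K)"
    by (auto simp: open_star_graph_def)
qed

end

text \<open>By compactness every continuous real function on the star graph is bounded, so that
  the type \<open>'k star_graph \<Rightarrow>\<^sub>C real\<close> is the space of all continuous functions with the
  supremum norm.\<close>

lemma compact_star_graph: "compact (UNIV :: 'k::finite star_graph set)"
proof -
  have "continuous_on UNIV (star_pt i)" for i :: 'k
    by (auto simp: continuous_on_open_vimage open_star_graph_def vimage_def)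
  then have "compact (\<Union>i::'k. range (star_pt i))"
    by (intro compact_UN compact_continuous_image compact_UNIV) auto
  moreover have "(\<Union>i::'k. range (star_pt i)) = UNIV"
    by (auto simp: image_iff) (metis star_graph_exhaust)
  ultimately show ?thesis
    by simp
qed


section \<open>Operators and Feller semigroups\<close>

text \<open>Unbounded operators are represented by their graphs.\<close>

definition generator :: "(real \<Rightarrow> 'a::real_normed_vector \<Rightarrow>\<^sub>L 'a) \<Rightarrow> ('a \<times> 'a) set" where
  "generator T = {(f, g). ((\<lambda>t. (T t f - f) /\<^sub>R t) \<longlongrightarrow> g) (at_right 0)}"

text \<open>The condition below says that \<open>R\<close> is the bounded, everywhere defined inverse of
  \<open>lam - A\<close>: the pair \<open>(f, lam *\<^sub>R f - g)\<close> lies in the graph of \<open>A\<close> iff \<open>f\<close> is in the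
  domain and \<open>lam *\<^sub>R f - A f = g\<close>.\<close>

definition is_resolvent ::
    "('a::real_normed_vector \<times> 'a) set \<Rightarrow> real \<Rightarrow> ('a \<Rightarrow>\<^sub>L 'a) \<Rightarrow> bool" where
  "is_resolvent A lam R \<longleftrightarrow> (\<forall>f g. (f, lam *\<^sub>R f - g) \<in> A \<longleftrightarrow> f = R g)"

definition resolvent_set :: "('a::real_normed_vector \<times> 'a) set \<Rightarrow> real set" where
  "resolvent_set A = {lam. \<exists>R. is_resolvent A lam R}"

definition resolvent :: "('a::real_normed_vector \<times> 'a) set \<Rightarrow> real \<Rightarrow> 'a \<Rightarrow>\<^sub>L 'a" where
  "resolvent A lam = (THE R. is_resolvent A lam R)"

definition feller_semigroup ::
    "(real \<Rightarrow> ('s::topological_space \<Rightarrow>\<^sub>C real) \<Rightarrow>\<^sub>L ('s \<Rightarrow>\<^sub>C real)) \<Rightarrow> bool" where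
  "feller_semigroup T \<longleftrightarrow>
     T 0 = id_blinfun \<and>
     (\<forall>s\<ge>0. \<forall>t\<ge>0. T (s + t) = T s o\<^sub>L T t) \<and>
     (\<forall>f. ((\<lambda>t. T t f) \<longlongrightarrow> f) (at_right 0)) \<and>
     (\<forall>t\<ge>0. norm (T t) \<le> 1) \<and>
     (\<forall>t\<ge>0. \<forall>f. (\<forall>x. 0 \<le> apply_bcontfun f x) \<longrightarrow> (\<forall>x. 0 \<le> apply_bcontfun (T t f) x))"

definition feller_generator ::
    "(('s::topological_space \<Rightarrow>\<^sub>C real) \<times> ('s \<Rightarrow>\<^sub>C real)) set \<Rightarrow> bool" where
  "feller_generator A \<longleftrightarrow> (\<exists>T. feller_semigroup T \<and> generator T = A)"

text \<open>The operator \<open>exp (t A)\<close>. A semigroup is determined by its generator only for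
  \<open>t \<ge> 0\<close>, so the description is applied to its value at \<open>t\<close>.\<close>

definition semigroup_of ::
    "(('s::topological_space \<Rightarrow>\<^sub>C real) \<times> ('s \<Rightarrow>\<^sub>C real)) set
      \<Rightarrow> real \<Rightarrow> ('s \<Rightarrow>\<^sub>C real) \<Rightarrow>\<^sub>L ('s \<Rightarrow>\<^sub>C real)" where
  "semigroup_of A t = (THE B. \<exists>T. feller_semigroup T \<and> generator T = A \<and> T t = B)"


section \<open>The Laplace operator on the star graph and its boundary conditions\<close>

definition edge :: "('k star_graph \<Rightarrow>\<^sub>C real) \<Rightarrow> 'k \<Rightarrow> real \<Rightarrow> real" where
  "edge f i y = f (star_pt i (ennreal y))"

definition half_line_deriv :: "(real \<Rightarrow> real) \<Rightarrow> real \<Rightarrow> real" where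
  "half_line_deriv u y = vector_derivative u (at y within {0..})"

definition edge_d1 :: "('k star_graph \<Rightarrow>\<^sub>C real) \<Rightarrow> 'k \<Rightarrow> real \<Rightarrow> real" where
  "edge_d1 f i = half_line_deriv (edge f i)"

definition edge_d2 :: "('k star_graph \<Rightarrow>\<^sub>C real) \<Rightarrow> 'k \<Rightarrow> real \<Rightarrow> real" where
  "edge_d2 f i = half_line_deriv (edge_d1 f i)"

definition C2_star :: "('k star_graph \<Rightarrow>\<^sub>C real) set" where
  "C2_star = {f.
     (\<forall>i. edge f i differentiable_on {0..} \<and>
          edge_d1 f i differentiable_on {0..} \<and>
          continuous_on {0..} (edge_d2 f i) \<and>
          (\<exists>l. (edge_d2 f i \<longlongrightarrow> l) at_top)) \<and>
     (\<forall>i j. edge_d2 f i 0 = edge_d2 f j 0)}"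

definition center_d2 :: "('k star_graph \<Rightarrow>\<^sub>C real) \<Rightarrow> real" where
  "center_d2 f = (THE c. \<forall>i. edge_d2 f i 0 = c)"

text \<open>The values of \<open>g\<close> at the points at infinity are forced by continuity of \<open>g\<close>.\<close>

definition star_laplacian ::
    "(('k star_graph \<Rightarrow>\<^sub>C real) \<times> ('k star_graph \<Rightarrow>\<^sub>C real)) set" where
  "star_laplacian = {(f, g). f \<in> C2_star \<and> (\<forall>i. \<forall>y\<ge>0. edge g i y = edge_d2 f i y / 2)}"

definition star_operator ::
    "real \<Rightarrow> ('k::finite \<Rightarrow> real) \<Rightarrow> real \<Rightarrow> 'k star_graph measure
      \<Rightarrow> (('k star_graph \<Rightarrow>\<^sub>C real) \<times> ('k star_graph \<Rightarrow>\<^sub>C real)) set" where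
  "star_operator \<alpha> \<beta> \<gamma> m = {(f, g) \<in> star_laplacian.
     \<alpha> / 2 * center_d2 f - (\<Sum>i\<in>UNIV. \<beta> i * edge_d1 f i 0) + \<gamma> * f center
       = (\<integral>x. (f x - f center) \<partial>m)}"


section \<open>The explicit resolvent\<close>

text \<open>The function on the star graph with the edge functions \<open>u i\<close>, extended to the points
  at infinity by limits. It is used only when \<open>u i 0\<close> does not depend on \<open>i\<close>, so the
  arbitrary choice of an edge for the center is harmless.\<close>

definition star_edge :: "'k star_graph \<Rightarrow> 'k" where
  "star_edge x = (SOME i. \<exists>y. x = star_pt i y)"

definition star_extend :: "('k \<Rightarrow> real \<Rightarrow> real) \<Rightarrow> 'k star_graph \<Rightarrow> real" where
  "star_extend u x =
     (if star_norm x = \<infinity> then Lim at_top (u (star_edge x))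
      else u (star_edge x) (enn2real (star_norm x)))"

definition ell0 :: "real \<Rightarrow> 'k star_graph \<Rightarrow> real" where
  "ell0 lam = star_extend (\<lambda>i x. exp (- sqrt (2 * lam) * x))"

definition R0 :: "real \<Rightarrow> ('k star_graph \<Rightarrow>\<^sub>C real) \<Rightarrow> 'k star_graph \<Rightarrow> real" where
  "R0 lam g = star_extend (\<lambda>i x. 1 / sqrt (2 * lam) *
     (LINT y:{0..}|lborel.
        (exp (- sqrt (2 * lam) * \<bar>x - y\<bar>) - exp (- sqrt (2 * lam) * (x + y))) * edge g i y))"

definition C_edge :: "real \<Rightarrow> 'k \<Rightarrow> ('k star_graph \<Rightarrow>\<^sub>C real) \<Rightarrow> real" where
  "C_edge lam i g =
     1 / sqrt (2 * lam) * (LINT y:{0..}|lborel. exp (- sqrt (2 * lam) * y) * edge g i y)"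

definition C_total ::
    "real \<Rightarrow> ('k::finite \<Rightarrow> real) \<Rightarrow> real \<Rightarrow> ('k star_graph \<Rightarrow>\<^sub>C real) \<Rightarrow> real" where
  "C_total \<alpha> \<beta> lam g =
     2 * sqrt (2 * lam) * (\<Sum>i\<in>UNIV. \<beta> i * C_edge lam i g) + \<alpha> * g center"

definition C_bar ::
    "real \<Rightarrow> ('k::finite \<Rightarrow> real) \<Rightarrow> real \<Rightarrow> 'k star_graph measure \<Rightarrow> real
      \<Rightarrow> ('k star_graph \<Rightarrow>\<^sub>C real) \<Rightarrow> real" where
  "C_bar \<alpha> \<beta> \<gamma> m lam g =
     ((\<integral>x. R0 lam g x \<partial>m) + C_total \<alpha> \<beta> lam g) /
     (\<gamma> + lam * (\<integral>x. R0 lam (const_bcontfun 1) x \<partial>m)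
        + lam * C_total \<alpha> \<beta> lam (const_bcontfun 1))"


section \<open>Approximation by finite measures\<close>

definition star_tail :: "real \<Rightarrow> 'k star_graph set" where
  "star_tail \<epsilon> = {x. ennreal \<epsilon> \<le> star_norm x}"

definition approx_operator ::
    "real \<Rightarrow> (real \<Rightarrow> 'k::finite \<Rightarrow> real) \<Rightarrow> real \<Rightarrow> 'k star_graph measure \<Rightarrow> real
      \<Rightarrow> (('k star_graph \<Rightarrow>\<^sub>C real) \<times> ('k star_graph \<Rightarrow>\<^sub>C real)) set" where
  "approx_operator \<alpha> b \<gamma> m \<epsilon> =
     star_operator \<alpha> (b \<epsilon>) \<gamma>
       (scale_measure (emeasure m (star_tail \<epsilon>)) (uniform_measure m (star_tail \<epsilon>)))"

end

theory Submission
  imports Defs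
begin

text \<open>
  Why the theorem holds. Write \<open>s = sqrt (2 * lam)\<close>. On each edge the equation
  \<open>lam f - f'' / 2 = g\<close> has, among bounded functions, exactly the solutions
  \<open>R0 lam g + c * ell0 lam\<close>: the difference of two of them solves \<open>h'' = s\<^sup>2 h\<close>, and boundedness
  leaves only multiples of the decaying exponential. Continuity at the center makes \<open>c\<close>, which is
  the value of \<open>f\<close> there, the same on all edges
  (\<open>star_laplacian_resolvent\<close>). Inserting this form into the boundary condition turns it into one
  scalar equation for \<open>c\<close>, whose solution is \<open>C_bar\<close> (\<open>boundary_condition_iff\<close>). So the explicit
  operator, below \<open>Res lam\<close>, is the resolvent. It is visibly positive, and it maps the
  constant function 1 to a function bounded by \<open>1 / lam\<close>, so \<open>lam * Res lam\<close> is a contraction.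

  By the Hille--Yosida theorem it remains to see that \<open>lam * Res lam\<close> tends strongly to the
  identity as \<open>lam\<close> grows (\<open>Res_tendsto\<close>). For functions vanishing at the center, \<open>lam * R0 lam\<close> does
  so, as an integral against a concentrating two-sided exponential density. The remaining term is a
  quotient \<open>boundary_fun lam g / (\<gamma> + mass lam)\<close>, and here the infinite measure enters: \<open>mass lam\<close>
  tends to infinity, so the weight that the quotient puts away from the center disappears. A
  positive \<open>\<beta> i\<close> has the same effect. The approximating operators, with finite measures
  and positive coefficients, are thereby covered by the same argument.

  Convergence of the semigroups is the Trotter--Kato theorem: the resolvents of the approximating
  operators differ from the limiting one only in the scalar \<open>C_bar\<close>, which converges by dominated
  convergence (\<open>C_bar_cutoff_tendsto\<close>).

  Both semigroup theorems are derived from the implicit Euler scheme. For \<open>f\<close> in the domain of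
  \<open>A\<^sup>2\<close>, one step \<open>J h = (1 - h A)\<^sup>-\<^sup>1\<close> agrees with \<open>f + h A f\<close> up to \<open>h\<^sup>2\<close> times the norm of \<open>A\<^sup>2 f\<close>,
  and so does one step of length \<open>h\<close> of any contraction semigroup generated by \<open>A\<close>. Contractions do
  not amplify errors, so iterating \<open>t / h\<close> steps costs an error of order \<open>h\<close>, with a
  constant that depends on \<open>A\<close> only through the norms of \<open>A f\<close> and \<open>A\<^sup>2 f\<close>. This gives existence
  (convergence along dyadic step sizes), uniqueness, and the uniformity needed for Trotter--Kato,
  without operator exponentials or vector-valued integrals.
\<close>


section \<open>Contraction semigroups and their generators\<close>

definition contraction_semigroup :: "(real \<Rightarrow> 'a::real_normed_vector \<Rightarrow>\<^sub>L 'a) \<Rightarrow> bool" where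
  "contraction_semigroup T \<longleftrightarrow>
     T 0 = id_blinfun \<and>
     (\<forall>s\<ge>0. \<forall>t\<ge>0. T (s + t) = T s o\<^sub>L T t) \<and>
     (\<forall>f. ((\<lambda>t. T t f) \<longlongrightarrow> f) (at_right 0)) \<and>
     (\<forall>t\<ge>0. norm (T t) \<le> 1)"

lemma norm_blinfun_le_self:
  fixes P :: "'a::real_normed_vector \<Rightarrow>\<^sub>L 'b::real_normed_vector"
  assumes "norm P \<le> 1"
  shows "norm (P x) \<le> norm x"
  using norm_blinfun[of P x] mult_right_mono[OF assms norm_ge_zero[of x]] by simp

lemma norm_blinfun_diff_le:
  fixes P :: "'a::real_normed_vector \<Rightarrow>\<^sub>L 'b::real_normed_vector"
  assumes "norm P \<le> 1"
  shows "norm (P x - P y) \<le> norm (x - y)"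
  using norm_blinfun_le_self[OF assms, of "x - y"] by (simp add: blinfun.diff_right)

text \<open>Errors of single steps add up but are not amplified: in the telescoping sum of
  \<open>P^(n-j) (P - Q) Q^j x\<close> the powers of \<open>P\<close> are contractions. The one-step bound is required only
  on a \<open>Q\<close>-invariant set, which will be a part of the domain of the square of a generator.\<close>
lemma iterate_close:
  fixes P Q :: "'a::real_normed_vector \<Rightarrow> 'a"
  assumes P: "\<And>x y. norm (P x - P y) \<le> norm (x - y)"
    and Q: "\<And>x. x \<in> Z \<Longrightarrow> Q x \<in> Z"
    and c: "\<And>x. x \<in> Z \<Longrightarrow> norm (P x - Q x) \<le> c"
    and x: "x \<in> Z"
  shows "norm ((P ^^ n) x - (Q ^^ n) x) \<le> real n * c"
proof (induction n)
  case (Suc n)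
  have Z: "(Q ^^ n) x \<in> Z"
    by (induction n) (auto simp: x Q)
  have "norm (P ((P ^^ n) x) - Q ((Q ^^ n) x))
      \<le> norm (P ((P ^^ n) x) - P ((Q ^^ n) x)) + norm (P ((Q ^^ n) x) - Q ((Q ^^ n) x))"
    by (metis norm_triangle_ineq diff_add_cancel add_diff_eq)
  also have "\<dots> \<le> norm ((P ^^ n) x - (Q ^^ n) x) + c"
    by (intro add_mono P c Z)
  finally show ?case
    using Suc by (simp add: algebra_simps)
qed simp

lemma iterate_close_id:
  fixes P :: "'a::real_normed_vector \<Rightarrow> 'a"
  assumes "\<And>x y. norm (P x - P y) \<le> norm (x - y)"
  shows "norm ((P ^^ n) x - x) \<le> real n * norm (P x - x)"
  using iterate_close[of P "{x}" id "norm (P x - x)" x n] assms by simp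

lemma iterate_contraction:
  fixes P :: "'a::real_normed_vector \<Rightarrow> 'a"
  assumes "\<And>x y. norm (P x - P y) \<le> norm (x - y)"
  shows "norm ((P ^^ n) x - (P ^^ n) y) \<le> norm (x - y)"
  by (induction n) (auto intro: order_trans[OF assms])


lemma contraction_semigroup_power:
  assumes "contraction_semigroup S" "0 \<le> t"
  shows "S (real n * t) f = (blinfun_apply (S t) ^^ n) f"
proof (induction n)
  case 0
  then show ?case using assms by (simp add: contraction_semigroup_def)
next
  case (Suc n)
  have "S (t + real n * t) = S t o\<^sub>L S (real n * t)"
    using assms by (simp add: contraction_semigroup_def)
  then show ?case using Suc by (simp add: algebra_simps)
qed

lemma filterlim_divide_real_at_right:
  assumes "0 < t"
  shows "filterlim (\<lambda>n. t / real n) (at_right 0) sequentially"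
proof -
  have "(\<lambda>n. t / real n) \<longlonglongrightarrow> 0"
    by (intro real_tendsto_divide_at_top[OF tendsto_const] filterlim_real_sequentially)
  moreover have "eventually (\<lambda>n. t / real n \<in> {0<..} \<and> t / real n \<noteq> 0) sequentially"
    using eventually_gt_at_top[of "0::nat"] by eventually_elim (use assms in auto)
  ultimately show ?thesis
    unfolding filterlim_at by blast
qed

lemma norm_difference_quotient:
  fixes x y z :: "'a::real_normed_vector"
  assumes "0 < t"
  shows "norm ((x - y) /\<^sub>R t - z) = norm (x - y - t *\<^sub>R z) / t"
proof -
  have "(x - y) /\<^sub>R t - z = (x - y - t *\<^sub>R z) /\<^sub>R t"
    using assms by (simp add: scaleR_right_diff_distrib)
  then show ?thesis
    using assms by (simp only: norm_scaleR) (simp add: divide_inverse)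
qed

lemma generator_tendsto:
  "(f, g) \<in> generator S \<Longrightarrow> ((\<lambda>t. (S t f - f) /\<^sub>R t) \<longlongrightarrow> g) (at_right 0)"
  by (simp add: generator_def)

text \<open>Cutting \<open>[0, t]\<close> into \<open>n\<close> pieces bounds the displacement by \<open>n\<close> times that of one piece, and the
  limit \<open>n \<rightarrow> \<infinity>\<close> only involves the derivative at 0. This replaces integration of the derivative
  along the orbit.\<close>
lemma semigroup_lipschitz:
  assumes S: "contraction_semigroup S" and fg: "(f, g) \<in> generator S" and t: "0 \<le> t"
  shows "norm (S t f - f) \<le> t * norm g"
proof (cases "t = 0")
  case True
  then show ?thesis using S by (simp add: contraction_semigroup_def)
next
  case False
  with t have t: "0 < t" by simp
  have "(\<lambda>n. norm ((S (t / real n) f - f) /\<^sub>R (t / real n))) \<longlonglongrightarrow> norm g"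
    by (rule tendsto_norm[OF filterlim_compose[OF generator_tendsto[OF fg]
          filterlim_divide_real_at_right[OF t]]])
  then have "(\<lambda>n. t * norm ((S (t / real n) f - f) /\<^sub>R (t / real n))) \<longlonglongrightarrow> t * norm g"
    by (rule tendsto_mult_left)
  moreover have "norm (S t f - f) \<le> t * norm ((S (t / real n) f - f) /\<^sub>R (t / real n))" if "n \<ge> 1" for n
  proof -
    have n: "norm (S (t / real n)) \<le> 1"
      using S t by (simp add: contraction_semigroup_def)
    have "S t f = (blinfun_apply (S (t / real n)) ^^ n) f"
      using contraction_semigroup_power[OF S, of "t / real n" n] t that by simp
    then have "norm (S t f - f) \<le> real n * norm (S (t / real n) f - f)"
      using iterate_close_id[of "blinfun_apply (S (t / real n))", OF norm_blinfun_diff_le[OF n]] by simp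
    moreover have "t * norm ((S (t / real n) f - f) /\<^sub>R (t / real n)) = real n * norm (S (t / real n) f - f)"
      unfolding norm_scaleR using t that by simp
    ultimately show ?thesis by simp
  qed
  ultimately show ?thesis
    by (intro LIMSEQ_le_const) auto
qed

text \<open>The same subdivision, now with the linear term removed from each piece. The drift of
  the linear term along the orbit is controlled by the previous lemma applied to \<open>g\<close>.\<close>
lemma semigroup_taylor:
  assumes S: "contraction_semigroup S" and fg: "(f, g) \<in> generator S"
    and gz: "(g, z) \<in> generator S" and t: "0 \<le> t"
  shows "norm (S t f - f - t *\<^sub>R g) \<le> t\<^sup>2 * norm z"
proof (cases "t = 0")
  case True
  then show ?thesis using S by (simp add: contraction_semigroup_def)
next
  case False
  with t have t: "0 < t" by simp
  define r where "r = (\<lambda>\<tau>. S \<tau> f - f - \<tau> *\<^sub>R g)"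
  have step: "norm (r (real n * \<tau>)) \<le> real n * norm (r \<tau>) + (real n * \<tau>)\<^sup>2 * norm z"
    if \<tau>: "0 \<le> \<tau>" for n \<tau>
  proof (induction n)
    case 0
    then show ?case using S by (simp add: contraction_semigroup_def r_def)
  next
    case (Suc n)
    have "S (real n * \<tau> + \<tau>) = S (real n * \<tau>) o\<^sub>L S \<tau>"
      using S \<tau> by (simp add: contraction_semigroup_def)
    then have "r (real (Suc n) * \<tau>)
        = S (real n * \<tau>) (r \<tau>) + \<tau> *\<^sub>R (S (real n * \<tau>) g - g) + r (real n * \<tau>)"
      by (simp add: r_def algebra_simps blinfun.bilinear_simps)
    then have "norm (r (real (Suc n) * \<tau>))
        \<le> norm (S (real n * \<tau>) (r \<tau>)) + norm (\<tau> *\<^sub>R (S (real n * \<tau>) g - g)) + norm (r (real n * \<tau>))"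
      using norm_triangle_le by (metis add_mono norm_triangle_ineq order_refl)
    also have "\<dots> \<le> norm (r \<tau>) + \<tau> * (real n * \<tau> * norm z)
        + (real n * norm (r \<tau>) + (real n * \<tau>)\<^sup>2 * norm z)"
    proof (intro add_mono Suc)
      show "norm (S (real n * \<tau>) (r \<tau>)) \<le> norm (r \<tau>)"
        using S \<tau> by (intro norm_blinfun_le_self) (simp add: contraction_semigroup_def)
      show "norm (\<tau> *\<^sub>R (S (real n * \<tau>) g - g)) \<le> \<tau> * (real n * \<tau> * norm z)"
        using semigroup_lipschitz[OF S gz, of "real n * \<tau>"] \<tau> by (simp add: mult_left_mono)
    qed
    also have "\<dots> \<le> real (Suc n) * norm (r \<tau>) + (real (Suc n) * \<tau>)\<^sup>2 * norm z"
    proof -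
      have "\<tau> * (real n * \<tau>) + (real n * \<tau>)\<^sup>2 \<le> (real (Suc n) * \<tau>)\<^sup>2"
        using \<tau> by (simp add: power2_eq_square algebra_simps)
      from mult_right_mono[OF this norm_ge_zero[of z]] show ?thesis
        by (simp add: algebra_simps)
    qed
    finally show ?case .
  qed
  have "(\<lambda>n. norm ((S (t / real n) f - f) /\<^sub>R (t / real n) - g)) \<longlonglongrightarrow> norm (g - g)"
    by (rule tendsto_norm[OF tendsto_diff[OF filterlim_compose[OF generator_tendsto[OF fg]
          filterlim_divide_real_at_right[OF t]] tendsto_const]])
  then have "(\<lambda>n. t * norm ((S (t / real n) f - f) /\<^sub>R (t / real n) - g) + t\<^sup>2 * norm z)
      \<longlonglongrightarrow> t * norm (g - g) + t\<^sup>2 * norm z"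
    by (intro tendsto_add tendsto_mult_left tendsto_const)
  moreover have "norm (r t) \<le> t * norm ((S (t / real n) f - f) /\<^sub>R (t / real n) - g) + t\<^sup>2 * norm z"
    if "n \<ge> 1" for n
  proof -
    have "r (t / real n) = (t / real n) *\<^sub>R ((S (t / real n) f - f) /\<^sub>R (t / real n) - g)"
      using t that by (simp add: r_def scaleR_right_diff_distrib)
    then have "real n * norm (r (t / real n))
        = t * norm ((S (t / real n) f - f) /\<^sub>R (t / real n) - g)"
      using t that by simp
    with step[of "t / real n" n] t that show ?thesis by simp
  qed
  ultimately have "norm (r t) \<le> t * norm (g - g) + t\<^sup>2 * norm z"
    by (intro LIMSEQ_le_const) auto
  then show ?thesis by (simp add: r_def)
qed

section \<open>Generation by the implicit Euler scheme\<close>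

text \<open>The hypotheses of the Hille--Yosida theorem for contractions. Density of the domain appears
  as strong convergence of \<open>lam * R lam\<close> to the identity.\<close>
locale contraction_resolvent =
  fixes A :: "('a::banach \<times> 'a) set" and R :: "real \<Rightarrow> 'a \<Rightarrow>\<^sub>L 'a"
  assumes res: "0 < lam \<Longrightarrow> is_resolvent A lam (R lam)"
    and contr: "0 < lam \<Longrightarrow> norm (R lam) \<le> 1 / lam"
    and approx_id: "((\<lambda>lam. lam *\<^sub>R R lam f) \<longlongrightarrow> f) at_top"
begin

text \<open>One implicit Euler step of length \<open>h\<close>, that is \<open>(1 - h A)\<^sup>-\<^sup>1\<close>.\<close>
definition J :: "real \<Rightarrow> 'a \<Rightarrow>\<^sub>L 'a" where
  "J h = (1 / h) *\<^sub>R R (1 / h)"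

lemma J_iff:
  assumes "0 < h"
  shows "(f, g) \<in> A \<longleftrightarrow> J h (f - h *\<^sub>R g) = f"
proof -
  have "(f, (1 / h) *\<^sub>R f - (1 / h) *\<^sub>R (f - h *\<^sub>R g)) \<in> A
      \<longleftrightarrow> f = R (1 / h) ((1 / h) *\<^sub>R (f - h *\<^sub>R g))"
    using res[of "1 / h"] assms unfolding is_resolvent_def by simp
  moreover have "(1 / h) *\<^sub>R f - (1 / h) *\<^sub>R (f - h *\<^sub>R g) = g"
    using assms by (simp add: scaleR_right_diff_distrib)
  moreover have "J h (f - h *\<^sub>R g) = R (1 / h) ((1 / h) *\<^sub>R (f - h *\<^sub>R g))"
    by (simp only: J_def blinfun.scaleR_left blinfun.scaleR_right)
  ultimately show ?thesis by metis
qed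

lemma J_in_graph: "0 < h \<Longrightarrow> (J h f, (1 / h) *\<^sub>R (J h f - f)) \<in> A"
  by (subst J_iff[of h]) auto

lemma norm_J: "0 < h \<Longrightarrow> norm (J h) \<le> 1"
  using contr[of "1 / h"] by (simp add: J_def field_simps)

lemmas norm_J_le = norm_blinfun_le_self[OF norm_J]
lemmas norm_J_diff_le = norm_blinfun_diff_le[OF norm_J]

lemma J_eq:
  assumes "0 < h" "(f, g) \<in> A"
  shows "J h f = f + h *\<^sub>R J h g"
  using J_iff[OF assms(1), of f g] assms(2) by (simp add: blinfun.bilinear_simps algebra_simps)

lemma J_graph:
  assumes "0 < h" "(f, g) \<in> A"
  shows "(J h f, J h g) \<in> A"
  using J_in_graph[OF assms(1), of f] J_eq[OF assms] assms(1) by simp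

lemma tendsto_J: "((\<lambda>h. J h f) \<longlongrightarrow> f) (at_right 0)"
  using filterlim_compose[OF approx_id[of f] filterlim_inverse_at_top_right]
  by (simp add: J_def inverse_eq_divide blinfun.scaleR_left)

text \<open>The vectors in the domain of \<open>A\<^sup>2\<close>, graded by the bound that controls all error terms. The
  steps \<open>J h\<close> commute with \<open>A\<close> and therefore preserve each grade.\<close>
definition D2 :: "real \<Rightarrow> 'a set" where
  "D2 M = {f. \<exists>g z. (f, g) \<in> A \<and> (g, z) \<in> A \<and> norm g \<le> M \<and> norm z \<le> M}"

lemma J_D2:
  assumes "0 < h" "f \<in> D2 M"
  shows "J h f \<in> D2 M"
proof -
  obtain g z where "(f, g) \<in> A" "(g, z) \<in> A" "norm g \<le> M" "norm z \<le> M"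
    using assms(2) by (auto simp: D2_def)
  then have "(J h f, J h g) \<in> A" "(J h g, J h z) \<in> A" "norm (J h g) \<le> M" "norm (J h z) \<le> M"
    using assms(1) by (auto intro: J_graph order_trans[OF norm_J_le])
  then show ?thesis by (auto simp: D2_def)
qed

text \<open>Two Euler steps move every vector into the domain of \<open>A\<^sup>2\<close>. The bound depends only on \<open>h\<close> and the
  norm of \<open>f\<close>, so it is uniform over a family of operators; the convergence theorem relies on this.\<close>
lemma JJ_D2:
  assumes h: "0 < h"
  shows "J h (J h f) \<in> D2 (2 * norm f / h + 4 * norm f / h\<^sup>2)"
proof -
  define v where "v = J h f"
  define w where "w = (1 / h) *\<^sub>R (v - f)"
  have vw: "(v, w) \<in> A"
    using J_in_graph[OF h, of f] by (simp add: v_def w_def)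
  have n: "norm w \<le> 2 * norm f / h"
    using norm_triangle_ineq4[of v f] norm_J_le[OF h, of f] h
    by (auto simp: w_def v_def divide_right_mono)
  define z where "z = (1 / h) *\<^sub>R (J h w - w)"
  have "norm (J h w - w) \<le> 4 * norm f / h"
    using norm_triangle_ineq4[of "J h w" w] norm_J_le[OF h, of w] n by simp
  then have nz: "norm z \<le> 4 * norm f / h\<^sup>2"
    using h unfolding z_def norm_scaleR by (simp add: power2_eq_square field_simps)
  have "(J h v, J h w) \<in> A" "(J h w, z) \<in> A"
    using J_graph[OF h vw] J_in_graph[OF h, of w] by (auto simp: z_def)
  moreover have "norm (J h w) \<le> 2 * norm f / h + 4 * norm f / h\<^sup>2"
    using n norm_J_le[OF h, of w] zero_le_divide_iff[of "4 * norm f" "h\<^sup>2"] by (simp add: add_increasing2)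
  moreover have "norm z \<le> 2 * norm f / h + 4 * norm f / h\<^sup>2"
    using nz h by (intro order_trans[OF nz]) simp
  ultimately show ?thesis
    unfolding D2_def v_def by blast
qed

lemma tendsto_JJ: "((\<lambda>h. J h (J h f)) \<longlongrightarrow> f) (at_right 0)"
proof -
  have "((\<lambda>h. J h (J h f) - J h f) \<longlongrightarrow> 0) (at_right 0)"
  proof (rule tendsto_0_le[where K = 1])
    show "((\<lambda>h. J h f - f) \<longlongrightarrow> 0) (at_right 0)"
      using tendsto_diff[OF tendsto_J[of f] tendsto_const[of f]] by simp
    show "\<forall>\<^sub>F h in at_right 0. norm (J h (J h f) - J h f) \<le> norm (J h f - f) * 1"
      using eventually_at_right_less[of 0] by eventually_elim (simp add: norm_J_diff_le)
  qed
  from tendsto_add[OF this tendsto_J[of f]] show ?thesis by simp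
qed

lemma D2_dense:
  assumes "0 < e"
  obtains M f' where "f' \<in> D2 M" "norm (f - f') < e"
proof -
  have "\<forall>\<^sub>F h in at_right 0. dist (J h (J h f)) f < e"
    using tendsto_JJ assms by (auto simp: tendsto_iff)
  then have "\<forall>\<^sub>F h in at_right 0. dist (J h (J h f)) f < e \<and> 0 < h"
    using eventually_at_right_less[of 0] by eventually_elim auto
  then obtain h where "dist (J h (J h f)) f < e" "0 < h"
    using eventually_happens'[OF trivial_limit_at_right_real] by blast
  then show ?thesis
    using JJ_D2[of h f] by (intro that) (auto simp: dist_norm norm_minus_commute)
qed

lemma J_taylor:
  assumes h: "0 < h" and f: "(f, g) \<in> A" "(g, z) \<in> A" "norm z \<le> M"
  shows "norm (J h f - f - h *\<^sub>R g) \<le> h\<^sup>2 * M"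
proof -
  have "J h f - f - h *\<^sub>R g = h *\<^sub>R (h *\<^sub>R J h z)"
    using J_eq[OF h f(1)] J_eq[OF h f(2)] by (simp add: algebra_simps)
  then have "norm (J h f - f - h *\<^sub>R g) = h\<^sup>2 * norm (J h z)"
    using h by (simp add: power2_eq_square)
  also have "\<dots> \<le> h\<^sup>2 * M"
    using norm_J_le[OF h, of z] f(3) by (intro mult_left_mono) auto
  finally show ?thesis .
qed

text \<open>One step of length \<open>h\<close> and two steps of length \<open>h / 2\<close> have the same first-order expansion
  \<open>f + h A f\<close>.\<close>
lemma J_halving:
  assumes h: "0 < h" and f: "f \<in> D2 M"
  shows "norm (J h f - J (h / 2) (J (h / 2) f)) \<le> 2 * h\<^sup>2 * M"
proof -
  obtain g z where gz: "(f, g) \<in> A" "(g, z) \<in> A" "norm g \<le> M" "norm z \<le> M"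
    using f by (auto simp: D2_def)
  define k where "k = h / 2"
  have k: "0 < k" "h = 2 * k" using h by (auto simp: k_def)
  define r where "r = J k f - f - k *\<^sub>R g"
  have r: "norm r \<le> k\<^sup>2 * M"
    using J_taylor[OF k(1) gz(1,2,4)] by (simp add: r_def)
  have gk: "J k g - g = k *\<^sub>R J k z"
    using J_eq[OF k(1) gz(2)] by simp
  have "J h f - J k (J k f) = (J h f - f - h *\<^sub>R g) - (J k r + r + k *\<^sub>R (J k g - g))"
    by (simp add: r_def k(2) blinfun.bilinear_simps algebra_simps flip: scaleR_2)
  also have "norm \<dots> \<le> norm (J h f - f - h *\<^sub>R g) + (norm (J k r) + norm r + norm (k *\<^sub>R (J k g - g)))"
    by (meson norm_triangle_ineq norm_triangle_ineq4 add_mono order_refl order_trans)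
  also have "\<dots> \<le> h\<^sup>2 * M + (k\<^sup>2 * M + k\<^sup>2 * M + k\<^sup>2 * M)"
  proof (intro add_mono J_taylor[OF h gz(1,2,4)] r order_trans[OF norm_J_le[OF k(1)] r])
    have "norm (J k z) \<le> M"
      using norm_J_le[OF k(1), of z] gz(4) by simp
    then show "norm (k *\<^sub>R (J k g - g)) \<le> k\<^sup>2 * M"
      using k(1) by (simp add: gk power2_eq_square mult_left_mono)
  qed
  also have "\<dots> \<le> 2 * h\<^sup>2 * M"
  proof -
    have "0 \<le> M" using gz(3) norm_ge_zero order_trans by blast
    then have "0 \<le> k\<^sup>2 * M" by simp
    then show ?thesis by (simp add: k(2) power2_eq_square algebra_simps)
  qed
  finally show ?thesis by (simp add: k_def)
qed

text \<open>Euler approximation at time \<open>t\<close> with the step \<open>2\<^sup>-\<^sup>k\<close> fixed independently of \<open>t\<close>. The number of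
  steps is then almost additive in \<open>t\<close>, which yields the semigroup law for all real times at once.\<close>
definition E :: "nat \<Rightarrow> real \<Rightarrow> 'a \<Rightarrow> 'a" where
  "E k t = blinfun_apply (J (1 / 2 ^ k)) ^^ nat \<lfloor>t * 2 ^ k\<rfloor>"

lemma E_contraction: "norm (E k t f - E k t g) \<le> norm (f - g)"
  unfolding E_def by (rule iterate_contraction) (simp add: norm_J_diff_le)

lemma J_power_linear: "linear (blinfun_apply (J h) ^^ n)"
proof (induction n)
  case 0
  then show ?case using linear_id by (simp add: id_def)
next
  case (Suc n)
  then show ?case
    using linear_compose[OF Suc bounded_linear.linear[OF blinfun.bounded_linear_right, of "J h"]]
    by (simp add: o_def)
qed

lemma E_linear: "linear (E k t)"
  unfolding E_def by (rule J_power_linear)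

text \<open>Halving the step doubles the number of steps up to one additional step: the former costs
  \<open>J_halving\<close> for each of at most \<open>t 2\<^sup>k\<close> steps, the latter the length of a step times the norm of
  \<open>A f\<close>. The total is summable in \<open>k\<close>.\<close>
lemma E_step:
  assumes t: "0 \<le> t" and f: "f \<in> D2 M"
  shows "norm (E (Suc k) t f - E k t f) \<le> (2 * t + 1) * M * (1 / 2) ^ k"
proof -
  define h :: real where "h = 1 / 2 ^ k"
  have h: "0 < h" "h / 2 = 1 / 2 ^ Suc k" by (auto simp: h_def)
  define n where "n = nat \<lfloor>t * 2 ^ k\<rfloor>"
  define n' where "n' = nat \<lfloor>t * 2 ^ Suc k\<rfloor>"
  obtain g z where gz: "(f, g) \<in> A" "(g, z) \<in> A" "norm g \<le> M" "norm z \<le> M"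
    using f by (auto simp: D2_def)
  have M: "0 \<le> M" using gz(3) norm_ge_zero order_trans by blast
  let ?K = "blinfun_apply (J (h / 2))"
  have n': "n' = 2 * n \<or> n' = Suc (2 * n)"
    using t unfolding n_def n'_def by (simp add: algebra_simps) linarith
  have "real n \<le> t * 2 ^ k"
    using t by (simp add: n_def)
  then have nh: "real n * h \<le> t"
    by (simp add: h_def field_simps)
  have pow2: "(?K ^^ (2 * n)) f = ((?K \<circ> ?K) ^^ n) f"
    by (induction n) auto
  have "norm ((blinfun_apply (J h) ^^ n) f - ((?K \<circ> ?K) ^^ n) f) \<le> real n * (2 * h\<^sup>2 * M)"
    using h(1) by (intro iterate_close[where Z = "D2 M"] norm_J_diff_le f) (auto intro!: J_D2 J_halving)
  also have "\<dots> = 2 * (real n * h) * M * h"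
    by (simp add: power2_eq_square)
  also have "\<dots> \<le> 2 * t * M * h"
    using nh M h by (intro mult_right_mono mult_left_mono) auto
  finally have 1: "norm ((blinfun_apply (J h) ^^ n) f - (?K ^^ (2 * n)) f) \<le> 2 * t * M * h"
    by (simp add: pow2)
  have 2: "norm ((?K ^^ (2 * n)) f - (?K ^^ n') f) \<le> M * h"
  proof (cases "n' = 2 * n")
    case True
    then show ?thesis using M h by simp
  next
    case False
    with n' have e: "n' = Suc (2 * n)" by simp
    have "norm ((?K ^^ (2 * n)) f - (?K ^^ (2 * n)) (?K f)) \<le> norm (f - ?K f)"
      using h(1) by (intro iterate_contraction norm_J_diff_le) auto
    also have "\<dots> = (h / 2) * norm (J (h / 2) g)"
      using J_eq[OF _ gz(1), of "h / 2"] h(1) by simp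
    also have "\<dots> \<le> h * M"
      using h(1) norm_J_le[of "h / 2" g] gz(3) by (intro mult_mono) auto
    finally show ?thesis
      unfolding e by (simp only: funpow_Suc_right o_apply mult.commute)
  qed
  have "E (Suc k) t f - E k t f = - (((blinfun_apply (J h) ^^ n) f - (?K ^^ (2 * n)) f)
      + ((?K ^^ (2 * n)) f - (?K ^^ n') f))"
    unfolding E_def h(2) n_def n'_def by (simp add: h_def)
  also have "norm \<dots> \<le> 2 * t * M * h + M * h"
    unfolding norm_minus_cancel by (intro norm_triangle_le add_mono 1 2)
  finally show ?thesis
    by (simp add: h_def field_simps power_divide)
qed

lemma E_convergent_D2:
  assumes t: "0 \<le> t" and f: "f \<in> D2 M"
  shows "convergent (\<lambda>k. E k t f)"
proof -
  have "summable (\<lambda>k. (2 * t + 1) * M * (1 / 2 :: real) ^ k)"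
    by (intro summable_mult) simp
  then have "summable (\<lambda>k. E (Suc k) t f - E k t f)"
    using E_step[OF t f] by (rule summable_comparison_test'[of _ 0])
  then have "convergent (\<lambda>n. E 0 t f + (\<Sum>k<n. E (Suc k) t f - E k t f))"
    by (intro convergent_add convergent_const) (simp add: summable_iff_convergent)
  then show ?thesis
    by (simp add: sum_lessThan_telescope[of "\<lambda>k. E k t f"])
qed

lemma E_convergent:
  assumes t: "0 \<le> t"
  shows "convergent (\<lambda>k. E k t f)"
proof (rule Cauchy_convergent, rule metric_CauchyI)
  fix e :: real assume e: "0 < e"
  obtain M f' where f': "f' \<in> D2 M" "norm (f - f') < e / 3"
    using D2_dense[OF divide_pos_pos[OF e zero_less_numeral]] by blast
  have "Cauchy (\<lambda>k. E k t f')"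
    by (rule convergent_Cauchy[OF E_convergent_D2[OF t f'(1)]])
  then obtain N where N: "\<And>m n. m \<ge> N \<Longrightarrow> n \<ge> N \<Longrightarrow> dist (E m t f') (E n t f') < e / 3"
    using metric_CauchyD[of "\<lambda>k. E k t f'" "e / 3"] e by auto
  have close: "dist (E m t f) (E m t f') < e / 3" for m
    using E_contraction[of m t f f'] f'(2) by (simp add: dist_norm)
  have "dist (E m t f) (E n t f) < e" if "m \<ge> N" "n \<ge> N" for m n
    using close[of n] by (intro dist_triangle_third[OF close N[OF that]]) (simp add: dist_commute)
  then show "\<exists>N. \<forall>m\<ge>N. \<forall>n\<ge>N. dist (E m t f) (E n t f) < e" by blast
qed

definition T :: "real \<Rightarrow> 'a \<Rightarrow>\<^sub>L 'a" where
  "T t = Blinfun (\<lambda>f. lim (\<lambda>k. E k t f))"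

lemma T_aux:
  assumes t: "0 \<le> t"
  shows "(\<lambda>k. E k t f) \<longlonglongrightarrow> T t f" and "norm (T t) \<le> 1"
proof -
  let ?L = "\<lambda>f. lim (\<lambda>k. E k t f)"
  have L: "(\<lambda>k. E k t f) \<longlonglongrightarrow> ?L f" for f
    using E_convergent[OF t, of f] unfolding convergent_LIMSEQ_iff .
  have n: "norm (?L f) \<le> norm f" for f
  proof (rule LIMSEQ_le_const2[OF tendsto_norm[OF L]])
    show "\<exists>N. \<forall>k\<ge>N. norm (E k t f) \<le> norm f"
      using E_contraction[of _ t f 0] linear_0[OF E_linear] by auto
  qed
  have "bounded_linear ?L"
  proof (rule bounded_linear_intro[where K = 1])
    fix f g
    show "?L (f + g) = ?L f + ?L g"
      using tendsto_add[OF L[of f] L[of g]] L[of "f + g"]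
      by (intro LIMSEQ_unique[OF L[of "f + g"]]) (simp add: linear_add[OF E_linear])
  next
    fix r f
    show "?L (r *\<^sub>R f) = r *\<^sub>R ?L f"
      using tendsto_scaleR[OF tendsto_const[of r] L[of f]]
      by (intro LIMSEQ_unique[OF L[of "r *\<^sub>R f"]]) (simp add: linear_scale[OF E_linear])
  qed (simp add: n)
  then have T: "blinfun_apply (T t) = ?L"
    unfolding T_def by (rule bounded_linear_Blinfun_apply)
  then show "(\<lambda>k. E k t f) \<longlonglongrightarrow> T t f" using L by simp
  show "norm (T t) \<le> 1"
    by (rule norm_blinfun_bound) (auto simp: T n)
qed

lemmas T_lim = T_aux(1)
lemmas norm_T = T_aux(2)

lemma blinfun_eq_on_D2:
  fixes P Q :: "'a \<Rightarrow>\<^sub>L 'a"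
  assumes "\<And>f M. f \<in> D2 M \<Longrightarrow> P f = Q f"
  shows "P = Q"
proof (rule blinfun_eqI)
  fix f
  have lim: "((\<lambda>h. B (J h (J h f))) \<longlongrightarrow> B f) (at_right 0)" for B :: "'a \<Rightarrow>\<^sub>L 'a"
    by (intro tendsto_intros tendsto_JJ)
  have "\<forall>\<^sub>F h in at_right 0. P (J h (J h f)) = Q (J h (J h f))"
    using eventually_at_right_less[of 0] by eventually_elim (rule assms, rule JJ_D2)
  then show "P f = Q f"
    using tendsto_unique[OF trivial_limit_at_right_real Lim_transform_eventually[OF lim[of P]] lim[of Q]]
    by simp
qed

lemma J_power_lipschitz:
  assumes "0 < h" "(f, g) \<in> A"
  shows "norm ((blinfun_apply (J h) ^^ n) f - f) \<le> real n * h * norm g"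
proof -
  have "norm ((blinfun_apply (J h) ^^ n) f - f) \<le> real n * norm (J h f - f)"
    using assms by (intro iterate_close_id norm_J_diff_le)
  also have "\<dots> = real n * h * norm (J h g)"
    using J_eq[OF assms] assms(1) by simp
  also have "\<dots> \<le> real n * h * norm g"
    using assms(1) by (intro mult_left_mono norm_J_le) auto
  finally show ?thesis .
qed

lemma nat_floor_add:
  fixes x y :: real
  assumes "0 \<le> x" "0 \<le> y"
  shows "nat \<lfloor>x + y\<rfloor> = nat \<lfloor>x\<rfloor> + nat \<lfloor>y\<rfloor> \<or> nat \<lfloor>x + y\<rfloor> = Suc (nat \<lfloor>x\<rfloor> + nat \<lfloor>y\<rfloor>)"
proof -
  have "\<lfloor>x + y\<rfloor> = \<lfloor>x\<rfloor> + \<lfloor>y\<rfloor> \<or> \<lfloor>x + y\<rfloor> = \<lfloor>x\<rfloor> + \<lfloor>y\<rfloor> + 1"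
    by linarith
  moreover have "0 \<le> \<lfloor>x\<rfloor>" "0 \<le> \<lfloor>y\<rfloor>" using assms by auto
  ultimately show ?thesis by (auto simp: nat_add_distrib)
qed

text \<open>The two sides are limits of Euler approximations whose numbers of steps differ by at most
  one.\<close>
lemma T_add:
  assumes s: "0 \<le> s" and t: "0 \<le> t"
  shows "T (s + t) = T s o\<^sub>L T t"
proof (rule blinfun_eq_on_D2)
  fix f M assume f: "f \<in> D2 M"
  obtain g z where gz: "(f, g) \<in> A" "(g, z) \<in> A" "norm g \<le> M" "norm z \<le> M"
    using f by (auto simp: D2_def)
  have M: "0 \<le> M" using gz(3) norm_ge_zero order_trans by blast
  have "(\<lambda>k. E k s (E k t f) - E k s (T t f)) \<longlonglongrightarrow> 0"
  proof (rule tendsto_0_le[where K = 1])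
    show "(\<lambda>k. E k t f - T t f) \<longlonglongrightarrow> 0"
      by (rule LIM_zero[OF T_lim[OF t]])
  qed (simp add: E_contraction)
  from tendsto_add[OF this T_lim[OF s, of "T t f"]]
  have 1: "(\<lambda>k. E k s (E k t f)) \<longlonglongrightarrow> T s (T t f)" by simp
  have 2: "norm (E k (s + t) f - E k s (E k t f)) \<le> M * (1 / 2) ^ k" for k
  proof -
    define h :: real where "h = 1 / 2 ^ k"
    have h: "0 < h" by (simp add: h_def)
    let ?J = "blinfun_apply (J h)"
    define n where "n = nat \<lfloor>s * 2 ^ k\<rfloor> + nat \<lfloor>t * 2 ^ k\<rfloor>"
    have n: "nat \<lfloor>(s + t) * 2 ^ k\<rfloor> = n \<or> nat \<lfloor>(s + t) * 2 ^ k\<rfloor> = Suc n"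
      unfolding n_def distrib_right using s t by (intro nat_floor_add) auto
    have E2: "E k s (E k t f) = (?J ^^ n) f"
      by (simp add: E_def n_def h_def funpow_add)
    from n show ?thesis
    proof
      assume "nat \<lfloor>(s + t) * 2 ^ k\<rfloor> = n"
      then have "E k (s + t) f = (?J ^^ n) f" by (simp add: E_def h_def)
      then show ?thesis using E2 M by simp
    next
      assume "nat \<lfloor>(s + t) * 2 ^ k\<rfloor> = Suc n"
      then have "E k (s + t) f = (?J ^^ n) (?J f)"
        by (simp add: E_def h_def funpow_Suc_right del: funpow.simps)
      then have "norm (E k (s + t) f - E k s (E k t f)) \<le> norm (?J f - f)"
        unfolding E2 using h by (auto intro: iterate_contraction norm_J_diff_le)
      also have "\<dots> \<le> h * M"
        using J_power_lipschitz[OF h gz(1), of 1] gz(3) h by (auto intro: order_trans mult_left_mono)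
      finally show ?thesis by (simp add: h_def power_divide mult.commute)
    qed
  qed
  have "(\<lambda>k. M * (1 / 2 :: real) ^ k) \<longlonglongrightarrow> M * 0"
    by (rule tendsto_mult_left[OF LIMSEQ_power_zero]) simp
  then have "(\<lambda>k. E k (s + t) f - E k s (E k t f)) \<longlonglongrightarrow> 0"
    unfolding mult_zero_right by (rule Lim_null_comparison[rotated]) (rule always_eventually, rule allI, rule 2)
  from tendsto_add[OF this 1]
  have "(\<lambda>k. E k (s + t) f) \<longlonglongrightarrow> T s (T t f)" by simp
  from LIMSEQ_unique[OF this T_lim] s t show "T (s + t) f = (T s o\<^sub>L T t) f" by simp
qed

lemma floor_dyadic_tendsto:
  assumes "0 \<le> t"
  shows "(\<lambda>k. real (nat \<lfloor>t * 2 ^ k\<rfloor>) * (1 / 2 ^ k)) \<longlonglongrightarrow> t"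
proof (rule real_tendsto_sandwich)
  have "(\<lambda>k. t - (1 / 2 :: real) ^ k) \<longlonglongrightarrow> t - 0"
    by (rule tendsto_diff[OF tendsto_const LIMSEQ_power_zero]) simp
  then show "(\<lambda>k. t - (1 / 2 :: real) ^ k) \<longlonglongrightarrow> t" by simp
  have fl: "real (nat \<lfloor>t * 2 ^ k\<rfloor>) = of_int \<lfloor>t * 2 ^ k\<rfloor>" for k
    using assms by simp
  have "t - (1 / 2 :: real) ^ k \<le> real (nat \<lfloor>t * 2 ^ k\<rfloor>) * (1 / 2 ^ k)" for k
  proof -
    have "t * 2 ^ k - 1 \<le> of_int \<lfloor>t * 2 ^ k\<rfloor>" by linarith
    then have "(t * 2 ^ k - 1) * (1 / 2 ^ k) \<le> of_int \<lfloor>t * 2 ^ k\<rfloor> * (1 / 2 ^ k)"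
      by (intro mult_right_mono) auto
    moreover have "(t * 2 ^ k - 1) * (1 / 2 ^ k) = t - (1 / 2 :: real) ^ k"
      by (simp add: diff_divide_distrib power_one_over)
    ultimately show ?thesis unfolding fl by simp
  qed
  then show "\<forall>\<^sub>F k in sequentially. t - (1 / 2 :: real) ^ k \<le> real (nat \<lfloor>t * 2 ^ k\<rfloor>) * (1 / 2 ^ k)"
    by simp
  have "real (nat \<lfloor>t * 2 ^ k\<rfloor>) * (1 / 2 ^ k) \<le> t" for k
    unfolding fl by (simp add: field_simps)
  then show "\<forall>\<^sub>F k in sequentially. real (nat \<lfloor>t * 2 ^ k\<rfloor>) * (1 / 2 ^ k) \<le> t"
    by simp
qed simp

lemma J_power_diff:
  assumes h: "0 < h" and gz: "(g', z) \<in> A"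
  shows "norm ((blinfun_apply (J h) ^^ n) g - g) \<le> 2 * norm (g - g') + real n * h * norm z"
proof -
  let ?P = "blinfun_apply (J h) ^^ n"
  have "?P g - g = (?P g - ?P g') + (?P g' - g') + (g' - g)" by simp
  also have "norm \<dots> \<le> norm (?P g - ?P g') + norm (?P g' - g') + norm (g' - g)"
    by (meson norm_triangle_ineq add_mono order_refl order_trans)
  also have "\<dots> \<le> norm (g - g') + real n * h * norm z + norm (g - g')"
    using h by (intro add_mono iterate_contraction J_power_lipschitz gz norm_J_diff_le)
      (auto simp: norm_minus_commute)
  finally show ?thesis by simp
qed

lemma T_diff:
  assumes t: "0 \<le> t" and gz: "(g', z) \<in> A"
  shows "norm (T t g - g) \<le> 2 * norm (g - g') + t * norm z"
proof (rule LIMSEQ_le)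
  show "(\<lambda>k. norm (E k t g - g)) \<longlonglongrightarrow> norm (T t g - g)"
    by (intro tendsto_intros T_lim t)
  show "(\<lambda>k. 2 * norm (g - g') + real (nat \<lfloor>t * 2 ^ k\<rfloor>) * (1 / 2 ^ k) * norm z)
      \<longlonglongrightarrow> 2 * norm (g - g') + t * norm z"
    by (intro tendsto_intros floor_dyadic_tendsto t)
  show "\<exists>N. \<forall>k\<ge>N. norm (E k t g - g)
      \<le> 2 * norm (g - g') + real (nat \<lfloor>t * 2 ^ k\<rfloor>) * (1 / 2 ^ k) * norm z"
    unfolding E_def using J_power_diff[OF _ gz, of "1 / 2 ^ _"] by auto
qed

text \<open>The vector \<open>g = A f\<close> need not lie in the domain of \<open>A\<close>, so it is compared with some \<open>g'\<close>
  that does; \<open>g'\<close> is chosen close to \<open>g\<close> when the lemma is applied.\<close>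
lemma T_taylor:
  assumes t: "0 \<le> t" and fg: "(f, g) \<in> A" and gz: "(g', z) \<in> A"
  shows "norm (T t f - f - t *\<^sub>R g) \<le> t * (2 * norm (g - g') + t * norm z)"
proof -
  have J: "norm ((blinfun_apply (J h) ^^ n) f - f - (real n * h) *\<^sub>R g)
      \<le> real n * h * (2 * norm (g - g') + real n * h * norm z)" if h: "0 < h" for h n
  proof (induction n)
    case (Suc n)
    let ?P = "blinfun_apply (J h) ^^ n"
    have "?P (J h f) = ?P f + h *\<^sub>R ?P (J h g)"
      using J_eq[OF h fg] by (simp add: linear_add[OF J_power_linear] linear_scale[OF J_power_linear])
    then have "(blinfun_apply (J h) ^^ Suc n) f - f - (real (Suc n) * h) *\<^sub>R g
      = h *\<^sub>R ((blinfun_apply (J h) ^^ Suc n) g - g) + (?P f - f - (real n * h) *\<^sub>R g)"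
      by (simp only: funpow_Suc_right o_apply) (simp add: algebra_simps)
    also have "norm \<dots> \<le> h * (2 * norm (g - g') + real (Suc n) * h * norm z)
        + real n * h * (2 * norm (g - g') + real n * h * norm z)"
      using J_power_diff[OF h gz, of "Suc n" g] h Suc
      by (intro norm_triangle_le add_mono) (auto intro!: mult_left_mono simp del: funpow.simps of_nat_Suc)
    also have "\<dots> \<le> h * (2 * norm (g - g') + real (Suc n) * h * norm z)
        + real n * h * (2 * norm (g - g') + real (Suc n) * h * norm z)"
      using h by (intro add_left_mono mult_left_mono mult_right_mono) auto
    finally show ?case by (simp add: algebra_simps)
  qed simp
  show ?thesis
  proof (rule LIMSEQ_le)
    let ?r = "\<lambda>k. real (nat \<lfloor>t * 2 ^ k\<rfloor>) * (1 / 2 ^ k)"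
    show "(\<lambda>k. norm (E k t f - f - ?r k *\<^sub>R g)) \<longlonglongrightarrow> norm (T t f - f - t *\<^sub>R g)"
      by (intro tendsto_intros T_lim t floor_dyadic_tendsto)
    show "(\<lambda>k. ?r k * (2 * norm (g - g') + ?r k * norm z))
        \<longlonglongrightarrow> t * (2 * norm (g - g') + t * norm z)"
      by (intro tendsto_intros floor_dyadic_tendsto t)
    show "\<exists>N. \<forall>k\<ge>N. norm (E k t f - f - ?r k *\<^sub>R g) \<le> ?r k * (2 * norm (g - g') + ?r k * norm z)"
      unfolding E_def using J[of "1 / 2 ^ _"] by auto
  qed
qed

lemma graph_dense:
  assumes "0 < e"
  obtains g' z where "(g', z) \<in> A" "norm (g - g') < e"
proof -
  obtain M g' where "g' \<in> D2 M" "norm (g - g') < e"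
    by (rule D2_dense[OF assms])
  then show ?thesis by (auto simp: D2_def intro: that)
qed

lemma T_strongly_continuous: "((\<lambda>t. T t f) \<longlongrightarrow> f) (at_right 0)"
  unfolding tendsto_iff
proof (intro allI impI)
  fix e :: real assume e: "0 < e"
  obtain g' z where gz: "(g', z) \<in> A" "norm (f - g') < e / 4"
    using graph_dense[of "e / 4" f] e by auto
  have "((\<lambda>t. t * norm z) \<longlongrightarrow> 0 * norm z) (at_right 0)"
    by (intro tendsto_intros)
  then have "\<forall>\<^sub>F t in at_right 0. t * norm z < e / 2"
    using e by (intro order_tendstoD) auto
  then show "\<forall>\<^sub>F t in at_right 0. dist (T t f) f < e"
    using eventually_at_right_less[of 0]
  proof eventually_elim
    case (elim t)
    with T_diff[OF _ gz(1), of t f] gz(2) show ?case by (simp add: dist_norm)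
  qed
qed

lemma contraction_semigroup_T: "contraction_semigroup T"
proof -
  have "T 0 = id_blinfun"
    using T_lim[of 0] by (intro blinfun_eqI) (simp add: E_def LIMSEQ_const_iff)
  then show ?thesis
    by (simp add: contraction_semigroup_def T_add T_strongly_continuous norm_T)
qed

lemma graph_subset_generator_T: "A \<subseteq> generator T"
proof clarify
  fix f g assume fg: "(f, g) \<in> A"
  have "((\<lambda>t. (T t f - f) /\<^sub>R t) \<longlongrightarrow> g) (at_right 0)"
    unfolding tendsto_iff
  proof (intro allI impI)
    fix e :: real assume e: "0 < e"
    obtain g' z where gz: "(g', z) \<in> A" "norm (g - g') < e / 4"
      using graph_dense[of "e / 4" g] e by auto
    have "((\<lambda>t. t * norm z) \<longlongrightarrow> 0 * norm z) (at_right 0)"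
      by (intro tendsto_intros)
    then have "\<forall>\<^sub>F t in at_right 0. t * norm z < e / 2"
      using e by (intro order_tendstoD) auto
    then show "\<forall>\<^sub>F t in at_right 0. dist ((T t f - f) /\<^sub>R t) g < e"
      using eventually_at_right_less[of 0]
    proof eventually_elim
      case (elim t)
      have "norm ((T t f - f) /\<^sub>R t - g) = norm (T t f - f - t *\<^sub>R g) / t"
        using elim by (intro norm_difference_quotient) auto
      also have "\<dots> \<le> 2 * norm (g - g') + t * norm z"
        using T_taylor[OF _ fg gz(1), of t] elim by (simp add: field_simps)
      finally show ?case
        using elim gz(2) by (simp add: dist_norm)
    qed
  qed
  then show "(f, g) \<in> generator T" by (simp add: generator_def)
qed

end

text \<open>Along such a \<open>w\<close> the semigroup would expand at rate \<open>lam\<close>, contradicting contractivity.\<close>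
lemma generator_eigenvector_zero:
  assumes S: "contraction_semigroup S" and w: "(w, lam *\<^sub>R w) \<in> generator S" and lam: "0 < lam"
  shows "w = 0"
proof -
  have lim: "((\<lambda>t. norm (S t w - w - t *\<^sub>R (lam *\<^sub>R w)) / t) \<longlongrightarrow> 0) (at_right 0)"
  proof -
    have "((\<lambda>t. norm ((S t w - w) /\<^sub>R t - lam *\<^sub>R w)) \<longlongrightarrow> 0) (at_right 0)"
      using tendsto_norm[OF tendsto_diff[OF generator_tendsto[OF w] tendsto_const[of "lam *\<^sub>R w"]]]
      by simp
    then show ?thesis
    proof (rule Lim_transform_eventually)
      show "\<forall>\<^sub>F t in at_right 0. norm ((S t w - w) /\<^sub>R t - lam *\<^sub>R w)
          = norm (S t w - w - t *\<^sub>R (lam *\<^sub>R w)) / t"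
        using eventually_at_right_less[of 0]
      proof eventually_elim
        case (elim t)
        then show ?case by (rule norm_difference_quotient)
      qed
    qed
  qed
  have "\<forall>\<^sub>F t in at_right 0. lam * norm w \<le> norm (S t w - w - t *\<^sub>R (lam *\<^sub>R w)) / t"
    using eventually_at_right_less[of 0]
  proof eventually_elim
    case (elim t)
    have "norm (S t w) \<le> norm w"
      using S elim by (intro norm_blinfun_le_self) (auto simp: contraction_semigroup_def)
    moreover have "norm (w + t *\<^sub>R (lam *\<^sub>R w)) = (1 + t * lam) * norm w"
    proof -
      have "w + t *\<^sub>R (lam *\<^sub>R w) = (1 + t * lam) *\<^sub>R w" by (simp add: algebra_simps)
      then show ?thesis using elim lam by (simp del: scaleR_scaleR)
    qed
    moreover have "norm (w + t *\<^sub>R (lam *\<^sub>R w))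
        \<le> norm (S t w) + norm (S t w - w - t *\<^sub>R (lam *\<^sub>R w))"
      by (metis diff_diff_eq norm_minus_commute norm_triangle_sub)
    ultimately have "t * (lam * norm w) \<le> norm (S t w - w - t *\<^sub>R (lam *\<^sub>R w))"
      by (simp add: algebra_simps)
    then show ?case using elim by (simp add: field_simps)
  qed
  then have "lam * norm w \<le> 0"
    by (rule tendsto_lowerbound[OF lim]) simp
  with lam show ?thesis by (simp add: mult_le_0_iff)
qed

lemma generator_diff:
  assumes "(f, g) \<in> generator S" "(f', g') \<in> generator S"
  shows "(f - f', g - g') \<in> generator S"
  using tendsto_diff[of _ g _ _ g'] assms
  unfolding generator_def by (fastforce simp: blinfun.bilinear_simps algebra_simps)

context contraction_resolvent
begin

text \<open>The generator cannot properly extend \<open>A\<close>: as \<open>1 - A\<close> is already onto, a proper extension would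
  make \<open>1 - generator T\<close> fail to be injective.\<close>
theorem generator_T: "generator T = A"
proof
  show "A \<subseteq> generator T" by (rule graph_subset_generator_T)
  show "generator T \<subseteq> A"
  proof clarify
    fix f g assume fg: "(f, g) \<in> generator T"
    define f' where "f' = J 1 (f - g)"
    have f': "(f', f' - (f - g)) \<in> A"
      using J_in_graph[of 1 "f - g"] by (simp add: f'_def)
    then have "(f - f', g - (f' - (f - g))) \<in> generator T"
      using fg graph_subset_generator_T by (intro generator_diff) auto
    then have "(f - f', 1 *\<^sub>R (f - f')) \<in> generator T"
      by (simp add: algebra_simps)
    then have "f = f'"
      using generator_eigenvector_zero[OF contraction_semigroup_T, of "f - f'" 1] by simp
    with f' show "(f, g) \<in> A" by simp
  qed
qed

text \<open>The Euler scheme approximates every contraction semigroup generated by \<open>A\<close>, with an error bound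
  in which \<open>A\<close> and the semigroup occur only through \<open>M\<close>. Uniqueness follows with \<open>h \<rightarrow> 0\<close>, and the
  convergence theorem by keeping \<open>h\<close> fixed while the operator varies.\<close>
lemma semigroup_euler:
  assumes S: "contraction_semigroup S" "generator S = A"
    and t: "0 \<le> t" and h: "0 < h" and f: "f \<in> D2 M"
  shows "norm (S t f - (blinfun_apply (J h) ^^ nat \<lfloor>t / h\<rfloor>) f) \<le> (2 * t + 1) * h * M"
proof -
  define n where "n = nat \<lfloor>t / h\<rfloor>"
  have n: "real n * h \<le> t" "t - real n * h \<le> h"
  proof -
    have "real n = of_int \<lfloor>t / h\<rfloor>" using t h by (simp add: n_def)
    then have "real n \<le> t / h" "t / h - real n \<le> 1" by linarith+
    then show "real n * h \<le> t" "t - real n * h \<le> h" using h by (auto simp: field_simps)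
  qed
  obtain g z where gz: "(f, g) \<in> A" "(g, z) \<in> A" "norm g \<le> M" "norm z \<le> M"
    using f by (auto simp: D2_def)
  have M: "0 \<le> M" using gz(3) norm_ge_zero order_trans by blast
  have contr: "norm (S r) \<le> 1" if "0 \<le> r" for r
    using S that by (simp add: contraction_semigroup_def)
  have close: "norm (S h f' - J h f') \<le> 2 * h\<^sup>2 * M" if f': "f' \<in> D2 M" for f'
  proof -
    obtain g z where gz: "(f', g) \<in> A" "(g, z) \<in> A" "norm g \<le> M" "norm z \<le> M"
      using f' by (auto simp: D2_def)
    have "norm (S h f' - f' - h *\<^sub>R g) \<le> h\<^sup>2 * norm z"
      using gz h S by (intro semigroup_taylor) auto
    also have "\<dots> \<le> h\<^sup>2 * M" using gz by (intro mult_left_mono) auto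
    finally have "norm ((S h f' - f' - h *\<^sub>R g) - (J h f' - f' - h *\<^sub>R g)) \<le> h\<^sup>2 * M + h\<^sup>2 * M"
      by (rule order_trans[OF norm_triangle_ineq4 add_mono[OF _ J_taylor[OF h gz(1,2,4)]]])
    then show ?thesis by (simp add: algebra_simps)
  qed
  have "norm ((blinfun_apply (S h) ^^ n) f - (blinfun_apply (J h) ^^ n) f) \<le> real n * (2 * h\<^sup>2 * M)"
    using h by (intro iterate_close[where Z = "D2 M"] norm_blinfun_diff_le contr J_D2 f close) auto
  also have "\<dots> = 2 * (real n * h) * h * M"
    by (simp add: power2_eq_square)
  also have "\<dots> \<le> 2 * t * h * M"
    using n M h by (intro mult_right_mono mult_left_mono) auto
  finally have 1: "norm (S (real n * h) f - (blinfun_apply (J h) ^^ n) f) \<le> 2 * t * h * M"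
    using contraction_semigroup_power[OF S(1), of h n f] h by simp
  have "S (real n * h + (t - real n * h)) = S (real n * h) o\<^sub>L S (t - real n * h)"
    using S(1) n(1) h unfolding contraction_semigroup_def by (meson diff_ge_0_iff_ge mult_nonneg_nonneg of_nat_0_le_iff less_imp_le)
  then have "norm (S t f - S (real n * h) f) \<le> norm (S (t - real n * h) f - f)"
    using norm_blinfun_diff_le[OF contr, of "real n * h"] h by simp
  also have "\<dots> \<le> (t - real n * h) * norm g"
    using n gz S by (intro semigroup_lipschitz) auto
  also have "\<dots> \<le> h * M"
    using n gz h by (intro mult_mono) auto
  finally have "norm ((S t f - S (real n * h) f)
      + (S (real n * h) f - (blinfun_apply (J h) ^^ n) f)) \<le> h * M + 2 * t * h * M"
    using 1 by (intro norm_triangle_le add_mono)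
  then show ?thesis by (simp add: n_def algebra_simps)
qed

lemma semigroup_unique:
  assumes S: "contraction_semigroup S" "generator S = A" and t: "0 \<le> t"
  shows "S t = T t"
proof (rule blinfun_eq_on_D2)
  fix f M assume f: "f \<in> D2 M"
  have "norm (S t f - T t f) \<le> 2 * (2 * t + 1) * M * h" if h: "0 < h" for h
  proof -
    let ?e = "(blinfun_apply (J h) ^^ nat \<lfloor>t / h\<rfloor>) f"
    have "norm ((S t f - ?e) - (T t f - ?e)) \<le> (2 * t + 1) * h * M + (2 * t + 1) * h * M"
      by (intro order_trans[OF norm_triangle_ineq4] add_mono semigroup_euler S t h f
          contraction_semigroup_T generator_T)
    then show ?thesis by (simp add: algebra_simps)
  qed
  then have "\<forall>\<^sub>F h in at_right 0. norm (S t f - T t f) \<le> 2 * (2 * t + 1) * M * h"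
    using eventually_at_right_less[of 0] by (rule eventually_mono[rotated])
  moreover have "((\<lambda>h. 2 * (2 * t + 1) * M * h) \<longlongrightarrow> 2 * (2 * t + 1) * M * 0) (at_right 0)"
    by (intro tendsto_intros)
  ultimately have "norm (S t f - T t f) \<le> 2 * (2 * t + 1) * M * 0"
    by (intro tendsto_lowerbound[of _ _ "at_right 0"]) auto
  then show "S t f = T t f" by simp
qed

end

section \<open>Convergence of semigroups\<close>

text \<open>Strong convergence of resolvents implies strong convergence of semigroups. For a fixed step \<open>h\<close>
  the finitely many Euler iterates needed up to time \<open>t\<close> converge with the resolvents,
  and the distance from the iterates to the semigroups is small uniformly in \<open>\<epsilon>\<close> by
  \<open>semigroup_euler\<close>. Since the domains vary with \<open>\<epsilon>\<close>, the initial vector is smoothed by each operator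
  separately, giving the vectors \<open>f\<epsilon>\<close>.\<close>
theorem trotter_kato:
  fixes A :: "'e \<Rightarrow> ('a::banach \<times> 'a) set" and R' :: "real \<Rightarrow> 'a \<Rightarrow>\<^sub>L 'a"
  assumes R: "\<forall>\<^sub>F \<epsilon> in F. contraction_resolvent (A \<epsilon>) (R \<epsilon>) \<and>
       contraction_semigroup (S \<epsilon>) \<and> generator (S \<epsilon>) = A \<epsilon>"
    and R': "contraction_resolvent A' R'"
    and S': "contraction_semigroup S'" "generator S' = A'"
    and lim: "\<And>lam f. 0 < lam \<Longrightarrow> ((\<lambda>\<epsilon>. R \<epsilon> lam f) \<longlongrightarrow> R' lam f) F"
    and st: "0 \<le> s" "s \<le> t"
  shows "uniform_limit {s..t} (\<lambda>\<epsilon> r. S \<epsilon> r f) (\<lambda>r. S' r f) F"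
  unfolding uniform_limit_iff
proof (intro allI impI)
  fix e :: real assume e: "0 < e"
  interpret L: contraction_resolvent A' R' by (rule R')
  define J where "J = (\<lambda>\<epsilon> h. (1 / h) *\<^sub>R R \<epsilon> (1 / h))"
  have J_eq: "contraction_resolvent.J (R \<epsilon>) = J \<epsilon>"
    if "contraction_resolvent (A \<epsilon>) (R \<epsilon>)" for \<epsilon>
    using contraction_resolvent.J_def[OF that] by (simp add: J_def fun_eq_iff)
  have tendsto_Jg: "((\<lambda>\<epsilon>. J \<epsilon> h (g \<epsilon>)) \<longlongrightarrow> L.J h g') F"
    if h: "0 < h" and g: "(g \<longlongrightarrow> g') F" for h g g'
  proof -
    have "((\<lambda>\<epsilon>. J \<epsilon> h (g \<epsilon>) - J \<epsilon> h g') \<longlongrightarrow> 0) F"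
    proof (rule tendsto_0_le[where K = 1 and f = "\<lambda>\<epsilon>. g \<epsilon> - g'"])
      show "((\<lambda>\<epsilon>. g \<epsilon> - g') \<longlongrightarrow> 0) F" using g by (rule LIM_zero)
      show "\<forall>\<^sub>F \<epsilon> in F. norm (J \<epsilon> h (g \<epsilon>) - J \<epsilon> h g') \<le> norm (g \<epsilon> - g') * 1"
        using R
      proof eventually_elim
        case (elim \<epsilon>)
        then show ?case
          using contraction_resolvent.norm_J_diff_le[of "A \<epsilon>" "R \<epsilon>" h] h by (simp add: J_eq)
      qed
    qed
    moreover have "((\<lambda>\<epsilon>. J \<epsilon> h g') \<longlongrightarrow> L.J h g') F"
      unfolding J_def L.J_def blinfun.scaleR_left using h by (intro tendsto_intros lim) auto
    ultimately show ?thesis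
      using tendsto_add by fastforce
  qed
  have "\<forall>\<^sub>F h in at_right 0. dist (L.J h (L.J h f)) f < e / 8"
    by (rule tendstoD[OF L.tendsto_JJ]) (use e in simp)
  then have "\<forall>\<^sub>F h in at_right 0. dist (L.J h (L.J h f)) f < e / 8 \<and> 0 < h"
    using eventually_at_right_less[of 0] by eventually_elim auto
  then obtain h0 where h0: "dist (L.J h0 (L.J h0 f)) f < e / 8" "0 < h0"
    using eventually_happens'[OF trivial_limit_at_right_real] by blast
  define f0 where "f0 = L.J h0 (L.J h0 f)"
  define f\<epsilon> where "f\<epsilon> = (\<lambda>\<epsilon>. J \<epsilon> h0 (J \<epsilon> h0 f))"
  define M where "M = 2 * norm f / h0 + 4 * norm f / h0\<^sup>2"
  have M: "0 \<le> M" using h0 by (simp add: M_def)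
  have f\<epsilon>_lim: "(f\<epsilon> \<longlongrightarrow> f0) F"
    unfolding f\<epsilon>_def f0_def using h0(2) by (intro tendsto_Jg tendsto_const)
  \<comment> \<open>small enough that the Euler error \<open>(2 * r + 1) * h * M\<close> is below \<open>e / 8\<close> for all \<open>r \<le> t\<close>\<close>
  define h where "h = (e / 16) / ((2 * t + 1) * (M + 1))"
  have c: "0 < (2 * t + 1) * (M + 1)" using st M by (intro mult_pos_pos) auto
  have h: "0 < h" unfolding h_def using e c by (intro divide_pos_pos) auto
  have hM: "(2 * r + 1) * h * M < e / 8" if "0 \<le> r" "r \<le> t" for r
  proof -
    have "(2 * r + 1) * h * M \<le> (2 * t + 1) * h * (M + 1)"
      using that h M by (intro mult_mono) auto
    also have "\<dots> = h * ((2 * t + 1) * (M + 1))"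
      by (simp only: ac_simps)
    also have "\<dots> = e / 16"
      unfolding h_def using c by (intro nonzero_eq_divide_eq[THEN iffD1, OF _ refl]) auto
    finally show ?thesis using e by simp
  qed
  have pow: "((\<lambda>\<epsilon>. (blinfun_apply (J \<epsilon> h) ^^ n) (f\<epsilon> \<epsilon>)) \<longlongrightarrow> (blinfun_apply (L.J h) ^^ n) f0) F" for n
    by (induction n) (auto intro: f\<epsilon>_lim tendsto_Jg h)
  have "\<forall>\<^sub>F \<epsilon> in F. \<forall>n\<in>{..nat \<lfloor>t / h\<rfloor>}.
      dist ((blinfun_apply (J \<epsilon> h) ^^ n) (f\<epsilon> \<epsilon>)) ((blinfun_apply (L.J h) ^^ n) f0) < e / 8"
    using e by (intro eventually_ball_finite ballI tendstoD[OF pow]) auto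
  moreover have "\<forall>\<^sub>F \<epsilon> in F. dist (f\<epsilon> \<epsilon>) f0 < e / 8"
    by (rule tendstoD[OF f\<epsilon>_lim]) (use e in simp)
  ultimately show "\<forall>\<^sub>F \<epsilon> in F. \<forall>r\<in>{s..t}. dist (S \<epsilon> r f) (S' r f) < e"
    using R
  proof eventually_elim
    case (elim \<epsilon>)
    interpret C: contraction_resolvent "A \<epsilon>" "R \<epsilon>" using elim by simp
    have CJ: "C.J = J \<epsilon>" by (intro J_eq C.contraction_resolvent_axioms)
    show ?case
    proof
      fix r assume r: "r \<in> {s..t}"
      with st have r0: "0 \<le> r" "r \<le> t" by auto
      define n where "n = nat \<lfloor>r / h\<rfloor>"
      have "n \<le> nat \<lfloor>t / h\<rfloor>"
        unfolding n_def using r0 h by (intro nat_mono floor_mono divide_right_mono) auto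
      then have 3: "dist ((blinfun_apply (J \<epsilon> h) ^^ n) (f\<epsilon> \<epsilon>)) ((blinfun_apply (L.J h) ^^ n) f0) < e / 8"
        using elim by auto
      have "f\<epsilon> \<epsilon> \<in> C.D2 M" "f0 \<in> L.D2 M"
        using C.JJ_D2[OF h0(2), of f] L.JJ_D2[OF h0(2), of f] by (auto simp: f\<epsilon>_def f0_def M_def CJ)
      then have 2: "dist (S \<epsilon> r (f\<epsilon> \<epsilon>)) ((blinfun_apply (J \<epsilon> h) ^^ n) (f\<epsilon> \<epsilon>)) < e / 8"
        and 4: "dist (S' r f0) ((blinfun_apply (L.J h) ^^ n) f0) < e / 8"
        using C.semigroup_euler[of "S \<epsilon>" r h "f\<epsilon> \<epsilon>" M] L.semigroup_euler[of S' r h f0 M]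
          elim S' r0 h hM[OF r0] by (auto simp: dist_norm CJ n_def)
      have 1: "dist (S \<epsilon> r f) (S \<epsilon> r (f\<epsilon> \<epsilon>)) \<le> dist f (f\<epsilon> \<epsilon>)"
        using elim r0 unfolding dist_norm by (intro norm_blinfun_diff_le) (auto simp: contraction_semigroup_def)
      have 5: "dist (S' r f) (S' r f0) \<le> dist f f0"
        using S' r0 unfolding dist_norm by (intro norm_blinfun_diff_le) (auto simp: contraction_semigroup_def)
      have 6: "dist f f0 < e / 8" using h0 by (simp add: f0_def dist_commute)
      have 7: "dist (f\<epsilon> \<epsilon>) f0 < e / 8" using elim by simp
      have "dist f (f\<epsilon> \<epsilon>) < e / 8 + e / 8"
        using 6 7 dist_triangle2[of f "f\<epsilon> \<epsilon>" f0] by linarith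
      with 1 2 have a: "dist (S \<epsilon> r f) ((blinfun_apply (J \<epsilon> h) ^^ n) (f\<epsilon> \<epsilon>)) < 3 * (e / 8)"
        using dist_triangle[of "S \<epsilon> r f" "(blinfun_apply (J \<epsilon> h) ^^ n) (f\<epsilon> \<epsilon>)" "S \<epsilon> r (f\<epsilon> \<epsilon>)"]
        by linarith
      from 4 5 6 have b: "dist (S' r f) ((blinfun_apply (L.J h) ^^ n) f0) < 2 * (e / 8)"
        using dist_triangle[of "S' r f" "(blinfun_apply (L.J h) ^^ n) f0" "S' r f0"] by linarith
      from a 3 have "dist (S \<epsilon> r f) ((blinfun_apply (L.J h) ^^ n) f0) < 4 * (e / 8)"
        using dist_triangle[of "S \<epsilon> r f" "(blinfun_apply (L.J h) ^^ n) f0"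
            "(blinfun_apply (J \<epsilon> h) ^^ n) (f\<epsilon> \<epsilon>)"] by linarith
      with b show "dist (S \<epsilon> r f) (S' r f) < e"
        using dist_triangle2[of "S \<epsilon> r f" "S' r f" "(blinfun_apply (L.J h) ^^ n) f0"] e by linarith
    qed
  qed
qed

section \<open>The resolvent equation on the half-line\<close>

text \<open>The solution of \<open>u'' = s\<^sup>2 u - 2 \<phi>\<close> on the half-line that vanishes at 0 and is bounded: the integral
  of \<open>\<phi>\<close> against the Green function for absorption at 0. With \<open>s = sqrt (2 * lam)\<close> it is the edge
  function of \<open>R0 lam\<close>.\<close>
definition green :: "real \<Rightarrow> (real \<Rightarrow> real) \<Rightarrow> real \<Rightarrow> real" where
  "green s \<phi> x = 1 / s *
     (LINT y:{0..}|lborel. (exp (- s * \<bar>x - y\<bar>) - exp (- s * (x + y))) * \<phi> y)"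

definition laplace :: "real \<Rightarrow> (real \<Rightarrow> real) \<Rightarrow> real" where
  "laplace s \<phi> = (LINT y:{0..}|lborel. exp (- s * y) * \<phi> y)"

lemma set_integrable_exp_minus:
  fixes s :: real
  assumes "0 < s"
  shows "set_integrable lborel {0..} (\<lambda>y. exp (- s * y))"
proof -
  have "(\<lambda>y. exp (- s * y)) absolutely_integrable_on {0..}"
    by (intro nonnegative_absolutely_integrable_1 integrable_on_exp_minus_to_infinity assms) auto
  moreover have "(\<lambda>y. indicator {0..} y *\<^sub>R exp (- s * y) :: real) \<in> lborel \<rightarrow>\<^sub>M borel"
    by measurable
  ultimately show ?thesis
    unfolding set_integrable_def using integrable_completion by blast
qed

lemma laplace_one:
  assumes "0 < s"
  shows "laplace s (\<lambda>_. 1) = 1 / s"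
proof -
  have "laplace s (\<lambda>_. 1) = integral {0..} (\<lambda>y. exp (- s * y))"
    using set_borel_integral_eq_integral(2)[OF set_integrable_exp_minus[OF assms]]
    by (simp add: laplace_def)
  also have "\<dots> = 1 / s"
    using integral_unique[OF has_integral_exp_minus_to_infinity[OF assms, of 0]] by simp
  finally show ?thesis .
qed

lemma set_integrable_half_line_bound:
  fixes f g :: "real \<Rightarrow> real"
  assumes "set_integrable lborel {0..} g" "continuous_on UNIV f"
    and "\<And>y. 0 \<le> y \<Longrightarrow> \<bar>f y\<bar> \<le> g y"
  shows "set_integrable lborel {0..} f"
proof (rule set_integrable_bound[OF assms(1)])
  have "f \<in> borel_measurable borel"
    using assms(2) by (rule borel_measurable_continuous_onI)
  then show "set_borel_measurable lborel {0..} f"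
    unfolding set_borel_measurable_def by measurable
  show "AE y in lborel. y \<in> {0..} \<longrightarrow> norm (f y) \<le> norm (g y)"
    using assms(3) by (intro always_eventually) force
qed

lemma set_integrable_laplace:
  fixes s :: real and \<phi> :: "real \<Rightarrow> real"
  assumes s: "0 < s" and \<phi>: "continuous_on UNIV \<phi>" "\<And>y. \<bar>\<phi> y\<bar> \<le> C"
  shows "set_integrable lborel {0..} (\<lambda>y. exp (- s * y) * \<phi> y)"
proof (rule set_integrable_half_line_bound)
  show "set_integrable lborel {0..} (\<lambda>y. C * exp (- s * y))"
    using set_integrable_exp_minus[OF s] by (rule set_integrable_mult_right)
  show "continuous_on UNIV (\<lambda>y. exp (- s * y) * \<phi> y)"
    by (intro continuous_intros \<phi>)
  show "\<bar>exp (- s * y) * \<phi> y\<bar> \<le> C * exp (- s * y)" if "0 \<le> y" for y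
    using \<phi>(2)[of y] by (simp add: abs_mult mult.commute[of C] mult_left_mono)
qed

lemma set_integrable_resolvent_kernel:
  fixes s :: real and \<phi> :: "real \<Rightarrow> real"
  assumes s: "0 < s" and \<phi>: "continuous_on UNIV \<phi>" "\<And>y. \<bar>\<phi> y\<bar> \<le> C"
  shows "set_integrable lborel {0..} (\<lambda>y. exp (- s * \<bar>x - y\<bar>) * \<phi> y)"
proof (rule set_integrable_half_line_bound)
  show "set_integrable lborel {0..} (\<lambda>y. (C * exp (s * x)) * exp (- s * y))"
    using set_integrable_exp_minus[OF s] by (rule set_integrable_mult_right)
  show "continuous_on UNIV (\<lambda>y. exp (- s * \<bar>x - y\<bar>) * \<phi> y)"
    by (intro continuous_intros \<phi>)
  fix y :: real
  have "- s * \<bar>x - y\<bar> \<le> s * (x - y)"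
    using s mult_left_mono[of "- (x - y)" "\<bar>x - y\<bar>" s] by (simp add: algebra_simps)
  then have "exp (- s * \<bar>x - y\<bar>) \<le> exp (s * x) * exp (- s * y)"
    by (simp add: algebra_simps flip: exp_add)
  then have "exp (- s * \<bar>x - y\<bar>) * \<bar>\<phi> y\<bar> \<le> (exp (s * x) * exp (- s * y)) * C"
    by (intro mult_mono \<phi>) auto
  then show "\<bar>exp (- s * \<bar>x - y\<bar>) * \<phi> y\<bar> \<le> (C * exp (s * x)) * exp (- s * y)"
    by (simp add: abs_mult algebra_simps)
qed

lemma set_integrable_green:
  fixes s :: real and \<phi> :: "real \<Rightarrow> real"
  assumes s: "0 < s" and \<phi>: "continuous_on UNIV \<phi>" "\<And>y. \<bar>\<phi> y\<bar> \<le> C"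
  shows "set_integrable lborel {0..} (\<lambda>y. (exp (- s * \<bar>x - y\<bar>) - exp (- s * (x + y))) * \<phi> y)"
proof -
  have "set_integrable lborel {0..} (\<lambda>y. exp (- s * \<bar>x - y\<bar>) * \<phi> y - exp (- s * x) * (exp (- s * y) * \<phi> y))"
    by (intro set_integral_diff set_integrable_mult_right set_integrable_resolvent_kernel[OF s \<phi>]
        set_integrable_laplace[OF s \<phi>])
  then show ?thesis
    by (simp add: algebra_simps flip: exp_add)
qed

lemma green_mono:
  assumes s: "0 < s" and x: "0 \<le> x"
    and \<phi>: "continuous_on UNIV \<phi>" "\<And>y. \<bar>\<phi> y\<bar> \<le> C"
    and \<psi>: "continuous_on UNIV \<psi>" "\<And>y. \<bar>\<psi> y\<bar> \<le> D"
    and le: "\<And>y. 0 \<le> y \<Longrightarrow> \<phi> y \<le> \<psi> y"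
  shows "green s \<phi> x \<le> green s \<psi> x"
  unfolding green_def
proof (rule mult_left_mono, rule set_integral_mono[OF set_integrable_green[OF s \<phi>] set_integrable_green[OF s \<psi>]])
  fix y :: real assume y: "y \<in> {0..}"
  then have "s * \<bar>x - y\<bar> \<le> s * (x + y)"
    using x s by (intro mult_left_mono) auto
  then have "exp (- s * (x + y)) \<le> exp (- s * \<bar>x - y\<bar>)" by simp
  then show "(exp (- s * \<bar>x - y\<bar>) - exp (- s * (x + y))) * \<phi> y
      \<le> (exp (- s * \<bar>x - y\<bar>) - exp (- s * (x + y))) * \<psi> y"
    using y le by (intro mult_left_mono) auto
qed (use s in auto)

lemma green_add:
  assumes s: "0 < s"
    and \<phi>: "continuous_on UNIV \<phi>" "\<And>y. \<bar>\<phi> y\<bar> \<le> C"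
    and \<psi>: "continuous_on UNIV \<psi>" "\<And>y. \<bar>\<psi> y\<bar> \<le> D"
  shows "green s (\<lambda>y. \<phi> y + \<psi> y) x = green s \<phi> x + green s \<psi> x"
proof -
  define k where "k = (\<lambda>y. exp (- s * \<bar>x - y\<bar>) - exp (- s * (x + y)))"
  have "green s \<theta> x = 1 / s * (LINT y:{0..}|lborel. k y * \<theta> y)" for \<theta>
    by (simp add: green_def k_def)
  moreover have "set_integrable lborel {0..} (\<lambda>y. k y * \<phi> y)"
    "set_integrable lborel {0..} (\<lambda>y. k y * \<psi> y)"
    unfolding k_def by (rule set_integrable_green[OF s \<phi>] set_integrable_green[OF s \<psi>])+
  ultimately show ?thesis by (simp add: distrib_left add_divide_distrib)
qed

lemma green_scale: "green s (\<lambda>y. c * \<phi> y) x = c * green s \<phi> x"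
  unfolding green_def by (simp add: mult.left_commute[of _ c])

lemma laplace_add:
  assumes s: "0 < s"
    and \<phi>: "continuous_on UNIV \<phi>" "\<And>y. \<bar>\<phi> y\<bar> \<le> C"
    and \<psi>: "continuous_on UNIV \<psi>" "\<And>y. \<bar>\<psi> y\<bar> \<le> D"
  shows "laplace s (\<lambda>y. \<phi> y + \<psi> y) = laplace s \<phi> + laplace s \<psi>"
  unfolding laplace_def distrib_left
  by (rule set_integral_add(2)[OF set_integrable_laplace[OF s \<phi>] set_integrable_laplace[OF s \<psi>]])

lemma laplace_scale: "laplace s (\<lambda>y. c * \<phi> y) = c * laplace s \<phi>"
  unfolding laplace_def by (simp add: mult.left_commute[of _ c])

lemma laplace_mono:
  assumes s: "0 < s"
    and \<phi>: "continuous_on UNIV \<phi>" "\<And>y. \<bar>\<phi> y\<bar> \<le> C"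
    and \<psi>: "continuous_on UNIV \<psi>" "\<And>y. \<bar>\<psi> y\<bar> \<le> D"
    and le: "\<And>y. 0 \<le> y \<Longrightarrow> \<phi> y \<le> \<psi> y"
  shows "laplace s \<phi> \<le> laplace s \<psi>"
  unfolding laplace_def
  by (intro set_integral_mono set_integrable_laplace[OF s \<phi>] set_integrable_laplace[OF s \<psi>])
    (auto intro: le)

text \<open>Separating the variables in the kernel on either side of \<open>y = x\<close> exhibits the dependence on \<open>x\<close>
  through exponentials and two primitives; this form can be differentiated.\<close>
lemma green_formula:
  assumes s: "0 < s" and x: "0 \<le> x" and \<phi>: "continuous_on UNIV \<phi>" "\<And>y. \<bar>\<phi> y\<bar> \<le> C"
  shows "green s \<phi> x = 1 / s *
    (exp (- s * x) * integral {0..x} (\<lambda>y. exp (s * y) * \<phi> y)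
     + exp (s * x) * (laplace s \<phi> - integral {0..x} (\<lambda>y. exp (- s * y) * \<phi> y))
     - exp (- s * x) * laplace s \<phi>)"
proof -
  define p where "p = (\<lambda>y. indicator {0..x} y *\<^sub>R (exp (s * y) * \<phi> y))"
  define q where "q = (\<lambda>y. indicator {0..x} y *\<^sub>R (exp (- s * y) * \<phi> y))"
  define r where "r = (\<lambda>y. indicator {0..} y *\<^sub>R (exp (- s * y) * \<phi> y))"
  have cont: "continuous_on {0..x} \<phi>" using \<phi>(1) continuous_on_subset by blast
  have p': "set_integrable lborel {0..x} (\<lambda>y. exp (s * y) * \<phi> y)"
    and q': "set_integrable lborel {0..x} (\<lambda>y. exp (- s * y) * \<phi> y)"
    by (intro borel_integrable_atLeastAtMost' continuous_intros cont)+
  have ints: "integrable lborel p" "integrable lborel q" "integrable lborel r"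
    using p' q' set_integrable_laplace[OF s \<phi>] unfolding set_integrable_def p_def q_def r_def by auto
  have P: "integral\<^sup>L lborel p = integral {0..x} (\<lambda>y. exp (s * y) * \<phi> y)"
    using set_borel_integral_eq_integral(2)[OF p'] by (simp add: set_lebesgue_integral_def p_def)
  have Q: "integral\<^sup>L lborel q = integral {0..x} (\<lambda>y. exp (- s * y) * \<phi> y)"
    using set_borel_integral_eq_integral(2)[OF q'] by (simp add: set_lebesgue_integral_def q_def)
  have R: "integral\<^sup>L lborel r = laplace s \<phi>"
    by (simp add: laplace_def set_lebesgue_integral_def r_def)
  have "(LINT y:{0..}|lborel. (exp (- s * \<bar>x - y\<bar>) - exp (- s * (x + y))) * \<phi> y)
      = (LINT y|lborel. exp (- s * x) * p y - exp (s * x) * q y + (exp (s * x) - exp (- s * x)) * r y)"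
    unfolding set_lebesgue_integral_def
  proof (intro Bochner_Integration.integral_cong refl)
    fix y :: real
    have "exp (- s * (x + y)) = exp (- s * x) * exp (- s * y)"
      by (simp add: algebra_simps flip: exp_add)
    moreover have "exp (- s * \<bar>x - y\<bar>) = exp (- s * x) * exp (s * y)" if "y \<le> x"
      using that by (simp add: algebra_simps flip: exp_add)
    moreover have "exp (- s * \<bar>x - y\<bar>) = exp (s * x) * exp (- s * y)" if "\<not> y \<le> x"
      using that by (simp add: algebra_simps flip: exp_add)
    ultimately show "indicator {0..} y *\<^sub>R ((exp (- s * \<bar>x - y\<bar>) - exp (- s * (x + y))) * \<phi> y)
        = exp (- s * x) * p y - exp (s * x) * q y + (exp (s * x) - exp (- s * x)) * r y"
      by (cases "y \<le> x"; cases "0 \<le> y") (simp_all add: p_def q_def r_def algebra_simps)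
  qed
  also have "\<dots> = exp (- s * x) * integral\<^sup>L lborel p - exp (s * x) * integral\<^sup>L lborel q
      + (exp (s * x) - exp (- s * x)) * integral\<^sup>L lborel r"
    using ints by simp
  finally have eq: "(LINT y:{0..}|lborel. (exp (- s * \<bar>x - y\<bar>) - exp (- s * (x + y))) * \<phi> y) = \<dots>" .
  show ?thesis
    unfolding green_def eq P Q R by (rule arg_cong[where f = "\<lambda>u. 1 / s * u"]) (simp add: algebra_simps)
qed

lemma has_real_derivative_integral_half_line:
  fixes f :: "real \<Rightarrow> real"
  assumes f: "continuous_on UNIV f" and x: "0 \<le> x"
  shows "((\<lambda>x. integral {0..x} f) has_real_derivative f x) (at x within {0..})"
proof -
  have "((\<lambda>x. integral {0..x} f) has_real_derivative f x) (at x within {0..x+1})"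
    using x continuous_on_subset[OF f] by (intro integral_has_real_derivative) auto
  moreover have "at x within {0..x+1} = at x within {0..}"
    by (rule at_within_nhd[of _ "{..<x+1}"]) auto
  ultimately show ?thesis by simp
qed

text \<open>The derivative of \<open>green s \<phi>\<close>, in the form that results from \<open>green_formula\<close> after the
  derivatives of the two primitives have cancelled.\<close>
definition green_deriv :: "real \<Rightarrow> (real \<Rightarrow> real) \<Rightarrow> real \<Rightarrow> real" where
  "green_deriv s \<phi> x =
     - exp (- s * x) * integral {0..x} (\<lambda>y. exp (s * y) * \<phi> y)
     + exp (s * x) * (laplace s \<phi> - integral {0..x} (\<lambda>y. exp (- s * y) * \<phi> y))
     + exp (- s * x) * laplace s \<phi>"

lemma green_deriv_0: "green_deriv s \<phi> 0 = 2 * laplace s \<phi>"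
  by (simp add: green_deriv_def)

lemma
  assumes s: "0 < s" and x: "0 \<le> x" and \<phi>: "continuous_on UNIV \<phi>" "\<And>y. \<bar>\<phi> y\<bar> \<le> C"
  shows has_derivative_green: "(green s \<phi> has_real_derivative green_deriv s \<phi> x) (at x within {0..})"
    and has_derivative_green_deriv:
      "(green_deriv s \<phi> has_real_derivative s\<^sup>2 * green s \<phi> x - 2 * \<phi> x) (at x within {0..})"
proof -
  let ?P = "\<lambda>x. integral {0..x} (\<lambda>y. exp (s * y) * \<phi> y)"
  let ?Q = "\<lambda>x. integral {0..x} (\<lambda>y. exp (- s * y) * \<phi> y)"
  have P: "(?P has_real_derivative exp (s * x) * \<phi> x) (at x within {0..})"
    and Q: "(?Q has_real_derivative exp (- s * x) * \<phi> x) (at x within {0..})"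
    by (intro has_real_derivative_integral_half_line continuous_intros \<phi> x)+
  have e: "exp (- (s * x)) * exp (s * x) = 1" by (simp flip: exp_add)
  have d1: "((\<lambda>x. 1 / s * (exp (- s * x) * P x + exp (s * x) * (l - Q x) - exp (- s * x) * l))
      has_real_derivative - exp (- s * x) * P x + exp (s * x) * (l - Q x) + exp (- s * x) * l)
      (at x within {0..})"
    and d2: "((\<lambda>x. - exp (- s * x) * P x + exp (s * x) * (l - Q x) + exp (- s * x) * l)
      has_real_derivative s * exp (- s * x) * P x - exp (- (s * x)) * exp (s * x) * \<phi> x
      + (s * exp (s * x) * (l - Q x) - exp (- (s * x)) * exp (s * x) * \<phi> x)
      - s * exp (- s * x) * l) (at x within {0..})"
    if P: "(P has_real_derivative exp (s * x) * \<phi> x) (at x within {0..})"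
      and Q: "(Q has_real_derivative exp (- s * x) * \<phi> x) (at x within {0..})" for P Q l
  proof -
    have "((\<lambda>x. 1 / s * (exp (- s * x) * P x + exp (s * x) * (l - Q x) - exp (- s * x) * l))
      has_real_derivative 1 / s * (- s * exp (- s * x) * P x + exp (- (s * x)) * exp (s * x) * \<phi> x
      + (s * exp (s * x) * (l - Q x) - exp (- (s * x)) * exp (s * x) * \<phi> x) + s * exp (- s * x) * l))
      (at x within {0..})"
      by (rule DERIV_cmult) (auto intro!: derivative_eq_intros P Q simp: algebra_simps)
    moreover have "1 / s * (- s * exp (- s * x) * P x + exp (- (s * x)) * exp (s * x) * \<phi> x
      + (s * exp (s * x) * (l - Q x) - exp (- (s * x)) * exp (s * x) * \<phi> x) + s * exp (- s * x) * l)
      = - exp (- s * x) * P x + exp (s * x) * (l - Q x) + exp (- s * x) * l"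
      unfolding e using s by (simp add: field_simps)
    ultimately show "((\<lambda>x. 1 / s * (exp (- s * x) * P x + exp (s * x) * (l - Q x) - exp (- s * x) * l))
      has_real_derivative - exp (- s * x) * P x + exp (s * x) * (l - Q x) + exp (- s * x) * l)
      (at x within {0..})" by simp
    show "((\<lambda>x. - exp (- s * x) * P x + exp (s * x) * (l - Q x) + exp (- s * x) * l)
      has_real_derivative s * exp (- s * x) * P x - exp (- (s * x)) * exp (s * x) * \<phi> x
      + (s * exp (s * x) * (l - Q x) - exp (- (s * x)) * exp (s * x) * \<phi> x)
      - s * exp (- s * x) * l) (at x within {0..})"
      by (auto intro!: derivative_eq_intros P Q simp: algebra_simps)
  qed
  have "((\<lambda>x. 1 / s * (exp (- s * x) * ?P x + exp (s * x) * (laplace s \<phi> - ?Q x)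
      - exp (- s * x) * laplace s \<phi>)) has_real_derivative green_deriv s \<phi> x) (at x within {0..})"
    unfolding green_deriv_def by (rule d1[OF P Q])
  then have "((\<lambda>x. 1 / s * (exp (- s * x) * ?P x + exp (s * x) * (laplace s \<phi> - ?Q x)
      - exp (- s * x) * laplace s \<phi>)) has_derivative (*) (green_deriv s \<phi> x)) (at x within {0..})"
    by (simp add: has_field_derivative_def)
  then show "(green s \<phi> has_real_derivative green_deriv s \<phi> x) (at x within {0..})"
    unfolding has_field_derivative_def
    by (rule has_derivative_transform[rotated 2]) (use x green_formula[OF s _ \<phi>] in auto)
  note d2[OF P Q, of "laplace s \<phi>"]
  moreover have "s * exp (- s * x) * ?P x - exp (- (s * x)) * exp (s * x) * \<phi> x
      + (s * exp (s * x) * (laplace s \<phi> - ?Q x) - exp (- (s * x)) * exp (s * x) * \<phi> x)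
      - s * exp (- s * x) * laplace s \<phi> = s\<^sup>2 * green s \<phi> x - 2 * \<phi> x"
  proof -
    have "s\<^sup>2 * green s \<phi> x = s * (exp (- s * x) * ?P x + exp (s * x) * (laplace s \<phi> - ?Q x)
      - exp (- s * x) * laplace s \<phi>)"
      unfolding green_formula[OF s x \<phi>] using s by (simp add: power2_eq_square)
    then show ?thesis unfolding e by (simp add: algebra_simps)
  qed
  ultimately show "(green_deriv s \<phi> has_real_derivative s\<^sup>2 * green s \<phi> x - 2 * \<phi> x) (at x within {0..})"
    unfolding green_deriv_def[abs_def] by simp
qed

text \<open>Factor the second-order operator: \<open>h' + s h\<close> solves a first-order equation, so it is \<open>c\<close> times the growing
  exponential, and then \<open>h\<close> is a combination of the growing and the decaying one. Boundedness
  excludes the growing part.\<close>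
lemma bounded_solution_exp:
  fixes h h1 :: "real \<Rightarrow> real"
  assumes s: "0 < s"
    and h: "\<And>x. 0 \<le> x \<Longrightarrow> (h has_real_derivative h1 x) (at x within {0..})"
    and h1: "\<And>x. 0 \<le> x \<Longrightarrow> (h1 has_real_derivative s\<^sup>2 * h x) (at x within {0..})"
    and bnd: "\<And>x. 0 \<le> x \<Longrightarrow> \<bar>h x\<bar> \<le> C" and x: "0 \<le> x"
  shows "h x = h 0 * exp (- s * x)"
proof -
  have "\<exists>c. \<forall>x\<in>{0..}. (h1 x + s * h x) * exp (- s * x) = c"
    by (rule has_field_derivative_zero_constant)
      (auto intro!: derivative_eq_intros h h1 simp: power2_eq_square algebra_simps)
  then obtain c where c: "\<And>x. 0 \<le> x \<Longrightarrow> (h1 x + s * h x) * exp (- s * x) = c" by auto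
  have c': "h1 x + s * h x = c * exp (s * x)" if "0 \<le> x" for x
    using c[OF that] by (simp add: exp_minus field_simps)
  have "\<exists>k. \<forall>x\<in>{0..}. h x * exp (s * x) - c / (2 * s) * exp (2 * s * x) = k"
  proof (rule has_field_derivative_zero_constant)
    fix x :: real assume x: "x \<in> {0..}"
    have "((\<lambda>x. h x * exp (s * x) - c / (2 * s) * exp (2 * s * x)) has_real_derivative
        (h1 x * exp (s * x) + h x * (s * exp (s * x)) - c / (2 * s) * (2 * s * exp (2 * s * x))))
        (at x within {0..})"
      using x by (auto intro!: derivative_eq_intros h simp: algebra_simps)
    moreover have "h1 x * exp (s * x) + h x * (s * exp (s * x)) = (h1 x + s * h x) * exp (s * x)"
      by (simp add: algebra_simps)
    moreover have "exp (2 * s * x) = exp (s * x) * exp (s * x)"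
      by (simp flip: exp_add)
    ultimately show "((\<lambda>x. h x * exp (s * x) - c / (2 * s) * exp (2 * s * x)) has_real_derivative 0)
        (at x within {0..})"
      using c'[of x] x s by simp
  qed simp
  then obtain k where k: "\<And>x. 0 \<le> x \<Longrightarrow> h x * exp (s * x) - c / (2 * s) * exp (2 * s * x) = k"
    by auto
  have form: "h x = k * exp (- s * x) + c / (2 * s) * exp (s * x)" if "0 \<le> x" for x
  proof -
    have "exp (2 * s * x) = exp (s * x) * exp (s * x)" by (simp flip: exp_add)
    then have eq: "h x * exp (s * x) = k + c / (2 * s) * exp (s * x) * exp (s * x)"
      using k[OF that] by simp
    have e: "exp (s * x) * exp (- s * x) = 1" by (simp flip: exp_add)
    have "h x = (h x * exp (s * x)) * exp (- s * x)"
      unfolding mult.assoc e by simp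
    also have "\<dots> = k * exp (- s * x) + c / (2 * s) * exp (s * x) * (exp (s * x) * exp (- s * x))"
      unfolding eq by (simp only: distrib_right mult.assoc)
    finally show ?thesis unfolding e by simp
  qed
  have "c = 0"
  proof (rule ccontr)
    assume c0: "c \<noteq> 0"
    \<comment> \<open>a point at which the growing part already exceeds the bound, by \<open>exp (s * y) \<ge> 1 + s * y\<close>\<close>
    define y where "y = 2 * (C + \<bar>k\<bar>) / \<bar>c\<bar>"
    have "0 \<le> C" using bnd[of 0] by simp
    then have y: "0 \<le> y" by (simp add: y_def)
    have "\<bar>c\<bar> / (2 * s) * exp (s * y) = \<bar>h y - k * exp (- s * y)\<bar>"
      unfolding form[OF y] using s by (simp add: abs_mult)
    also have "\<dots> \<le> \<bar>h y\<bar> + \<bar>k * exp (- s * y)\<bar>" by (rule abs_triangle_ineq4)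
    also have "\<dots> \<le> C + \<bar>k\<bar>"
      using bnd[OF y] s y by (intro add_mono) (auto simp: abs_mult mult_left_le)
    finally have "\<bar>c\<bar> / (2 * s) * exp (s * y) \<le> C + \<bar>k\<bar>" .
    moreover have "\<bar>c\<bar> / (2 * s) * (1 + s * y) \<le> \<bar>c\<bar> / (2 * s) * exp (s * y)"
      using s by (intro mult_left_mono exp_ge_add_one_self) auto
    moreover have "\<bar>c\<bar> / (2 * s) * (1 + s * y) = \<bar>c\<bar> / (2 * s) + (C + \<bar>k\<bar>)"
      using s c0 by (simp add: y_def distrib_left) (simp add: add_divide_distrib)
    moreover have "0 < \<bar>c\<bar> / (2 * s)" using s c0 by simp
    ultimately show False by linarith
  qed
  then show ?thesis using form[OF x] form[of 0] by simp
qed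

lemma green_one:
  assumes s: "0 < s" and x: "0 \<le> x"
  shows "green s (\<lambda>_. 1) x = 2 / s\<^sup>2 * (1 - exp (- s * x))"
proof -
  have alg: "1 / s * (e * (E / s - 1 / s) + E * (1 / s - (- e / s + 1 / s)) - e * (1 / s)) = 2 / s\<^sup>2 * (1 - e)"
    if "e * E = 1" for e E :: real
  proof -
    have "1 / s * (e * (E / s - 1 / s) + E * (1 / s - (- e / s + 1 / s)) - e * (1 / s))
        = (e * E + e * E - e - e) / s\<^sup>2"
      using s by (simp add: field_simps power2_eq_square)
    then show ?thesis using s that by (simp add: power2_eq_square field_simps)
  qed
  have P: "integral {0..x} (\<lambda>y. exp (s * y)) = exp (s * x) / s - exp (s * 0) / s"
    using s x by (intro integral_unique fundamental_theorem_of_calculus)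
      (auto simp flip: has_real_derivative_iff_has_vector_derivative intro!: derivative_eq_intros)
  have Q: "integral {0..x} (\<lambda>y. exp (- s * y)) = (- exp (- s * x) / s) - (- exp (- s * 0) / s)"
    using s x by (intro integral_unique fundamental_theorem_of_calculus)
      (auto simp flip: has_real_derivative_iff_has_vector_derivative intro!: derivative_eq_intros)
  have e: "exp (- s * x) * exp (s * x) = 1" by (simp flip: exp_add)
  have "green s (\<lambda>_. 1) x = 1 / s *
    (exp (- s * x) * integral {0..x} (\<lambda>y. exp (s * y) * 1)
     + exp (s * x) * (laplace s (\<lambda>_. 1) - integral {0..x} (\<lambda>y. exp (- s * y) * 1))
     - exp (- s * x) * laplace s (\<lambda>_. 1))"
    using s x by (intro green_formula[where C = 1]) auto
  also have "\<dots> = 2 / s\<^sup>2 * (1 - exp (- s * x))"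
    using alg[OF e] s P Q by (simp add: laplace_one)
  finally show ?thesis .
qed

lemma abs_green_le:
  assumes s: "0 < s" and x: "0 \<le> x" and \<phi>: "continuous_on UNIV \<phi>" "\<And>y. \<bar>\<phi> y\<bar> \<le> C"
  shows "\<bar>green s \<phi> x\<bar> \<le> C * (2 / s\<^sup>2 * (1 - exp (- s * x)))"
proof -
  have C: "C * (2 / s\<^sup>2 * (1 - exp (- s * x))) = green s (\<lambda>_. C * 1) x"
    using green_scale[of s C "\<lambda>_. 1" x] green_one[OF s x] by simp
  have "green s \<phi> x \<le> green s (\<lambda>_. C * 1) x" "green s (\<lambda>y. - 1 * \<phi> y) x \<le> green s (\<lambda>_. C * 1) x"
    by (rule green_mono[OF s x, where C = C and D = "\<bar>C\<bar>"];
        use \<phi> in \<open>auto intro!: continuous_intros dest: abs_le_D1 abs_le_D2\<close>)+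
  then show ?thesis
    unfolding C green_scale by (simp add: abs_le_iff)
qed

text \<open>Besides describing all bounded solutions, this evaluates \<open>green\<close> on concrete functions: guess a
  bounded \<open>f\<close> and read off the \<open>\<phi>\<close> that it solves. The next two lemmas use it that way.\<close>
lemma bounded_solution_green:
  fixes f f1 :: "real \<Rightarrow> real"
  assumes s: "0 < s" and \<phi>: "continuous_on UNIV \<phi>" "\<And>y. \<bar>\<phi> y\<bar> \<le> C"
    and f: "\<And>x. 0 \<le> x \<Longrightarrow> (f has_real_derivative f1 x) (at x within {0..})"
    and f1: "\<And>x. 0 \<le> x \<Longrightarrow> (f1 has_real_derivative s\<^sup>2 * f x - 2 * \<phi> x) (at x within {0..})"
    and bnd: "\<And>x. 0 \<le> x \<Longrightarrow> \<bar>f x\<bar> \<le> D" and x: "0 \<le> x"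
  shows "f x = green s \<phi> x + f 0 * exp (- s * x)"
proof -
  have g0: "green s \<phi> 0 = 0"
    using abs_green_le[OF s order_refl \<phi>] by simp
  have "f x - green s \<phi> x = (f 0 - green s \<phi> 0) * exp (- s * x)"
  proof (rule bounded_solution_exp[OF s])
    show "((\<lambda>x. f x - green s \<phi> x) has_real_derivative f1 x - green_deriv s \<phi> x) (at x within {0..})"
      if "0 \<le> x" for x
      by (intro derivative_intros f has_derivative_green[OF s _ \<phi>] that)
    show "((\<lambda>x. f1 x - green_deriv s \<phi> x) has_real_derivative s\<^sup>2 * (f x - green s \<phi> x))
        (at x within {0..})" if "0 \<le> x" for x
      by (rule derivative_eq_intros f1 has_derivative_green_deriv[OF s _ \<phi>] that)+
        (simp add: algebra_simps)
    show "\<bar>f x - green s \<phi> x\<bar> \<le> D + C * (2 / s\<^sup>2)" if "0 \<le> x" for x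
    proof -
      have C: "0 \<le> C" using \<phi>(2)[of 0] by simp
      have "C * (2 / s\<^sup>2 * (1 - exp (- s * x))) \<le> C * (2 / s\<^sup>2 * 1)"
        using C by (intro mult_left_mono) auto
      then show ?thesis
        using abs_green_le[OF s that \<phi>] bnd[OF that] by simp
    qed
  qed (rule x)
  then show ?thesis by (simp add: g0)
qed

text \<open>A decaying source produces a decaying solution. The rate \<open>s / 2\<close> stands for any rate below the
  resonant rate \<open>s\<close>. The absolute value makes the source bounded on the whole line; on the half-line it
  changes nothing.\<close>
lemma green_exp_le:
  assumes s: "0 < s" and x: "0 \<le> x"
  shows "green s (\<lambda>y. exp (- (s / 2) * \<bar>y\<bar>)) x \<le> 8 / (3 * s\<^sup>2) * exp (- (s / 2) * x)"
proof -
  let ?f = "\<lambda>y. exp (- (s / 2) * y)"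
  let ?\<phi> = "\<lambda>y. (3 * s\<^sup>2 / 8) * exp (- (s / 2) * \<bar>y\<bar>)"
  have "?f x = green s ?\<phi> x + ?f 0 * exp (- s * x)"
  proof (rule bounded_solution_green[OF s])
    show "continuous_on UNIV ?\<phi>" by (intro continuous_intros)
    show "\<bar>?\<phi> y\<bar> \<le> 3 * s\<^sup>2 / 8" for y
      using s by (simp add: abs_mult mult_left_le)
    show "(?f has_real_derivative - (s / 2) * exp (- (s / 2) * y)) (at y within {0..})" for y
      by (auto intro!: derivative_eq_intros)
    show "((\<lambda>y. - (s / 2) * exp (- (s / 2) * y)) has_real_derivative s\<^sup>2 * ?f y - 2 * ?\<phi> y)
        (at y within {0..})" if "0 \<le> y" for y
      using that by (auto intro!: derivative_eq_intros simp: power2_eq_square field_simps)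
    show "\<bar>?f y\<bar> \<le> 1" if "0 \<le> y" for y using that s by simp
  qed (rule x)
  then have "(3 * s\<^sup>2 / 8) * green s (\<lambda>y. exp (- (s / 2) * \<bar>y\<bar>)) x \<le> exp (- (s / 2) * x)"
    unfolding green_scale by (simp add: field_simps)
  then show ?thesis using s by (simp add: field_simps)
qed

text \<open>The function \<open>1 - exp (- x)\<close> is concave and vanishes at 0, hence superharmonic for the process
  absorbed at 0, and the normalised resolvent decreases it.\<close>
lemma green_one_minus_exp_le:
  assumes s: "0 < s" and x: "0 \<le> x"
  shows "green s (\<lambda>y. 1 - exp (- \<bar>y\<bar>)) x \<le> 2 / s\<^sup>2 * (1 - exp (- x))"
proof -
  let ?w = "\<lambda>y. 1 - exp (- \<bar>y\<bar>) :: real"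
  let ?\<phi> = "\<lambda>y. (s\<^sup>2 / 2) * ?w y + exp (- \<bar>y\<bar>) / 2"
  have b\<phi>: "\<bar>?\<phi> y\<bar> \<le> s\<^sup>2 / 2 + 1 / 2" for y
  proof -
    have "0 \<le> ?\<phi> y" by (intro add_nonneg_nonneg mult_nonneg_nonneg) auto
    moreover have "?\<phi> y \<le> s\<^sup>2 / 2 * 1 + 1 / 2" by (intro add_mono mult_left_mono) auto
    ultimately show ?thesis by (simp only: abs_of_nonneg mult_1_right)
  qed
  have "1 - exp (- x) = green s ?\<phi> x + (1 - exp (- 0)) * exp (- s * x)"
  proof (rule bounded_solution_green[OF s _ b\<phi>])
    show "continuous_on UNIV ?\<phi>" by (intro continuous_intros) auto
    show "((\<lambda>y. 1 - exp (- y)) has_real_derivative exp (- y)) (at y within {0..})" for y :: real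
      by (auto intro!: derivative_eq_intros)
    show "((\<lambda>y. exp (- y)) has_real_derivative s\<^sup>2 * (1 - exp (- y)) - 2 * ?\<phi> y) (at y within {0..})"
      if "0 \<le> y" for y :: real
      using that by (auto intro!: derivative_eq_intros simp: field_simps)
    show "\<bar>1 - exp (- y)\<bar> \<le> 1" if "0 \<le> y" for y :: real using that by simp
  qed (rule x)
  moreover have "green s (\<lambda>y. (s\<^sup>2 / 2) * ?w y) x \<le> green s ?\<phi> x"
  proof (rule green_mono[OF s x _ _ _ b\<phi>])
    show "\<bar>(s\<^sup>2 / 2) * ?w y\<bar> \<le> s\<^sup>2 / 2" for y
      by (simp add: abs_mult mult_left_le)
  qed (auto intro!: continuous_intros)
  ultimately have "(s\<^sup>2 / 2) * green s ?w x \<le> 1 - exp (- x)"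
    unfolding green_scale by simp
  then show ?thesis using s by (simp add: field_simps)
qed

text \<open>Subtracting the limit, the source is at most \<open>\<eta>\<close> plus a multiple of a decaying exponential, and
  \<open>green\<close> is monotone and known on both.\<close>
lemma green_tendsto_at_top:
  assumes s: "0 < s" and \<phi>: "continuous_on UNIV \<phi>" "\<And>y. \<bar>\<phi> y\<bar> \<le> C"
    and lim: "(\<phi> \<longlongrightarrow> L) at_top"
  shows "(green s \<phi> \<longlongrightarrow> 2 / s\<^sup>2 * L) at_top"
proof -
  have C: "0 \<le> C" using \<phi>(2)[of 0] by simp
  have LC: "\<bar>L\<bar> \<le> C"
    by (rule tendsto_upperbound[OF tendsto_rabs[OF lim]]) (auto simp: \<phi>)
  define \<psi> where "\<psi> = (\<lambda>y. \<phi> y + (- L) * 1)"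
  have \<psi>: "continuous_on UNIV \<psi>" "\<bar>\<psi> y\<bar> \<le> 2 * C" for y
    using LC \<phi>(2)[of y] by (auto simp: \<psi>_def intro!: continuous_intros \<phi>)
  have green_\<psi>: "green s \<psi> x = green s \<phi> x - L * (2 / s\<^sup>2 * (1 - exp (- s * x)))" if "0 \<le> x" for x
    unfolding \<psi>_def using green_add[OF s \<phi>, of "\<lambda>_. - L * 1" "\<bar>L\<bar>" x] green_scale[of s "- L" "\<lambda>_. 1" x]
      green_one[OF s that] by simp
  have exp0: "((\<lambda>x. exp (- c * x)) \<longlongrightarrow> 0) at_top" if "0 < c" for c :: real
    by (rule filterlim_compose[OF exp_at_bot],
        rule filterlim_tendsto_neg_mult_at_bot[OF tendsto_const _ filterlim_ident]) (use that in simp)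
  have "(green s \<psi> \<longlongrightarrow> 0) at_top"
    unfolding tendsto_iff
  proof (intro allI impI)
    fix e :: real assume e: "0 < e"
    define \<eta> where "\<eta> = e * s\<^sup>2 / 4"
    have \<eta>: "0 < \<eta>" using e s by (simp add: \<eta>_def)
    obtain Y where Y: "\<And>y. Y \<le> y \<Longrightarrow> \<bar>\<psi> y\<bar> < \<eta>"
      using tendstoD[OF lim \<eta>] by (auto simp: eventually_at_top_linorder \<psi>_def dist_real_def)
    define K where "K = 2 * C * exp (s / 2 * \<bar>Y\<bar>)"
    have K: "0 \<le> K" using C by (simp add: K_def)
    let ?\<theta> = "\<lambda>y. \<eta> * 1 + K * exp (- (s / 2) * \<bar>y\<bar>)"
    have \<theta>: "continuous_on UNIV ?\<theta>" "\<bar>?\<theta> y\<bar> \<le> \<eta> + K" for y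
      using \<eta> K s by (auto intro!: continuous_intros simp: abs_mult mult_left_le)
    have le: "\<bar>\<psi> y\<bar> \<le> ?\<theta> y" if "0 \<le> y" for y
    proof (cases "Y \<le> y")
      case True
      then show ?thesis using Y[OF True] K by (intro add_increasing2) auto
    next
      case False
      with that have "1 \<le> exp (s / 2 * \<bar>Y\<bar>) * exp (- (s / 2) * \<bar>y\<bar>)"
        using s by (simp flip: exp_add)
      from mult_left_mono[OF this, of "2 * C"] C have "2 * C \<le> K * exp (- (s / 2) * \<bar>y\<bar>)"
        by (simp add: K_def mult.assoc)
      then show ?thesis using \<psi>(2)[of y] \<eta> by simp
    qed
    have bound: "\<bar>green s \<psi> x\<bar> \<le> e / 2 + K * (8 / (3 * s\<^sup>2)) * exp (- (s / 2) * x)" if x: "0 \<le> x" for x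
    proof -
      have "green s \<psi> x \<le> green s ?\<theta> x" "green s (\<lambda>y. - 1 * \<psi> y) x \<le> green s ?\<theta> x"
        by (rule green_mono[OF s x _ _ \<theta>, where C = "2 * C"];
            use \<psi> le in \<open>auto intro!: continuous_intros dest: abs_le_D1 abs_le_D2\<close>)+
      then have "\<bar>green s \<psi> x\<bar> \<le> green s ?\<theta> x"
        unfolding green_scale by (simp add: abs_le_iff)
      also have "\<dots> = \<eta> * green s (\<lambda>_. 1) x + K * green s (\<lambda>y. exp (- (s / 2) * \<bar>y\<bar>)) x"
        unfolding green_scale[symmetric] using \<eta> K s
        by (intro green_add[OF s, where C = \<eta> and D = K]) (auto intro!: continuous_intros simp: abs_mult mult_left_le)
      also have "\<dots> \<le> \<eta> * (2 / s\<^sup>2) + K * (8 / (3 * s\<^sup>2) * exp (- (s / 2) * x))"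
        using \<eta> K s x by (intro add_mono mult_left_mono green_exp_le) (auto simp: green_one mult_left_le divide_right_mono)
      finally show ?thesis using s by (simp add: \<eta>_def)
    qed
    have "((\<lambda>x. e / 2 + K * (8 / (3 * s\<^sup>2)) * exp (- (s / 2) * x)) \<longlongrightarrow> e / 2 + K * (8 / (3 * s\<^sup>2)) * 0) at_top"
      using s by (intro tendsto_add tendsto_mult_left tendsto_const exp0) auto
    then have "\<forall>\<^sub>F x in at_top. e / 2 + K * (8 / (3 * s\<^sup>2)) * exp (- (s / 2) * x) < e"
      by (rule order_tendstoD(2)) (use e in simp)
    then show "\<forall>\<^sub>F x in at_top. dist (green s \<psi> x) 0 < e"
      using eventually_ge_at_top[of 0]
    proof eventually_elim
      case (elim x)
      then show ?case using bound[of x] by simp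
    qed
  qed
  then have "((\<lambda>x. green s \<psi> x + L * (2 / s\<^sup>2 * (1 - exp (- s * x)))) \<longlongrightarrow> 0 + L * (2 / s\<^sup>2 * (1 - 0))) at_top"
    by (intro tendsto_add tendsto_mult_left tendsto_diff tendsto_const exp0 s)
  then have "((\<lambda>x. green s \<psi> x + L * (2 / s\<^sup>2 * (1 - exp (- s * x)))) \<longlongrightarrow> 2 / s\<^sup>2 * L) at_top"
    by (simp add: mult.commute)
  then show ?thesis
    by (rule Lim_transform_eventually)
      (use eventually_ge_at_top[of 0] in \<open>eventually_elim, simp add: green_\<psi>\<close>)
qed

lemma two_sided_exp_integral_le:
  fixes c x :: real
  assumes c: "0 < c" and x: "0 \<le> x"
  shows "(LINT y:{0..}|lborel. exp (- c * \<bar>x - y\<bar>)) \<le> 2 / c"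
proof -
  have i1: "set_integrable lborel {0..} (\<lambda>y. exp (- c * \<bar>x - y\<bar>) - exp (- c * (x + y)))"
    using set_integrable_green[OF c, of "\<lambda>_. 1" 1 x] by simp
  have i2: "set_integrable lborel {0..} (\<lambda>y. exp (- c * x) * exp (- c * y))"
    by (intro set_integrable_mult_right set_integrable_exp_minus c)
  have "(LINT y:{0..}|lborel. exp (- c * \<bar>x - y\<bar>))
      = (LINT y:{0..}|lborel. (exp (- c * \<bar>x - y\<bar>) - exp (- c * (x + y))) + exp (- c * x) * exp (- c * y))"
    by (simp add: algebra_simps flip: exp_add)
  also have "\<dots> = c * green c (\<lambda>_. 1) x + exp (- c * x) * laplace c (\<lambda>_. 1)"
    using c by (subst set_integral_add(2)[OF i1 i2]) (simp add: green_def laplace_def)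
  also have "\<dots> = 2 / c * (1 - exp (- c * x)) + exp (- c * x) / c"
    using c x by (simp add: green_one laplace_one power2_eq_square)
  also have "\<dots> \<le> 2 / c"
    using c by (simp add: field_simps)
  finally show ?thesis .
qed

lemma mult_exp_minus_le: "t * exp (- t) \<le> exp (- (t / 2))" for t :: real
proof -
  have "t \<le> (1 + t / 4)\<^sup>2"
    using zero_le_power2[of "1 - t / 4"] by (simp add: power2_eq_square algebra_simps)
  also have "\<dots> \<le> (exp (t / 4))\<^sup>2" if "0 \<le> t"
    using that exp_ge_add_one_self[of "t / 4"] by (intro power_mono) auto
  also have "(exp (t / 4))\<^sup>2 = exp (t / 2)"
    by (simp add: power2_eq_square flip: exp_add)
  finally have "t \<le> exp (t / 2)"
    using exp_ge_zero[of "t / 2"] by (cases "0 \<le> t") (auto intro: order_trans[of _ 0])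
  then have "t * exp (- t) \<le> exp (t / 2) * exp (- t)"
    by (intro mult_right_mono) auto
  then show ?thesis by (simp flip: exp_add)
qed

text \<open>Up to the mass lost at 0, the kernel is the two-sided exponential density around \<open>x\<close> with mean
  distance of order \<open>1 / s\<close>. The lost mass is \<open>exp (- s * x)\<close>; it is multiplied by \<open>\<phi> x\<close>, which is small
  where that mass is not, because \<open>\<phi>\<close> vanishes at 0.\<close>
lemma green_approx_identity:
  assumes s: "0 < s" and x: "0 \<le> x" and \<phi>: "continuous_on UNIV \<phi>" "\<And>y. \<bar>\<phi> y\<bar> \<le> C"
    and K: "0 \<le> K" and \<eta>: "0 \<le> \<eta>"
    and mod: "\<And>x y. 0 \<le> x \<Longrightarrow> 0 \<le> y \<Longrightarrow> \<bar>\<phi> y - \<phi> x\<bar> \<le> \<eta> + K * \<bar>x - y\<bar>"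
    and \<phi>0: "\<phi> 0 = 0"
  shows "\<bar>s\<^sup>2 / 2 * green s \<phi> x - \<phi> x\<bar> \<le> 2 * \<eta> + 3 * K / s"
proof -
  let ?k = "\<lambda>y. exp (- s * \<bar>x - y\<bar>) - exp (- s * (x + y))"
  define \<psi> where "\<psi> = (\<lambda>y. \<phi> y + (- \<phi> x) * 1)"
  have \<psi>: "continuous_on UNIV \<psi>" "\<bar>\<psi> y\<bar> \<le> C + \<bar>\<phi> x\<bar>" for y
    using \<phi>(2)[of y] by (auto simp: \<psi>_def intro!: continuous_intros \<phi>)
  have g\<psi>: "green s \<psi> x = green s \<phi> x - \<phi> x * (2 / s\<^sup>2 * (1 - exp (- s * x)))"
    unfolding \<psi>_def using green_add[OF s \<phi>, of "\<lambda>_. - \<phi> x * 1" "\<bar>\<phi> x\<bar>" x]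
      green_scale[of s "- \<phi> x" "\<lambda>_. 1" x] green_one[OF s x] by simp
  let ?g = "\<lambda>y. \<eta> * exp (- s * \<bar>x - y\<bar>) + K / s * exp (- (s / 2) * \<bar>x - y\<bar>)"
  have kernel_int: "set_integrable lborel {0..} (\<lambda>y. exp (- c * \<bar>x - y\<bar>))" if "0 < c" for c
    using set_integrable_resolvent_kernel[OF that, of "\<lambda>_. 1" 1 x] by simp
  have g: "set_integrable lborel {0..} ?g"
    using s by (intro set_integral_add set_integrable_mult_right kernel_int) auto
  have "\<bar>LINT y:{0..}|lborel. ?k y * \<psi> y\<bar> \<le> (LINT y:{0..}|lborel. \<bar>?k y * \<psi> y\<bar>)"
    using set_integral_norm_bound[OF set_integrable_green[OF s \<psi>]] by simp
  also have "\<dots> \<le> (LINT y:{0..}|lborel. ?g y)"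
  proof (intro set_integral_mono g set_integrable_abs set_integrable_green[OF s \<psi>])
    fix y :: real assume y: "y \<in> {0..}"
    have "s * \<bar>x - y\<bar> \<le> s * (x + y)"
      using x y s by (intro mult_left_mono) auto
    then have k: "\<bar>?k y\<bar> \<le> exp (- s * \<bar>x - y\<bar>)" by (simp add: abs_le_iff)
    have p: "\<bar>\<psi> y\<bar> \<le> \<eta> + K * \<bar>x - y\<bar>"
      using mod[OF x, of y] y by (simp add: \<psi>_def)
    have "\<bar>?k y * \<psi> y\<bar> \<le> exp (- s * \<bar>x - y\<bar>) * (\<eta> + K * \<bar>x - y\<bar>)"
      unfolding abs_mult by (intro mult_mono k p) auto
    also have "\<dots> = \<eta> * exp (- s * \<bar>x - y\<bar>) + K / s * ((s * \<bar>x - y\<bar>) * exp (- (s * \<bar>x - y\<bar>)))"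
      using s by (simp add: field_simps)
    also have "\<dots> \<le> \<eta> * exp (- s * \<bar>x - y\<bar>) + K / s * exp (- (s * \<bar>x - y\<bar> / 2))"
      using K s by (intro add_left_mono mult_left_mono mult_exp_minus_le) auto
    finally show "\<bar>?k y * \<psi> y\<bar> \<le> ?g y" by simp
  qed
  also have "\<dots> = \<eta> * (LINT y:{0..}|lborel. exp (- s * \<bar>x - y\<bar>))
      + K / s * (LINT y:{0..}|lborel. exp (- (s / 2) * \<bar>x - y\<bar>))"
    using s by (subst set_integral_add(2)[OF set_integrable_mult_right set_integrable_mult_right])
      (simp_all only: kernel_int set_integral_mult_right zero_less_divide_iff zero_less_numeral simp_thms)
  also have "\<dots> \<le> \<eta> * (2 / s) + K / s * (2 / (s / 2))"
    using \<eta> K s x by (intro add_mono mult_left_mono two_sided_exp_integral_le) auto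
  finally have "s / 2 * \<bar>LINT y:{0..}|lborel. ?k y * \<psi> y\<bar> \<le> s / 2 * (\<eta> * (2 / s) + K / s * (2 / (s / 2)))"
    using s by (intro mult_left_mono) auto
  also have "\<dots> = \<eta> + 2 * K / s"
    using s by (simp add: field_simps)
  also have "s / 2 * \<bar>LINT y:{0..}|lborel. ?k y * \<psi> y\<bar> = \<bar>s\<^sup>2 / 2 * green s \<psi> x\<bar>"
    using s by (simp add: green_def abs_mult power2_eq_square)
  finally have 1: "\<bar>s\<^sup>2 / 2 * green s \<psi> x\<bar> \<le> \<eta> + 2 * K / s" .
  have 2: "\<bar>\<phi> x * exp (- s * x)\<bar> \<le> \<eta> + K / s"
  proof -
    have "\<bar>\<phi> x\<bar> \<le> \<eta> + K * x"
      using mod[OF order_refl x] \<phi>0 x by simp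
    then have "\<bar>\<phi> x\<bar> * exp (- s * x) \<le> (\<eta> + K * x) * exp (- s * x)"
      by (intro mult_right_mono) auto
    also have "\<dots> = \<eta> * exp (- s * x) + K / s * (s * x * exp (- (s * x)))"
      using s by (simp add: field_simps)
    also have "\<dots> \<le> \<eta> * 1 + K / s * 1"
      using \<eta> K s x mult_exp_minus_le[of "s * x"]
      by (intro add_mono mult_left_mono) (auto intro: order_trans)
    finally show ?thesis by (simp add: abs_mult)
  qed
  have "s\<^sup>2 / 2 * green s \<phi> x - \<phi> x = s\<^sup>2 / 2 * green s \<psi> x - \<phi> x * exp (- s * x)"
    unfolding g\<psi> using s by (simp add: field_simps)
  also have "\<bar>\<dots>\<bar> \<le> (\<eta> + 2 * K / s) + (\<eta> + K / s)"
    by (intro order_trans[OF abs_triangle_ineq4] add_mono 1 2)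
  also have "\<dots> = 2 * \<eta> + 3 * K / s" by (simp add: add_divide_distrib[symmetric])
  finally show ?thesis .
qed

text \<open>Uniform continuity of a function with a limit at infinity, written as an affine bound that can be
  integrated against the kernel. The slope comes from boundedness at distances above \<open>\<delta>\<close>.\<close>
lemma modulus_of_continuity_half_line:
  fixes \<phi> :: "real \<Rightarrow> real"
  assumes \<phi>: "continuous_on UNIV \<phi>" "\<And>y. \<bar>\<phi> y\<bar> \<le> C" and lim: "(\<phi> \<longlongrightarrow> L) at_top" and \<eta>: "0 < \<eta>"
  obtains K where "0 \<le> K" "\<And>x y. 0 \<le> x \<Longrightarrow> 0 \<le> y \<Longrightarrow> \<bar>\<phi> y - \<phi> x\<bar> \<le> \<eta> + K * \<bar>x - y\<bar>"
proof -
  obtain Y where Y: "\<And>y. Y \<le> y \<Longrightarrow> \<bar>\<phi> y - L\<bar> < \<eta> / 2"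
    using tendstoD[OF lim, of "\<eta> / 2"] \<eta> by (auto simp: eventually_at_top_linorder dist_real_def)
  have "uniformly_continuous_on {0..Y + 1} \<phi>"
    using continuous_on_subset[OF \<phi>(1)] by (intro compact_uniformly_continuous) auto
  then obtain d where d: "0 < d" "\<And>x y. x \<in> {0..Y+1} \<Longrightarrow> y \<in> {0..Y+1} \<Longrightarrow> \<bar>y - x\<bar> < d \<Longrightarrow> \<bar>\<phi> y - \<phi> x\<bar> < \<eta>"
    unfolding uniformly_continuous_on_def dist_real_def using \<eta> by metis
  define \<delta> where "\<delta> = min d 1"
  have \<delta>: "0 < \<delta>" "\<delta> \<le> d" "\<delta> \<le> 1" using d by (auto simp: \<delta>_def)
  have C: "0 \<le> C" using \<phi>(2)[of 0] by simp
  show ?thesis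
  proof (rule that[of "2 * C / \<delta>"])
    show "0 \<le> 2 * C / \<delta>" using C \<delta> by simp
    fix x y :: real assume xy: "0 \<le> x" "0 \<le> y"
    have n: "0 \<le> 2 * C / \<delta> * \<bar>x - y\<bar>" using C \<delta> by simp
    consider "\<delta> \<le> \<bar>x - y\<bar>" | "\<bar>x - y\<bar> < \<delta>" "x \<le> Y + 1" "y \<le> Y + 1"
      | "\<bar>x - y\<bar> < \<delta>" "Y \<le> x" "Y \<le> y"
      using \<delta>(3) by linarith
    then show "\<bar>\<phi> y - \<phi> x\<bar> \<le> \<eta> + 2 * C / \<delta> * \<bar>x - y\<bar>"
    proof cases
      case 1
      have "\<bar>\<phi> y - \<phi> x\<bar> \<le> 2 * C"
        using \<phi>(2)[of x] \<phi>(2)[of y] by linarith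
      also have "\<dots> = 2 * C / \<delta> * \<delta>" using \<delta> by simp
      also have "\<dots> \<le> 2 * C / \<delta> * \<bar>x - y\<bar>"
        using 1 C \<delta> by (intro mult_left_mono) auto
      finally show ?thesis using \<eta> by simp
    next
      case 2
      then have "\<bar>\<phi> y - \<phi> x\<bar> < \<eta>" using xy \<delta> by (intro d) auto
      then show ?thesis using n by linarith
    next
      case 3
      then show ?thesis using Y[of x] Y[of y] n by linarith
    qed
  qed
qed

section \<open>Continuous functions on the star graph\<close>

text \<open>A uniform limit of continuous functions is continuous, whatever the topology of the domain. So
  the continuous functions on the star graph form a Banach space.\<close>
instance bcontfun :: (topological_space, complete_space) complete_space
proof
  fix f :: "nat \<Rightarrow> 'a \<Rightarrow>\<^sub>C 'b"
  assume "Cauchy f"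
  then have "uniformly_Cauchy_on UNIV (\<lambda>n. apply_bcontfun (f n))"
    unfolding Cauchy_def uniformly_Cauchy_on_def by (metis dist_fun_lt_imp_dist_val_lt)
  then obtain g where g: "uniform_limit UNIV f g sequentially"
    using Cauchy_uniformly_convergent unfolding uniformly_convergent_on_def by blast
  obtain l' where "(f \<longlonglongrightarrow> l')"
    by (rule uniform_limit_bcontfunE[OF g sequentially_bot])
  then show "convergent f"
    by (rule convergentI)
qed

instance bcontfun :: (topological_space, banach) banach ..

lemma tendsto_apply_bcontfun:
  fixes f :: "'i \<Rightarrow> 'a::topological_space \<Rightarrow>\<^sub>C 'b::metric_space"
  assumes "(f \<longlongrightarrow> l) F"
  shows "((\<lambda>i. f i x) \<longlongrightarrow> l x) F"
  using tendsto_uniform_limitI[OF tendsto_bcontfun_uniform_limit[OF assms]] by simp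

lemma continuous_on_star_iff:
  "continuous_on UNIV f \<longleftrightarrow> (\<forall>i. continuous_on UNIV (\<lambda>y. f (star_pt i y)))"
  by (auto simp: continuous_on_open_vimage open_star_graph_def vimage_def)

lemma continuous_star_norm: "continuous_on UNIV star_norm"
  by (simp add: continuous_on_star_iff)

lemma continuous_star_bcontfun:
  fixes f :: "'k::finite star_graph \<Rightarrow> real"
  assumes "continuous_on UNIV f"
  shows "f \<in> bcontfun"
  using assms compact_continuous_image[OF assms compact_star_graph]
  by (simp add: bcontfun_def compact_imp_bounded)

lemma tendsto_ennreal_top_at_top: "((\<lambda>y. ennreal y) \<longlongrightarrow> top) at_top"
  by (simp add: ennreal_tendsto_top_eq_at_top filterlim_ident)

lemma star_tendsto_infinity:
  fixes f :: "'k star_graph \<Rightarrow> 'b::topological_space"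
  assumes "continuous_on UNIV f"
  shows "((\<lambda>y. f (star_pt i (ennreal y))) \<longlongrightarrow> f (star_pt i top)) at_top"
proof -
  have "continuous_on UNIV (\<lambda>y. f (star_pt i y))"
    using assms by (simp add: continuous_on_star_iff)
  then show ?thesis
    by (rule continuous_on_tendsto_compose[OF _ tendsto_ennreal_top_at_top]) auto
qed

lemma star_cases:
  obtains i y where "0 \<le> y" "x = star_pt i (ennreal y)" | i where "x = star_pt i top"
proof -
  obtain i y where x: "x = star_pt i y" by (rule star_graph_exhaust)
  show thesis
    by (cases y rule: ennreal_cases) (use x that in auto)
qed

text \<open>The points at infinity are limits of finite points, so identities and inequalities between
  continuous functions need to be verified at finite points only.\<close>
lemma star_le:
  fixes f g :: "'k star_graph \<Rightarrow> real"
  assumes "continuous_on UNIV f" "continuous_on UNIV g"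
    and le: "\<And>i y. 0 \<le> y \<Longrightarrow> f (star_pt i (ennreal y)) \<le> g (star_pt i (ennreal y))"
  shows "f x \<le> g x"
proof (cases x rule: star_cases)
  case (2 i)
  have "\<forall>\<^sub>F y in at_top. f (star_pt i (ennreal y)) \<le> g (star_pt i (ennreal y))"
    using eventually_ge_at_top[of 0] by eventually_elim (rule le)
  then show ?thesis
    unfolding 2 by (intro tendsto_le[OF _ star_tendsto_infinity star_tendsto_infinity] assms) auto
qed (use le in auto)

lemma star_eq:
  fixes f g :: "'k star_graph \<Rightarrow> real"
  assumes "continuous_on UNIV f" "continuous_on UNIV g"
    and "\<And>i y. 0 \<le> y \<Longrightarrow> f (star_pt i (ennreal y)) = g (star_pt i (ennreal y))"
  shows "f x = g x"
proof (rule antisym)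
  show "f x \<le> g x" by (rule star_le[OF assms(1,2)]) (simp add: assms(3))
  show "g x \<le> f x" by (rule star_le[OF assms(2,1)]) (simp add: assms(3))
qed

lemma star_edge_star_pt:
  assumes "y \<noteq> 0"
  shows "star_edge (star_pt i y) = i"
proof -
  have "\<exists>z. star_pt i y = star_pt (SOME j. \<exists>z. star_pt i y = star_pt j z) z"
    by (rule someI_ex[of "\<lambda>j. \<exists>z. star_pt i y = star_pt j z"]) (rule exI[of _ i], rule exI[of _ y], rule refl)
  then obtain z where "star_pt i y = star_pt (star_edge (star_pt i y)) z"
    unfolding star_edge_def ..
  then show ?thesis
    using star_pt_eq_iff[THEN iffD1, of i y "star_edge (star_pt i y)" z] assms by argo
qed

lemma star_norm_center: "star_norm center = 0"
  using star_norm_star_pt[of undefined 0] by simp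

lemma star_extend_star_pt:
  assumes "\<And>i j. u i 0 = u j 0" "0 \<le> y"
  shows "star_extend u (star_pt i (ennreal y)) = u i y"
proof (cases "y = 0")
  case True
  then show ?thesis
    using assms(1)[of "star_edge center" i] by (simp add: star_extend_def star_norm_center)
next
  case False
  then show ?thesis using assms(2) by (simp add: star_extend_def star_edge_star_pt)
qed

lemma star_extend_infinity: "star_extend u (star_pt i top) = Lim at_top (u i)"
  by (simp add: star_extend_def star_edge_star_pt)

lemma continuous_ennreal_extension:
  fixes u :: "real \<Rightarrow> real"
  assumes u: "continuous_on {0..} u" and lim: "(u \<longlongrightarrow> l) at_top"
    and f: "\<And>y. 0 \<le> y \<Longrightarrow> f (ennreal y) = u y" "f top = l"
  shows "continuous_on UNIV f"
  unfolding continuous_on_eq_continuous_at[OF open_UNIV] isCont_def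
proof
  fix y :: ennreal
  show "f \<midarrow>y\<rightarrow> f y"
  proof (cases y rule: ennreal_cases)
    case (real r)
    have "(enn2real \<longlongrightarrow> r) (at y)"
      using real by (intro tendsto_enn2real) (auto intro: tendsto_eq_intros)
    then have "((\<lambda>y. u (enn2real y)) \<longlongrightarrow> u r) (at y)"
      by (rule continuous_on_tendsto_compose[OF u]) (use real in auto)
    moreover have "\<forall>\<^sub>F y' in at y. u (enn2real y') = f y'"
    proof -
      have "\<forall>\<^sub>F y' in at y. y' < top"
        by (rule order_tendstoD(2)[OF tendsto_ident_at]) (use real in auto)
      then show ?thesis
      proof eventually_elim
        case (elim y')
        then show ?case using f(1)[of "enn2real y'"] by simp
      qed
    qed
    ultimately have "(f \<longlongrightarrow> u r) (at y)" by (rule Lim_transform_eventually)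
    then show ?thesis using real f(1) by simp
  next
    case top
    show ?thesis
      unfolding top f(2) tendsto_iff
    proof (intro allI impI)
      fix e :: real assume "0 < e"
      then obtain M where M: "\<And>r. M \<le> r \<Longrightarrow> dist (u r) l < e"
        using tendstoD[OF lim] by (auto simp: eventually_at_top_linorder)
      have "\<forall>\<^sub>F y' in at top. ennreal (max 0 M) < y'"
        by (rule order_tendstoD(1)[OF tendsto_ident_at]) simp
      then show "\<forall>\<^sub>F y' in at top. dist (f y') l < e"
      proof eventually_elim
        case (elim y')
        show ?case
        proof (cases y' rule: ennreal_cases)
          case (real r)
          with elim have "max 0 M < r" by (simp add: ennreal_less_iff)
          then show ?thesis using real f(1)[of r] M[of r] by simp
        next
          case top
          then show ?thesis using f(2) \<open>0 < e\<close> by simp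
        qed
      qed
    qed
  qed
qed

lemma continuous_star_extend:
  assumes u: "\<And>i. continuous_on {0..} (u i)" and lim: "\<And>i. (u i \<longlongrightarrow> l i) at_top"
    and u0: "\<And>i j. u i 0 = u j 0"
  shows "continuous_on UNIV (star_extend u)"
  unfolding continuous_on_star_iff
proof
  fix i
  have "Lim at_top (u i) = l i"
    by (rule tendsto_Lim[OF _ lim]) simp
  then show "continuous_on UNIV (\<lambda>y. star_extend u (star_pt i y))"
    by (intro continuous_ennreal_extension[OF u lim])
      (auto simp: star_extend_star_pt[where u = u, OF u0] star_extend_infinity)
qed

lemma continuous_edge: "continuous_on UNIV (edge g i)"
proof -
  have "continuous_on UNIV (\<lambda>y. g (star_pt i y))"
    using continuous_on_star_iff[of "apply_bcontfun g"] by simp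
  then have "continuous_on UNIV (\<lambda>y. g (star_pt i (ennreal y)))"
    by (rule continuous_on_compose2[OF _ continuous_on_ennreal[OF continuous_on_id]]) auto
  then show ?thesis unfolding edge_def[abs_def] .
qed

lemma abs_edge_le: "\<bar>edge g i y\<bar> \<le> norm g"
  using norm_bounded[of g] by (simp add: edge_def)

lemma edge_0: "edge g i 0 = g center"
  by (simp add: edge_def)

lemma edge_tendsto: "(edge g i \<longlongrightarrow> g (star_pt i top)) at_top"
  unfolding edge_def[abs_def] by (rule star_tendsto_infinity) simp

section \<open>Resolvent solutions for the Laplacian\<close>

lemma R0_eq_green: "R0 lam g = star_extend (\<lambda>i. green (sqrt (2 * lam)) (edge g i))"
  by (simp add: R0_def green_def[abs_def])

lemma C_edge_eq_laplace: "C_edge lam i g = laplace (sqrt (2 * lam)) (edge g i) / sqrt (2 * lam)"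
  by (simp add: C_edge_def laplace_def)

lemma green_0: "0 < s \<Longrightarrow> green s (edge g i) 0 = 0"
  using abs_green_le[OF _ order_refl continuous_edge abs_edge_le, of s g i] by simp

context
  fixes lam :: real
  assumes lam: "0 < lam"
begin

lemma sqrt_pos: "0 < sqrt (2 * lam)"
  using lam by simp

lemma R0_star_pt: "0 \<le> y \<Longrightarrow> R0 lam g (star_pt i (ennreal y)) = green (sqrt (2 * lam)) (edge g i) y"
  unfolding R0_eq_green by (rule star_extend_star_pt) (auto simp: green_0[OF sqrt_pos])

lemma ell0_star_pt: "0 \<le> y \<Longrightarrow> ell0 lam (star_pt i (ennreal y)) = exp (- sqrt (2 * lam) * y)"
  unfolding ell0_def by (rule star_extend_star_pt) auto

lemma continuous_R0: "continuous_on UNIV (R0 lam g)"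
  unfolding R0_eq_green
proof (rule continuous_star_extend)
  fix i
  show "continuous_on {0..} (green (sqrt (2 * lam)) (edge g i))"
    by (rule DERIV_continuous_on, rule has_derivative_green[OF sqrt_pos _ continuous_edge abs_edge_le]) simp
  show "(green (sqrt (2 * lam)) (edge g i) \<longlongrightarrow> 2 / (sqrt (2 * lam))\<^sup>2 * g (star_pt i top)) at_top"
    by (rule green_tendsto_at_top[OF sqrt_pos continuous_edge abs_edge_le edge_tendsto])
qed (simp add: green_0[OF sqrt_pos])

lemma continuous_ell0: "continuous_on UNIV (ell0 lam)"
  unfolding ell0_def
proof (rule continuous_star_extend)
  show "continuous_on {0..} (\<lambda>x. exp (- sqrt (2 * lam) * x))"
    by (intro continuous_intros)
  show "((\<lambda>x. exp (- sqrt (2 * lam) * x)) \<longlongrightarrow> 0) at_top"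
    by (rule filterlim_compose[OF exp_at_bot],
        rule filterlim_tendsto_neg_mult_at_bot[OF tendsto_const _ filterlim_ident]) (use lam in simp)
qed simp

lemma R0_center: "R0 lam g center = 0"
  using R0_star_pt[of 0 g undefined] by (simp add: green_0[OF sqrt_pos])

lemma ell0_center: "ell0 lam center = 1"
  using ell0_star_pt[of 0 undefined] by simp

lemma ell0_nonneg: "0 \<le> ell0 lam x"
  by (rule star_le[OF _ continuous_ell0]) (auto simp: ell0_star_pt)

lemma ell0_le_one: "ell0 lam x \<le> 1"
  by (rule star_le[OF continuous_ell0]) (use lam in \<open>auto simp: ell0_star_pt\<close>)

lemma R0_add: "R0 lam (g + h) x = R0 lam g x + R0 lam h x"
proof (rule star_eq)
  show "R0 lam (g + h) (star_pt i (ennreal y)) = R0 lam g (star_pt i (ennreal y)) + R0 lam h (star_pt i (ennreal y))"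
    if "0 \<le> y" for i y
    using green_add[OF sqrt_pos continuous_edge[of g i] abs_edge_le continuous_edge[of h i] abs_edge_le]
    by (simp add: R0_star_pt that edge_def[abs_def])
qed (intro continuous_intros continuous_R0)+

lemma R0_scale: "R0 lam (c *\<^sub>R g) x = c * R0 lam g x"
proof (rule star_eq)
  show "R0 lam (c *\<^sub>R g) (star_pt i (ennreal y)) = c * R0 lam g (star_pt i (ennreal y))"
    if "0 \<le> y" for i y
    using green_scale[of "sqrt (2 * lam)" c "edge g i"]
    by (simp add: R0_star_pt that edge_def[abs_def])
qed (intro continuous_intros continuous_R0)+

lemma R0_mono:
  assumes "\<And>x. apply_bcontfun g x \<le> apply_bcontfun h x"
  shows "R0 lam g x \<le> R0 lam h x"
proof (rule star_le)
  show "R0 lam g (star_pt i (ennreal y)) \<le> R0 lam h (star_pt i (ennreal y))" if "0 \<le> y" for i y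
    using green_mono[OF sqrt_pos that continuous_edge[of g i] abs_edge_le continuous_edge[of h i] abs_edge_le] assms
    by (simp add: R0_star_pt that edge_def[abs_def])
qed (rule continuous_R0)+

text \<open>In probabilistic terms: the process absorbed at the center survives an independent exponential
  time unless it has reached the center before.\<close>
lemma lam_R0_one: "lam * R0 lam (const_bcontfun 1) x = 1 - ell0 lam x"
proof (rule star_eq)
  show "lam * R0 lam (const_bcontfun 1) (star_pt i (ennreal y)) = 1 - ell0 lam (star_pt i (ennreal y))"
    if "0 \<le> y" for i y
    using green_one[OF sqrt_pos that] lam
    by (simp add: R0_star_pt ell0_star_pt that edge_def[abs_def])
qed (intro continuous_intros continuous_R0 continuous_ell0)+

lemma abs_R0_le: "\<bar>R0 lam g x\<bar> \<le> norm g / lam * (1 - ell0 lam x)"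
proof (rule star_le)
  show "\<bar>R0 lam g (star_pt i (ennreal y))\<bar> \<le> norm g / lam * (1 - ell0 lam (star_pt i (ennreal y)))"
    if "0 \<le> y" for i y
    using abs_green_le[OF sqrt_pos that continuous_edge abs_edge_le, of g i] lam
    by (simp add: R0_star_pt ell0_star_pt that)
qed (intro continuous_intros continuous_R0 continuous_ell0)+

end

lemma half_line_deriv_eq:
  assumes "0 \<le> y" "(u has_real_derivative d) (at y within {0..})"
  shows "half_line_deriv u y = d"
proof -
  have "at y within {0..} \<noteq> bot"
  proof -
    have "at y within {y..y + 1} \<noteq> bot" by (simp add: at_within_Icc_at_right)
    moreover have "at y within {y..y + 1} \<le> at y within {0..}"
      using assms(1) by (intro at_le) auto
    ultimately show ?thesis using bot.extremum_uniqueI by metis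
  qed
  then show ?thesis
    unfolding half_line_deriv_def
    using assms(2) by (intro vector_derivative_within) (simp_all flip: has_real_derivative_iff_has_vector_derivative)
qed

lemma half_line_deriv_works:
  assumes "u differentiable_on {0..}" "0 \<le> y"
  shows "(u has_real_derivative half_line_deriv u y) (at y within {0..})"
  using assms unfolding half_line_deriv_def has_real_derivative_iff_has_vector_derivative
  by (simp add: differentiable_on_def vector_derivative_works)

text \<open>Derivatives of a function in resolvent form. At the center they give the quantities that
  enter the boundary condition.\<close>
lemma resolvent_form_derivs:
  assumes lam: "0 < lam" and f: "\<And>x. apply_bcontfun f x = R0 lam g x + c * ell0 lam x"
  defines "s \<equiv> sqrt (2 * lam)"
  assumes y: "0 \<le> y"
  shows "(edge f i has_real_derivative edge_d1 f i y) (at y within {0..})"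
    and "(edge_d1 f i has_real_derivative edge_d2 f i y) (at y within {0..})"
    and "edge_d1 f i y = green_deriv s (edge g i) y - c * s * exp (- s * y)"
    and "edge_d2 f i y = 2 * (lam * edge f i y - edge g i y)"
proof -
  have s: "0 < s" "s\<^sup>2 = 2 * lam" using lam by (auto simp: s_def)
  have e: "edge f i y = green s (edge g i) y + c * exp (- s * y)" if "0 \<le> y" for y
    using that lam by (simp add: edge_def f R0_star_pt ell0_star_pt s_def)
  have d1: "(edge f i has_real_derivative green_deriv s (edge g i) y - c * s * exp (- s * y)) (at y within {0..})"
    if y: "0 \<le> y" for y
  proof -
    have "((\<lambda>y. green s (edge g i) y + c * exp (- s * y)) has_real_derivative
        green_deriv s (edge g i) y - c * s * exp (- s * y)) (at y within {0..})"
      by (rule derivative_eq_intros has_derivative_green[OF s(1) y continuous_edge abs_edge_le] refl)+ simp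
    then show ?thesis
      unfolding has_field_derivative_def
      by (rule has_derivative_transform[rotated 2]) (use y e in auto)
  qed
  have e1: "edge_d1 f i y = green_deriv s (edge g i) y - c * s * exp (- s * y)" if "0 \<le> y" for y
    unfolding edge_d1_def by (rule half_line_deriv_eq[OF that d1[OF that]])
  have d2: "(edge_d1 f i has_real_derivative 2 * (lam * edge f i y - edge g i y)) (at y within {0..})"
    if y: "0 \<le> y" for y
  proof -
    have "((\<lambda>y. green_deriv s (edge g i) y - c * s * exp (- s * y)) has_real_derivative
        2 * (lam * edge f i y - edge g i y)) (at y within {0..})"
      unfolding e[OF y]
      by (rule derivative_eq_intros has_derivative_green_deriv[OF s(1) y continuous_edge abs_edge_le] refl)+
        (simp add: s(2)[unfolded power2_eq_square] power2_eq_square algebra_simps)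
    then show ?thesis
      unfolding has_field_derivative_def
      by (rule has_derivative_transform[rotated 2]) (use y e1 in auto)
  qed
  have e2: "edge_d2 f i y = 2 * (lam * edge f i y - edge g i y)" if "0 \<le> y" for y
    unfolding edge_d2_def by (rule half_line_deriv_eq[OF that d2[OF that]])
  show "(edge f i has_real_derivative edge_d1 f i y) (at y within {0..})"
    "(edge_d1 f i has_real_derivative edge_d2 f i y) (at y within {0..})"
    "edge_d1 f i y = green_deriv s (edge g i) y - c * s * exp (- s * y)"
    "edge_d2 f i y = 2 * (lam * edge f i y - edge g i y)"
    using d1[OF y] d2[OF y] e1[OF y] e2[OF y] by auto
qed

text \<open>The equation alone, without a boundary condition, leaves exactly one free parameter: the value
  of \<open>f\<close> at the center.\<close>
lemma star_laplacian_resolvent: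
  fixes f g :: "'k star_graph \<Rightarrow>\<^sub>C real"
  assumes lam: "0 < lam"
  shows "(f, lam *\<^sub>R f - g) \<in> star_laplacian
    \<longleftrightarrow> (\<forall>x. f x = R0 lam g x + f center * ell0 lam x)"
proof
  let ?s = "sqrt (2 * lam)"
  have s: "0 < ?s" using lam by simp
  assume "(f, lam *\<^sub>R f - g) \<in> star_laplacian"
  then have C2: "f \<in> C2_star"
    and eq: "\<And>i y. 0 \<le> y \<Longrightarrow> edge (lam *\<^sub>R f - g) i y = edge_d2 f i y / 2"
    by (auto simp: star_laplacian_def)
  have "edge f i y = green ?s (edge g i) y + edge f i 0 * exp (- ?s * y)" if y: "0 \<le> y" for i y
  proof (rule bounded_solution_green[OF s continuous_edge abs_edge_le _ _ abs_edge_le y])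
    fix y :: real assume y: "0 \<le> y"
    show "(edge f i has_real_derivative edge_d1 f i y) (at y within {0..})"
      using C2 y unfolding edge_d1_def by (intro half_line_deriv_works) (auto simp: C2_star_def)
    have "(edge_d1 f i has_real_derivative edge_d2 f i y) (at y within {0..})"
      using C2 y unfolding edge_d2_def by (intro half_line_deriv_works) (auto simp: C2_star_def)
    moreover have "edge_d2 f i y = ?s\<^sup>2 * edge f i y - 2 * edge g i y"
      using eq[OF y, of i] lam by (simp add: edge_def)
    ultimately show "(edge_d1 f i has_real_derivative ?s\<^sup>2 * edge f i y - 2 * edge g i y) (at y within {0..})"
      by simp
  qed
  then have *: "f (star_pt i (ennreal y)) = R0 lam g (star_pt i (ennreal y)) + f center * ell0 lam (star_pt i (ennreal y))"
    if "0 \<le> y" for i y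
    using that lam by (simp add: R0_star_pt ell0_star_pt edge_0) (simp add: edge_def)
  have "continuous_on UNIV (\<lambda>x. R0 lam g x + f center * ell0 lam x)"
    by (intro continuous_intros continuous_R0 continuous_ell0 lam)
  then show "\<forall>x. f x = R0 lam g x + f center * ell0 lam x"
    using star_eq[OF continuous_on_apply_bcontfun _ *] by blast
next
  assume "\<forall>x. f x = R0 lam g x + f center * ell0 lam x"
  then have f: "\<And>x. f x = R0 lam g x + f center * ell0 lam x" by blast
  note d = resolvent_form_derivs[OF lam f]
  have lim: "(edge_d2 f i \<longlongrightarrow> 2 * (lam * f (star_pt i top) - g (star_pt i top))) at_top" for i
  proof (rule Lim_transform_eventually)
    show "((\<lambda>y. 2 * (lam * edge f i y - edge g i y)) \<longlongrightarrow> 2 * (lam * f (star_pt i top) - g (star_pt i top))) at_top"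
      by (intro tendsto_intros edge_tendsto)
    show "\<forall>\<^sub>F y in at_top. 2 * (lam * edge f i y - edge g i y) = edge_d2 f i y"
      using eventually_ge_at_top[of 0] by eventually_elim (simp add: d(4))
  qed
  have cont: "continuous_on {0..} (edge_d2 f i)" for i
  proof -
    have "continuous_on {0..} (\<lambda>y. 2 * (lam * edge f i y - edge g i y))"
      by (intro continuous_intros continuous_on_subset[OF continuous_edge]) auto
    then show ?thesis by (subst continuous_on_cong[OF refl d(4)]) auto
  qed
  have diff: "u differentiable_on {0..}"
    if "\<And>y. 0 \<le> y \<Longrightarrow> (u has_real_derivative u' y) (at y within {0..})" for u u' :: "real \<Rightarrow> real"
    using that unfolding differentiable_on_def has_field_derivative_def
    by (auto simp: differentiable_def)
  have "f \<in> C2_star"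
    unfolding C2_star_def using lim cont diff[OF d(1)] diff[OF d(2)]
    by (auto simp: d(4) edge_0)
  then show "(f, lam *\<^sub>R f - g) \<in> star_laplacian"
    by (auto simp: star_laplacian_def d(4)) (simp add: edge_def)
qed

section \<open>The boundary condition and the resolvent\<close>

lemma apply_const_bcontfun [simp]: "apply_bcontfun (const_bcontfun c) x = c"
  by (simp add: const_bcontfun.rep_eq)

lemma C_total_add:
  assumes "0 < lam"
  shows "C_total \<alpha> \<beta> lam (g + h) = C_total \<alpha> \<beta> lam g + C_total \<alpha> \<beta> lam h"
proof -
  have "laplace (sqrt (2 * lam)) (edge (g + h) i)
      = laplace (sqrt (2 * lam)) (edge g i) + laplace (sqrt (2 * lam)) (edge h i)" for i
    using laplace_add[OF sqrt_pos[OF assms] continuous_edge[of g i] abs_edge_le continuous_edge[of h i] abs_edge_le]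
    by (simp add: edge_def[abs_def])
  then show ?thesis
    by (simp add: C_total_def C_edge_eq_laplace sum.distrib add_divide_distrib algebra_simps)
qed

lemma C_total_scale: "C_total \<alpha> \<beta> lam (c *\<^sub>R g) = c * C_total \<alpha> \<beta> lam g"
proof -
  have "laplace (sqrt (2 * lam)) (edge (c *\<^sub>R g) i) = c * laplace (sqrt (2 * lam)) (edge g i)" for i
    using laplace_scale[of "sqrt (2 * lam)" c "edge g i"] by (simp add: edge_def[abs_def])
  then have "C_edge lam i (c *\<^sub>R g) = c * C_edge lam i g" for i
    by (simp add: C_edge_eq_laplace)
  then show ?thesis
    by (simp add: C_total_def sum_distrib_left distrib_left mult_ac)
qed

lemma C_total_mono:
  assumes "0 < lam" "0 \<le> \<alpha>" "\<And>i. 0 \<le> \<beta> i" "\<And>x. apply_bcontfun g x \<le> apply_bcontfun h x"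
  shows "C_total \<alpha> \<beta> lam g \<le> C_total \<alpha> \<beta> lam h"
proof -
  have "C_edge lam i g \<le> C_edge lam i h" for i
    unfolding C_edge_eq_laplace using assms
    by (intro divide_right_mono laplace_mono[OF sqrt_pos[OF assms(1)] continuous_edge abs_edge_le continuous_edge abs_edge_le])
      (auto simp: edge_def)
  then show ?thesis
    unfolding C_total_def using assms by (intro add_mono mult_left_mono sum_mono) auto
qed

lemma lam_C_total_one:
  fixes \<beta> :: "'k::finite \<Rightarrow> real"
  assumes "0 < lam"
  shows "lam * C_total \<alpha> \<beta> lam (const_bcontfun 1) = sqrt (2 * lam) * (\<Sum>i\<in>UNIV. \<beta> i) + lam * \<alpha>"
proof -
  have "C_edge lam i (const_bcontfun 1) = 1 / (2 * lam)" for i :: 'k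
    using laplace_one[OF sqrt_pos[OF assms]] assms by (simp add: C_edge_eq_laplace edge_def[abs_def])
  then have "(\<Sum>i\<in>UNIV. \<beta> i * C_edge lam i (const_bcontfun 1)) = (\<Sum>i\<in>UNIV. \<beta> i) / (2 * lam)"
    by (simp add: sum_divide_distrib)
  then show ?thesis
    using assms by (simp add: C_total_def distrib_left)
qed

text \<open>The last assumption keeps the center from being a holding point: it is left through
  infinitely many small jumps or by reflection into an edge. It covers both the limiting operator
  and the approximating ones.\<close>
locale star_boundary =
  fixes \<alpha> \<gamma> :: real and \<beta> :: "'k::finite \<Rightarrow> real" and m :: "'k star_graph measure"
  assumes sets_m: "sets m = sets (restrict_space borel (- {center}))"
    and finite_m: "(\<integral>\<^sup>+ x. min 1 (star_norm x) \<partial>m) < \<infinity>"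
    and \<alpha>: "0 \<le> \<alpha>" and \<gamma>: "0 \<le> \<gamma>" and \<beta>: "\<And>i. 0 \<le> \<beta> i"
    and infinite: "emeasure m (space m) = \<infinity> \<or> (\<exists>i. 0 < \<beta> i)"
begin

lemma space_m: "space m = - {center}"
  using sets_eq_imp_space_eq[OF sets_m] by (simp add: space_restrict_space)

lemma measurable_continuous:
  fixes f :: "'k star_graph \<Rightarrow> 'b::topological_space"
  assumes "continuous_on UNIV f"
  shows "f \<in> borel_measurable m"
proof -
  have "f \<in> borel_measurable (restrict_space borel (- {center}))"
    by (rule measurable_restrict_space1[OF borel_measurable_continuous_onI[OF assms]])
  then show ?thesis using measurable_cong_sets[OF sets_m refl] by blast
qed

text \<open>Near the center \<open>1 - ell0 lam\<close> is of first order in the distance, and it is bounded, so the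
  moment condition on the measure applies. It dominates every \<open>R0 lam g\<close> by \<open>abs_R0_le\<close>.\<close>
lemma integrable_one_minus_ell0:
  assumes lam: "0 < lam"
  shows "integrable m (\<lambda>x. 1 - ell0 lam x)"
proof (rule integrableI_bounded)
  let ?s = "sqrt (2 * lam)"
  show "(\<lambda>x. 1 - ell0 lam x) \<in> borel_measurable m"
    by (intro measurable_continuous continuous_intros continuous_ell0 lam)
  have le: "ennreal (norm (1 - ell0 lam x)) \<le> ennreal (1 + ?s) * min 1 (star_norm x)" for x
  proof (cases x rule: star_cases)
    case (1 i y)
    have e: "0 \<le> 1 - exp (- ?s * y)" using 1 lam by simp
    show ?thesis
    proof (cases "y \<le> 1")
      case True
      have "1 - exp (- ?s * y) \<le> ?s * y" using exp_ge_add_one_self[of "- ?s * y"] by simp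
      also have "\<dots> \<le> (1 + ?s) * y" using 1 by (simp add: distrib_right)
      finally have "ennreal (1 - exp (- ?s * y)) \<le> ennreal ((1 + ?s) * y)" by (rule ennreal_leI)
      also have "\<dots> = ennreal (1 + ?s) * ennreal y" using lam by (intro ennreal_mult') simp
      also have "ennreal y = min 1 (ennreal y)" using True by (simp add: min_def)
      finally show ?thesis using 1 e by (simp add: ell0_star_pt[OF lam])
    next
      case False
      then have "min 1 (ennreal y) = 1" by (simp add: min_def)
      moreover have "1 - exp (- ?s * y) \<le> 1 + ?s"
        by (rule order_trans[of _ 1]) (use lam in auto)
      ultimately show ?thesis using 1 e by (simp add: ell0_star_pt[OF lam] ennreal_leI)
    qed
  next
    case (2 i)
    have "1 - ell0 lam x \<le> 1 + ?s"
      by (rule order_trans[of _ 1]) (use ell0_nonneg[OF lam, of x] lam in auto)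
    then show ?thesis
      using 2 ell0_le_one[OF lam, of x] by (simp add: ennreal_leI min_def)
  qed
  have "(\<integral>\<^sup>+ x. ennreal (norm (1 - ell0 lam x)) \<partial>m) \<le> (\<integral>\<^sup>+ x. ennreal (1 + ?s) * min 1 (star_norm x) \<partial>m)"
    by (intro nn_integral_mono le)
  also have "\<dots> = ennreal (1 + ?s) * (\<integral>\<^sup>+ x. min 1 (star_norm x) \<partial>m)"
    by (intro nn_integral_cmult measurable_continuous continuous_on_min continuous_on_const continuous_star_norm)
  also have "\<dots> < \<infinity>"
    using finite_m by (simp add: ennreal_mult_less_top)
  finally show "(\<integral>\<^sup>+ x. ennreal (norm (1 - ell0 lam x)) \<partial>m) < \<infinity>" .
qed

lemma integrable_R0:
  assumes lam: "0 < lam"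
  shows "integrable m (R0 lam g)"
proof (rule Bochner_Integration.integrable_bound)
  show "integrable m (\<lambda>x. norm g / lam * (1 - ell0 lam x))"
    by (intro integrable_mult_right integrable_one_minus_ell0 lam)
  show "R0 lam g \<in> borel_measurable m"
    by (intro measurable_continuous continuous_R0 lam)
  show "AE x in m. norm (R0 lam g x) \<le> norm (norm g / lam * (1 - ell0 lam x))"
  proof (intro always_eventually allI)
    fix x :: "'k star_graph"
    have "0 \<le> norm g / lam * (1 - ell0 lam x)"
      using ell0_le_one[OF lam, of x] lam by simp
    then show "norm (R0 lam g x) \<le> norm (norm g / lam * (1 - ell0 lam x))"
      using abs_R0_le[OF lam, of g x] by (simp only: real_norm_def abs_of_nonneg)
  qed
qed

text \<open>The numerator and, up to the summand \<open>\<gamma>\<close>, the denominator of \<open>C_bar\<close>. They are linked by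
  \<open>mass lam = lam * boundary_fun lam 1\<close>, and \<open>boundary_fun lam\<close> is a positive linear functional; this
  is all that the bounds on \<open>C_bar\<close> need.\<close>
definition mass :: "real \<Rightarrow> real" where
  "mass lam = (\<integral>x. 1 - ell0 lam x \<partial>m) + sqrt (2 * lam) * (\<Sum>i\<in>UNIV. \<beta> i) + lam * \<alpha>"

definition boundary_fun :: "real \<Rightarrow> ('k star_graph \<Rightarrow>\<^sub>C real) \<Rightarrow> real" where
  "boundary_fun lam g = (\<integral>x. R0 lam g x \<partial>m) + C_total \<alpha> \<beta> lam g"

lemma sets_tail: "0 < \<epsilon> \<Longrightarrow> star_tail \<epsilon> \<in> sets m"
proof -
  assume \<epsilon>: "0 < \<epsilon>"
  have "closed (star_tail \<epsilon> :: 'k star_graph set)"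
    unfolding star_tail_def by (intro closed_Collect_le continuous_on_const continuous_star_norm)
  moreover have "star_tail \<epsilon> = (- {center}) \<inter> (star_tail \<epsilon> :: 'k star_graph set)"
    using \<epsilon> by (auto simp: star_tail_def star_norm_center)
  ultimately show ?thesis
    unfolding sets_m sets_restrict_space by (metis borel_closed imageI)
qed

lemma one_minus_ell0_on_tail:
  assumes lam: "0 < lam" and x: "x \<in> star_tail \<epsilon>" and \<epsilon>: "0 < \<epsilon>"
  shows "1 - exp (- sqrt (2 * lam) * \<epsilon>) \<le> 1 - ell0 lam x"
proof -
  have "ell0 lam x \<le> exp (- sqrt (2 * lam) * \<epsilon>)"
  proof (cases x rule: star_cases)
    case (1 i y)
    then have "\<epsilon> \<le> y" using x by (simp add: star_tail_def)
    then show ?thesis using 1 lam by (simp add: ell0_star_pt[OF lam])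
  next
    case (2 i)
    have "\<forall>\<^sub>F y in at_top. ell0 lam (star_pt i (ennreal y)) \<le> exp (- sqrt (2 * lam) * \<epsilon>)"
      using eventually_ge_at_top[of \<epsilon>]
      by eventually_elim (use \<epsilon> lam in \<open>simp add: ell0_star_pt[OF lam]\<close>)
    then show ?thesis
      unfolding 2 by (intro tendsto_upperbound[OF star_tendsto_infinity[OF continuous_ell0[OF lam]]]) auto
  qed
  then show ?thesis by simp
qed

text \<open>Markov's inequality for \<open>1 - ell0 lam\<close>. It shows that the tails have finite measure, and, read the
  other way, that a large tail forces a large integral.\<close>
lemma emeasure_tail_le:
  assumes lam: "0 < lam" and \<epsilon>: "0 < \<epsilon>"
  shows "ennreal (1 - exp (- sqrt (2 * lam) * \<epsilon>)) * emeasure m (star_tail \<epsilon>)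
    \<le> ennreal (\<integral>x. 1 - ell0 lam x \<partial>m)"
proof -
  have "ennreal (1 - exp (- sqrt (2 * lam) * \<epsilon>)) * emeasure m (star_tail \<epsilon>)
      = (\<integral>\<^sup>+ x. ennreal (1 - exp (- sqrt (2 * lam) * \<epsilon>)) * indicator (star_tail \<epsilon>) x \<partial>m)"
    by (rule nn_integral_cmult_indicator[OF sets_tail[OF \<epsilon>], symmetric])
  also have "\<dots> \<le> (\<integral>\<^sup>+ x. ennreal (1 - ell0 lam x) \<partial>m)"
  proof (rule nn_integral_mono)
    fix x
    show "ennreal (1 - exp (- sqrt (2 * lam) * \<epsilon>)) * indicator (star_tail \<epsilon>) x \<le> ennreal (1 - ell0 lam x)"
    proof (cases "x \<in> star_tail \<epsilon>")
      case True
      then show ?thesis using ennreal_leI[OF one_minus_ell0_on_tail[OF lam True \<epsilon>]] by simp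
    qed simp
  qed
  also have "\<dots> = ennreal (\<integral>x. 1 - ell0 lam x \<partial>m)"
    using ell0_le_one[OF lam] by (intro nn_integral_eq_integral integrable_one_minus_ell0 lam) auto
  finally show ?thesis .
qed

lemma emeasure_tail_finite:
  assumes "0 < \<epsilon>"
  shows "emeasure m (star_tail \<epsilon>) < \<infinity>"
proof (rule ccontr)
  assume "\<not> ?thesis"
  then have "emeasure m (star_tail \<epsilon>) = top" by (simp add: not_less top_unique)
  moreover have "ennreal (1 - exp (- sqrt (2 * 1) * \<epsilon>)) \<noteq> 0" using assms by simp
  ultimately have "top \<le> ennreal (\<integral>x. 1 - ell0 1 x \<partial>m)"
    using emeasure_tail_le[OF zero_less_one assms] by (simp only: ennreal_mult_top if_False)
  then show False by (simp add: top_unique)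
qed

lemma tail_large:
  assumes "emeasure m (space m) = \<infinity>"
  obtains \<epsilon> where "0 < \<epsilon>" "ennreal Z < emeasure m (star_tail \<epsilon>)"
proof -
  let ?U = "\<lambda>n. star_tail (inverse (real (Suc n))) :: 'k star_graph set"
  have "incseq ?U"
    by (intro incseq_SucI) (auto simp: star_tail_def intro: order_trans[rotated] ennreal_leI le_imp_inverse_le)
  moreover have "range ?U \<subseteq> sets m" by (auto intro: sets_tail)
  moreover have "(\<Union>n. ?U n) = space m"
  proof (intro equalityI subsetI)
    fix x assume "x \<in> space m"
    then have xc: "x \<noteq> center" by (simp add: space_m)
    show "x \<in> (\<Union>n. ?U n)"
    proof (cases x rule: star_cases)
      case (1 i y)
      with xc have "0 < y" by (cases "y = 0") auto
      then obtain n where "inverse (real (Suc n)) < y" using reals_Archimedean by blast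
      then have "x \<in> ?U n" using 1 by (simp add: star_tail_def ennreal_leI)
      then show ?thesis by blast
    next
      case (2 i)
      then show ?thesis by (simp add: star_tail_def)
    qed
  next
    fix x assume "x \<in> (\<Union>n. ?U n)"
    then show "x \<in> space m" by (auto simp: space_m star_tail_def star_norm_center)
  qed
  ultimately have "(SUP n. emeasure m (?U n)) = top"
    using SUP_emeasure_incseq[of ?U m] assms by simp
  then obtain n where "ennreal Z < emeasure m (?U n)"
    by (metis SUP_eq_top_iff ennreal_less_top UNIV_I)
  then show thesis by (intro that[of "inverse (real (Suc n))"]) auto
qed

lemma integral_one_minus_ell0_nonneg: "0 < lam \<Longrightarrow> 0 \<le> (\<integral>x. 1 - ell0 lam x \<partial>m)"
  using ell0_le_one by (intro integral_nonneg_AE always_eventually) auto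

lemma mass_pos:
  assumes lam: "0 < lam"
  shows "0 < mass lam"
  using infinite
proof
  assume "emeasure m (space m) = \<infinity>"
  then obtain \<epsilon> where \<epsilon>: "0 < \<epsilon>" "ennreal 0 < emeasure m (star_tail \<epsilon>)"
    by (rule tail_large)
  moreover have "0 < 1 - exp (- sqrt (2 * lam) * \<epsilon>)" using \<epsilon> lam by simp
  ultimately have "0 < ennreal (1 - exp (- sqrt (2 * lam) * \<epsilon>)) * emeasure m (star_tail \<epsilon>)"
    by (simp add: ennreal_zero_less_mult_iff)
  then have "0 < (\<integral>x. 1 - ell0 lam x \<partial>m)"
    using emeasure_tail_le[OF lam \<epsilon>(1)] by (meson ennreal_less_zero_iff less_le_trans)
  then show ?thesis
    unfolding mass_def using \<alpha> \<beta> lam by (intro add_pos_nonneg mult_nonneg_nonneg sum_nonneg) auto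
next
  assume "\<exists>i. 0 < \<beta> i"
  then obtain i where "0 < \<beta> i" ..
  then have "0 < (\<Sum>i\<in>UNIV. \<beta> i)" using \<beta> by (intro sum_pos2[of UNIV i]) auto
  then show ?thesis
    unfolding mass_def using \<alpha> lam integral_one_minus_ell0_nonneg[OF lam]
    by (intro add_pos_nonneg add_nonneg_pos mult_pos_pos mult_nonneg_nonneg) auto
qed

text \<open>If the measure is infinite, some tail has measure above \<open>2 Z\<close>, and for large \<open>lam\<close> the function
  \<open>1 - ell0 lam\<close> is at least \<open>1 / 2\<close> on it. If some \<open>\<beta> i\<close> is positive, the term with the square root
  suffices.\<close>
lemma mass_at_top: "filterlim mass at_top at_top"
  using infinite
proof
  assume inf: "emeasure m (space m) = \<infinity>"
  show ?thesis
    unfolding filterlim_at_top_ge[of _ _ 0]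
  proof (intro allI impI)
    fix Z :: real assume Z: "0 \<le> Z"
    obtain \<epsilon> where \<epsilon>: "0 < \<epsilon>" "ennreal (2 * Z) < emeasure m (star_tail \<epsilon>)"
      by (rule tail_large[OF inf])
    have "filterlim (\<lambda>lam. sqrt (2 * lam) * \<epsilon>) at_top at_top"
      by (intro filterlim_at_top_mult_tendsto_pos[OF tendsto_const \<epsilon>(1)]
          filterlim_compose[OF sqrt_at_top] filterlim_tendsto_pos_mult_at_top[OF tendsto_const _ filterlim_ident]) simp
    then have "\<forall>\<^sub>F lam in at_top. ln 2 \<le> sqrt (2 * lam) * \<epsilon>"
      by (simp add: filterlim_at_top)
    then show "\<forall>\<^sub>F lam in at_top. Z \<le> mass lam"
      using eventually_gt_at_top[of 0]
    proof eventually_elim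
      case (elim lam)
      have "exp (- sqrt (2 * lam) * \<epsilon>) \<le> exp (- ln 2)" using elim by simp
      then have half: "1 / 2 \<le> 1 - exp (- sqrt (2 * lam) * \<epsilon>)" by (simp add: exp_minus)
      have "ennreal Z = ennreal (1 / 2) * ennreal (2 * Z)"
        using Z by (subst ennreal_mult[symmetric]) auto
      also have "\<dots> \<le> ennreal (1 - exp (- sqrt (2 * lam) * \<epsilon>)) * emeasure m (star_tail \<epsilon>)"
        using half \<epsilon>(2) by (intro mult_mono ennreal_leI) auto
      also have "\<dots> \<le> ennreal (\<integral>x. 1 - ell0 lam x \<partial>m)"
        by (rule emeasure_tail_le[OF elim(2) \<epsilon>(1)])
      finally have "Z \<le> (\<integral>x. 1 - ell0 lam x \<partial>m)"
        using integral_one_minus_ell0_nonneg[OF elim(2)] by (simp add: ennreal_le_iff)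
      moreover have "0 \<le> sqrt (2 * lam) * (\<Sum>i\<in>UNIV. \<beta> i) + lam * \<alpha>"
        using \<alpha> \<beta> elim by (intro add_nonneg_nonneg mult_nonneg_nonneg sum_nonneg) auto
      ultimately show ?case unfolding mass_def by linarith
    qed
  qed
next
  assume "\<exists>i. 0 < \<beta> i"
  then obtain i where "0 < \<beta> i" ..
  then have B: "0 < (\<Sum>i\<in>UNIV. \<beta> i)" using \<beta> by (intro sum_pos2[of UNIV i]) auto
  have "filterlim (\<lambda>lam. sqrt (2 * lam) * (\<Sum>i\<in>UNIV. \<beta> i)) at_top at_top"
    by (intro filterlim_at_top_mult_tendsto_pos[OF tendsto_const B]
        filterlim_compose[OF sqrt_at_top] filterlim_tendsto_pos_mult_at_top[OF tendsto_const _ filterlim_ident]) simp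
  then show ?thesis
  proof (rule filterlim_at_top_mono)
    show "\<forall>\<^sub>F lam in at_top. sqrt (2 * lam) * (\<Sum>i\<in>UNIV. \<beta> i) \<le> mass lam"
      using eventually_gt_at_top[of 0]
      by eventually_elim (use \<alpha> integral_one_minus_ell0_nonneg in \<open>simp add: mass_def\<close>)
  qed
qed

lemma boundary_fun_add: "0 < lam \<Longrightarrow> boundary_fun lam (g + h) = boundary_fun lam g + boundary_fun lam h"
  unfolding boundary_fun_def
  by (simp add: ext[where f = "R0 lam (g + h)", OF R0_add] C_total_add integrable_R0)

lemma boundary_fun_scale: "0 < lam \<Longrightarrow> boundary_fun lam (c *\<^sub>R g) = c * boundary_fun lam g"
  unfolding boundary_fun_def
  by (simp add: ext[where f = "R0 lam (c *\<^sub>R g)", OF R0_scale] C_total_scale integrable_R0 distrib_left)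

lemma boundary_fun_mono:
  assumes lam: "0 < lam" and "\<And>x. apply_bcontfun g x \<le> apply_bcontfun h x"
  shows "boundary_fun lam g \<le> boundary_fun lam h"
  unfolding boundary_fun_def
  by (intro add_mono integral_mono integrable_R0 R0_mono C_total_mono \<alpha> \<beta> assms)

lemma abs_boundary_fun_le:
  assumes lam: "0 < lam" and "\<And>x. \<bar>apply_bcontfun g x\<bar> \<le> apply_bcontfun h x"
  shows "\<bar>boundary_fun lam g\<bar> \<le> boundary_fun lam h"
proof -
  have "boundary_fun lam g \<le> boundary_fun lam h" "boundary_fun lam (- g) \<le> boundary_fun lam h"
    using assms(2) by (auto intro!: boundary_fun_mono[OF lam] simp: abs_le_iff)
  moreover have "boundary_fun lam (- g) = - boundary_fun lam g"
    using boundary_fun_scale[OF lam, of "- 1" g] by simp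
  ultimately show ?thesis by (simp add: abs_le_iff)
qed

lemma boundary_fun_nonneg:
  assumes lam: "0 < lam" and "\<And>x. 0 \<le> apply_bcontfun g x"
  shows "0 \<le> boundary_fun lam g"
  using boundary_fun_mono[OF lam, of 0 g] boundary_fun_scale[OF lam, of 0 0] assms(2) by simp

lemma lam_boundary_fun_one:
  assumes lam: "0 < lam"
  shows "lam * boundary_fun lam (const_bcontfun 1) = mass lam"
proof -
  have "lam * (\<integral>x. R0 lam (const_bcontfun 1) x \<partial>m) = (\<integral>x. 1 - ell0 lam x \<partial>m)"
    by (simp add: lam_R0_one[OF lam] flip: integral_mult_right_zero)
  then show ?thesis
    using lam_C_total_one[OF lam, of \<alpha> \<beta>] by (simp add: boundary_fun_def mass_def distrib_left)
qed

lemma C_bar_eq: "0 < lam \<Longrightarrow> C_bar \<alpha> \<beta> \<gamma> m lam g = boundary_fun lam g / (\<gamma> + mass lam)"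
  unfolding C_bar_def lam_boundary_fun_one[symmetric] boundary_fun_def by (simp add: distrib_left add.assoc)

lemma denominator_pos: "0 < lam \<Longrightarrow> 0 < \<gamma> + mass lam"
  using mass_pos \<gamma> by (simp add: add_nonneg_pos)

lemma abs_C_bar_le:
  assumes lam: "0 < lam"
  shows "\<bar>C_bar \<alpha> \<beta> \<gamma> m lam g\<bar> \<le> norm g / lam"
proof -
  have "\<bar>boundary_fun lam g\<bar> \<le> boundary_fun lam (norm g *\<^sub>R const_bcontfun 1)"
    using norm_bounded[of g] by (intro abs_boundary_fun_le lam) simp
  also have "\<dots> = norm g / lam * mass lam"
    using lam by (simp add: boundary_fun_scale flip: lam_boundary_fun_one)
  also have "\<dots> \<le> norm g / lam * (\<gamma> + mass lam)"
    using lam \<gamma> by (intro mult_left_mono) auto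
  finally show ?thesis
    using denominator_pos[OF lam] by (simp add: C_bar_eq[OF lam] field_simps)
qed

definition Res :: "real \<Rightarrow> ('k star_graph \<Rightarrow>\<^sub>C real) \<Rightarrow>\<^sub>L ('k star_graph \<Rightarrow>\<^sub>C real)" where
  "Res lam = Blinfun (\<lambda>g. Bcontfun (\<lambda>x. R0 lam g x + C_bar \<alpha> \<beta> \<gamma> m lam g * ell0 lam x))"

lemma
  assumes lam: "0 < lam"
  shows Res_apply: "Res lam g x = R0 lam g x + C_bar \<alpha> \<beta> \<gamma> m lam g * ell0 lam x"
    and norm_Res: "norm (Res lam) \<le> 1 / lam"
proof -
  let ?F = "\<lambda>g. Bcontfun (\<lambda>x. R0 lam g x + C_bar \<alpha> \<beta> \<gamma> m lam g * ell0 lam x)"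
  have F: "?F g x = R0 lam g x + C_bar \<alpha> \<beta> \<gamma> m lam g * ell0 lam x" for g x
    by (subst Bcontfun_inverse)
      (auto intro!: continuous_star_bcontfun continuous_intros continuous_R0 continuous_ell0 lam)
  have n: "norm (?F g) \<le> norm g * (1 / lam)" for g
  proof (rule norm_bound)
    fix x
    have "norm (?F g x) \<le> \<bar>R0 lam g x\<bar> + \<bar>C_bar \<alpha> \<beta> \<gamma> m lam g\<bar> * ell0 lam x"
      unfolding F using abs_triangle_ineq[of "R0 lam g x" "C_bar \<alpha> \<beta> \<gamma> m lam g * ell0 lam x"]
        ell0_nonneg[OF lam, of x] by (simp add: abs_mult)
    also have "\<dots> \<le> norm g / lam * (1 - ell0 lam x) + norm g / lam * ell0 lam x"
      by (intro add_mono mult_right_mono abs_R0_le abs_C_bar_le ell0_nonneg lam)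
    finally show "norm (?F g x) \<le> norm g * (1 / lam)" by (simp add: algebra_simps)
  qed
  have bl: "bounded_linear ?F"
  proof (rule bounded_linear_intro[OF _ _ n])
    show "?F (g + h) = ?F g + ?F h" for g h
      by (rule bcontfun_eqI, unfold plus_bcontfun.rep_eq F)
        (simp add: R0_add[OF lam] C_bar_eq[OF lam] boundary_fun_add[OF lam] add_divide_distrib algebra_simps)
    show "?F (r *\<^sub>R g) = r *\<^sub>R ?F g" for r g
      by (rule bcontfun_eqI, unfold scaleR_bcontfun.rep_eq F)
        (simp add: R0_scale[OF lam] C_bar_eq[OF lam] boundary_fun_scale[OF lam] algebra_simps)
  qed
  have R: "blinfun_apply (Res lam) = ?F"
    unfolding Res_def by (rule bounded_linear_Blinfun_apply[OF bl])
  show "Res lam g x = R0 lam g x + C_bar \<alpha> \<beta> \<gamma> m lam g * ell0 lam x"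
    unfolding R by (rule F)
  show "norm (Res lam) \<le> 1 / lam"
    using lam by (intro norm_blinfun_bound) (auto simp: R mult.commute[of "1 / lam"] intro: n[simplified])
qed

lemma Res_center:
  assumes "0 < lam"
  shows "Res lam g center = C_bar \<alpha> \<beta> \<gamma> m lam g"
  by (simp add: Res_apply R0_center ell0_center assms)

lemma Res_nonneg:
  assumes lam: "0 < lam" and g: "\<And>x. 0 \<le> apply_bcontfun g x"
  shows "0 \<le> Res lam g x"
proof -
  have "R0 lam 0 x = 0" using R0_scale[OF lam, of 0 0 x] by simp
  then have "0 \<le> R0 lam g x" using R0_mono[OF lam, of 0 g x] g by simp
  moreover have "0 \<le> C_bar \<alpha> \<beta> \<gamma> m lam g"
    unfolding C_bar_eq[OF lam] using boundary_fun_nonneg[OF lam g] denominator_pos[OF lam] by simp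
  ultimately show ?thesis
    by (simp add: Res_apply[OF lam] ell0_nonneg[OF lam])
qed

text \<open>For a function in resolvent form both sides of the boundary condition are affine in the value
  at the center, and collecting terms gives \<open>f center * (\<gamma> + mass lam) = boundary_fun lam g\<close>.\<close>
lemma boundary_condition_iff:
  assumes lam: "0 < lam" and f: "\<And>x. apply_bcontfun f x = R0 lam g x + f center * ell0 lam x"
  shows "\<alpha> / 2 * center_d2 f - (\<Sum>i\<in>UNIV. \<beta> i * edge_d1 f i 0) + \<gamma> * f center
      = (\<integral>x. (f x - f center) \<partial>m) \<longleftrightarrow> f center = C_bar \<alpha> \<beta> \<gamma> m lam g"
proof -
  let ?s = "sqrt (2 * lam)"
  let ?c = "f center" and ?B = "\<Sum>i\<in>UNIV. \<beta> i" and ?I = "\<integral>x. 1 - ell0 lam x \<partial>m"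
  let ?R = "\<integral>x. R0 lam g x \<partial>m" and ?S = "\<Sum>i\<in>UNIV. \<beta> i * C_edge lam i g"
  have "edge_d2 f i 0 = 2 * (lam * ?c - g center)" for i
    using resolvent_form_derivs(4)[OF lam f order_refl, of i] by (simp add: edge_0)
  then have d2: "center_d2 f = 2 * (lam * ?c - g center)"
    unfolding center_d2_def by simp
  have "edge_d1 f i 0 = 2 * ?s * C_edge lam i g - ?c * ?s" for i
    using resolvent_form_derivs(3)[OF lam f order_refl, of i] lam
    by (simp add: green_deriv_0 C_edge_eq_laplace)
  then have d1: "(\<Sum>i\<in>UNIV. \<beta> i * edge_d1 f i 0) = 2 * ?s * ?S - ?c * ?s * ?B"
    by (simp add: right_diff_distrib sum_subtractf sum_distrib_left sum_distrib_right mult_ac)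
  have "(\<integral>x. (f x - ?c) \<partial>m) = (\<integral>x. R0 lam g x - ?c * (1 - ell0 lam x) \<partial>m)"
    by (intro Bochner_Integration.integral_cong refl) (subst f, simp add: algebra_simps)
  also have "\<dots> = ?R - ?c * ?I"
    using integrable_R0[OF lam] integrable_one_minus_ell0[OF lam] by simp
  finally have int: "(\<integral>x. (f x - ?c) \<partial>m) = ?R - ?c * ?I" .
  let ?X = "\<alpha> / 2 * center_d2 f - (\<Sum>i\<in>UNIV. \<beta> i * edge_d1 f i 0) + \<gamma> * ?c"
  have X: "?X - (\<integral>x. (f x - ?c) \<partial>m) = ?c * (\<gamma> + mass lam) - boundary_fun lam g"
    unfolding d1 d2 int boundary_fun_def mass_def C_total_def by (simp add: algebra_simps)
  have C: "?c = C_bar \<alpha> \<beta> \<gamma> m lam g \<longleftrightarrow> ?c * (\<gamma> + mass lam) - boundary_fun lam g = 0"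
    unfolding C_bar_eq[OF lam] using denominator_pos[OF lam] by (simp add: field_simps)
  show ?thesis
    unfolding C X[symmetric] by (rule eq_iff_diff_eq_0)
qed

theorem is_resolvent_Res:
  assumes lam: "0 < lam"
  shows "is_resolvent (star_operator \<alpha> \<beta> \<gamma> m) lam (Res lam)"
  unfolding is_resolvent_def
proof (intro allI)
  fix f g :: "'k star_graph \<Rightarrow>\<^sub>C real"
  let ?form = "\<forall>x. f x = R0 lam g x + f center * ell0 lam x"
  let ?bc = "\<alpha> / 2 * center_d2 f - (\<Sum>i\<in>UNIV. \<beta> i * edge_d1 f i 0) + \<gamma> * f center
    = (\<integral>x. (f x - f center) \<partial>m)"
  have "(f, lam *\<^sub>R f - g) \<in> star_operator \<alpha> \<beta> \<gamma> m
      \<longleftrightarrow> (f, lam *\<^sub>R f - g) \<in> star_laplacian \<and> ?bc"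
    by (simp add: star_operator_def)
  also have "\<dots> \<longleftrightarrow> ?form \<and> f center = C_bar \<alpha> \<beta> \<gamma> m lam g"
    unfolding star_laplacian_resolvent[OF lam] using boundary_condition_iff[OF lam, of f g] by blast
  also have "\<dots> \<longleftrightarrow> f = Res lam g"
  proof
    assume f: "?form \<and> f center = C_bar \<alpha> \<beta> \<gamma> m lam g"
    show "f = Res lam g"
    proof (rule bcontfun_eqI)
      fix x
      have "f x = R0 lam g x + f center * ell0 lam x" "f center = C_bar \<alpha> \<beta> \<gamma> m lam g"
        using f by blast+
      then show "f x = Res lam g x"
        unfolding Res_apply[OF lam] by metis
    qed
  next
    assume f: "f = Res lam g"
    show "?form \<and> f center = C_bar \<alpha> \<beta> \<gamma> m lam g"
      unfolding f Res_center[OF lam] unfolding Res_apply[OF lam] by blast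
  qed
  finally show "(f, lam *\<^sub>R f - g) \<in> star_operator \<alpha> \<beta> \<gamma> m \<longleftrightarrow> f = Res lam g" .
qed

end

section \<open>The resolvents approximate the identity\<close>

lemma laplace_one_minus_exp_le:
  assumes s: "0 < s"
  shows "laplace s (\<lambda>y. 1 - exp (- \<bar>y\<bar>)) \<le> 1 / s\<^sup>2"
proof -
  have "laplace s (\<lambda>y. - 1 * exp (- \<bar>y\<bar>)) = - laplace s (\<lambda>y. exp (- \<bar>y\<bar>))"
    using laplace_scale[of s "- 1" "\<lambda>y. exp (- \<bar>y\<bar>)"] by simp
  moreover have "laplace s (\<lambda>y. exp (- \<bar>y\<bar>)) = laplace (s + 1) (\<lambda>_. 1)"
    unfolding laplace_def
    by (intro set_lebesgue_integral_cong) (auto simp: algebra_simps simp flip: exp_add)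
  moreover have "laplace s (\<lambda>y. 1 + - 1 * exp (- \<bar>y\<bar>))
      = laplace s (\<lambda>_. 1) + laplace s (\<lambda>y. - 1 * exp (- \<bar>y\<bar>))"
    by (rule laplace_add[OF s, where C = 1 and D = 1]) (auto intro!: continuous_intros)
  ultimately have "laplace s (\<lambda>y. 1 - exp (- \<bar>y\<bar>)) = 1 / s - 1 / (s + 1)"
    using s by (simp add: laplace_one)
  also have "\<dots> = 1 / (s * (s + 1))" using s by (simp add: field_simps)
  also have "\<dots> \<le> 1 / s\<^sup>2"
    using s by (intro divide_left_mono mult_pos_pos) (auto simp: power2_eq_square algebra_simps)
  finally show ?thesis .
qed

text \<open>The function \<open>1 - exp (- y)\<close> on every edge; the parameter \<open>1 / 2\<close> makes the exponent
  \<open>sqrt (2 * lam)\<close> equal to 1. It serves as a smooth substitute for \<open>min 1 y\<close>: for every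
  \<open>\<eta> > 0\<close>, a continuous function that vanishes at the center is at most \<open>\<eta> + L * ramp\<close> with some \<open>L\<close>.\<close>
definition ramp :: "'k::finite star_graph \<Rightarrow>\<^sub>C real" where
  "ramp = Bcontfun (\<lambda>x. 1 - ell0 (1 / 2) x)"

lemma ramp_apply: "ramp x = 1 - ell0 (1 / 2) x"
  unfolding ramp_def
  by (subst Bcontfun_inverse)
    (auto intro!: continuous_star_bcontfun continuous_intros continuous_ell0)

lemma ramp_star_pt: "0 \<le> y \<Longrightarrow> ramp (star_pt i (ennreal y)) = 1 - exp (- y)"
  by (simp add: ramp_apply ell0_star_pt)

lemma lam_R0_ramp_le:
  assumes lam: "0 < lam"
  shows "lam * R0 lam ramp x \<le> ramp x"
proof (rule star_le)
  show "lam * R0 lam ramp (star_pt i (ennreal y)) \<le> ramp (star_pt i (ennreal y))" if y: "0 \<le> y" for i y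
  proof -
    let ?s = "sqrt (2 * lam)"
    have "green ?s (edge ramp i) y \<le> green ?s (\<lambda>y. 1 - exp (- \<bar>y\<bar>)) y"
      by (rule green_mono[OF sqrt_pos[OF lam] y continuous_edge abs_edge_le, where D = 1])
        (auto intro!: continuous_intros simp: edge_def ramp_star_pt)
    also have "\<dots> \<le> 2 / ?s\<^sup>2 * (1 - exp (- y))"
      by (rule green_one_minus_exp_le[OF sqrt_pos[OF lam] y])
    finally have "lam * green ?s (edge ramp i) y \<le> lam * (2 / ?s\<^sup>2 * (1 - exp (- y)))"
      using lam by (intro mult_left_mono) auto
    then show ?thesis using lam y by (simp add: R0_star_pt ramp_star_pt)
  qed
qed (intro continuous_intros continuous_R0 lam continuous_on_apply_bcontfun)+

lemma lam_C_total_ramp_le: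
  fixes \<beta> :: "'k::finite \<Rightarrow> real"
  assumes lam: "0 < lam" and \<beta>: "\<And>i. 0 \<le> \<beta> i"
  shows "lam * C_total \<alpha> \<beta> lam ramp \<le> (\<Sum>i\<in>UNIV. \<beta> i)"
proof -
  let ?s = "sqrt (2 * lam)"
  have s: "0 < ?s" using lam by simp
  have l: "laplace ?s (edge ramp i) \<le> 1 / ?s\<^sup>2" for i :: 'k
    by (rule order_trans[OF laplace_mono[OF s continuous_edge abs_edge_le, where D = 1] laplace_one_minus_exp_le[OF s]])
      (auto intro!: continuous_intros simp: edge_def ramp_star_pt)
  have "ramp (center :: 'k star_graph) = 0"
    by (simp add: ramp_apply ell0_center)
  then have "lam * C_total \<alpha> \<beta> lam ramp = (\<Sum>i\<in>UNIV. \<beta> i * (?s\<^sup>2 * laplace ?s (edge ramp i)))"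
    using lam by (simp add: C_total_def C_edge_eq_laplace sum_distrib_left mult_ac)
  also have "\<dots> \<le> (\<Sum>i\<in>UNIV. \<beta> i * (?s\<^sup>2 * (1 / ?s\<^sup>2)))"
    by (intro sum_mono mult_left_mono l \<beta>) auto
  also have "\<dots> = (\<Sum>i\<in>UNIV. \<beta> i)" using lam by simp
  finally show ?thesis .
qed

context star_boundary
begin

text \<open>The bound does not depend on \<open>lam\<close>, whereas \<open>lam * boundary_fun lam 1 = mass lam\<close> tends to
  infinity. So \<open>boundary_fun lam\<close>, normalised by its value at 1, concentrates at the center.\<close>
lemma lam_boundary_fun_ramp_le:
  assumes lam: "0 < lam"
  shows "lam * boundary_fun lam ramp \<le> (\<integral>x. ramp x \<partial>m) + (\<Sum>i\<in>UNIV. \<beta> i)"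
proof -
  have "integrable m (apply_bcontfun ramp)"
    using integrable_one_minus_ell0[of "1 / 2"] by (simp add: ramp_apply[abs_def])
  then have "(\<integral>x. lam * R0 lam ramp x \<partial>m) \<le> (\<integral>x. ramp x \<partial>m)"
    by (intro integral_mono integrable_mult_right integrable_R0 lam lam_R0_ramp_le)
  then show ?thesis
    using lam_C_total_ramp_le[where \<alpha> = \<alpha> and \<beta> = \<beta>, OF lam \<beta>] by (simp add: boundary_fun_def distrib_left)
qed

lemma Res_one_close:
  assumes lam: "0 < lam"
  shows "norm (lam *\<^sub>R Res lam (const_bcontfun 1) - const_bcontfun 1) \<le> \<gamma> / mass lam"
proof (rule norm_bound)
  fix x
  have m: "0 < mass lam" "0 < \<gamma> + mass lam"
    using mass_pos[OF lam] denominator_pos[OF lam] by auto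
  have "lam * C_bar \<alpha> \<beta> \<gamma> m lam (const_bcontfun 1) = mass lam / (\<gamma> + mass lam)"
    by (simp add: C_bar_eq[OF lam] lam_boundary_fun_one[OF lam])
  then have "lam * Res lam (const_bcontfun 1) x - 1
      = (1 - ell0 lam x) + mass lam / (\<gamma> + mass lam) * ell0 lam x - 1"
    by (simp add: Res_apply[OF lam] distrib_left lam_R0_one[OF lam] flip: mult.assoc)
  also have "\<dots> = - (\<gamma> / (\<gamma> + mass lam) * ell0 lam x)"
    using m by (simp add: field_simps)
  finally have "norm ((lam *\<^sub>R Res lam (const_bcontfun 1) - const_bcontfun 1) x)
      = \<gamma> / (\<gamma> + mass lam) * ell0 lam x"
    using \<gamma> m ell0_nonneg[OF lam, of x] by (simp add: abs_mult)
  also have "\<dots> \<le> \<gamma> / (\<gamma> + mass lam)"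
    using \<gamma> m ell0_le_one[OF lam, of x] by (intro mult_left_le) auto
  also have "\<dots> \<le> \<gamma> / mass lam"
    using \<gamma> m by (intro divide_left_mono) auto
  finally show "norm ((lam *\<^sub>R Res lam (const_bcontfun 1) - const_bcontfun 1) x) \<le> \<gamma> / mass lam" .
qed

text \<open>The first two terms of the bound come from \<open>green_approx_identity\<close>, the last one and a third \<open>\<eta>\<close>
  from \<open>C_bar\<close>, whose numerator is estimated by \<open>boundary_fun lam\<close> of \<open>\<eta> + L * ramp\<close>.\<close>
lemma Res_vanishing_close:
  assumes lam: "0 < lam" and K: "0 \<le> K" and L: "0 \<le> L" and \<eta>: "0 \<le> \<eta>"
    and mod: "\<And>i x y. 0 \<le> x \<Longrightarrow> 0 \<le> y \<Longrightarrow> \<bar>edge h i y - edge h i x\<bar> \<le> \<eta> + K * \<bar>x - y\<bar>"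
    and h0: "apply_bcontfun h center = 0"
    and ramp: "\<And>x. \<bar>apply_bcontfun h x\<bar> \<le> \<eta> + L * ramp x"
  shows "norm (lam *\<^sub>R Res lam h - h)
    \<le> 3 * \<eta> + 3 * K / sqrt (2 * lam) + L * ((\<integral>x. ramp x \<partial>m) + (\<Sum>i\<in>UNIV. \<beta> i)) / mass lam"
proof (rule norm_bound)
  fix x
  let ?s = "sqrt (2 * lam)" and ?W = "(\<integral>x. ramp x \<partial>m) + (\<Sum>i\<in>UNIV. \<beta> i)"
  have m: "0 < mass lam" using mass_pos[OF lam] .
  have 1: "\<bar>lam * R0 lam h x - h x\<bar> \<le> 2 * \<eta> + 3 * K / ?s"
  proof (rule star_le)
    show "\<bar>lam * R0 lam h (star_pt i (ennreal y)) - h (star_pt i (ennreal y))\<bar> \<le> 2 * \<eta> + 3 * K / ?s"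
      if y: "0 \<le> y" for i y
      using green_approx_identity[OF sqrt_pos[OF lam] y continuous_edge abs_edge_le K \<eta> mod, of i] h0 lam y
      by (simp add: edge_0 R0_star_pt) (simp add: edge_def)
  qed (intro continuous_intros continuous_R0 lam continuous_on_apply_bcontfun)+
  have 2: "\<bar>lam * C_bar \<alpha> \<beta> \<gamma> m lam h\<bar> \<le> \<eta> + L * ?W / mass lam"
  proof -
    have "\<bar>boundary_fun lam h\<bar> \<le> boundary_fun lam (\<eta> *\<^sub>R const_bcontfun 1 + L *\<^sub>R ramp)"
      using ramp by (intro abs_boundary_fun_le lam) simp
    also have "\<dots> = \<eta> * boundary_fun lam (const_bcontfun 1) + L * boundary_fun lam ramp"
      by (simp only: boundary_fun_add[OF lam] boundary_fun_scale[OF lam])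
    finally have "lam * \<bar>boundary_fun lam h\<bar> \<le> lam * (\<eta> * boundary_fun lam (const_bcontfun 1) + L * boundary_fun lam ramp)"
      using lam by (intro mult_left_mono) auto
    also have "\<dots> = \<eta> * mass lam + L * (lam * boundary_fun lam ramp)"
      by (simp add: algebra_simps flip: lam_boundary_fun_one[OF lam])
    also have "\<dots> \<le> \<eta> * mass lam + L * ?W"
      using lam_boundary_fun_ramp_le[OF lam] L by (intro add_left_mono mult_left_mono)
    finally have a: "lam * \<bar>boundary_fun lam h\<bar> \<le> \<eta> * mass lam + L * ?W" .
    have "\<bar>lam * C_bar \<alpha> \<beta> \<gamma> m lam h\<bar> = lam * \<bar>boundary_fun lam h\<bar> / (\<gamma> + mass lam)"
      using lam denominator_pos[OF lam] by (simp add: C_bar_eq[OF lam] abs_mult)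
    also have "\<dots> \<le> lam * \<bar>boundary_fun lam h\<bar> / mass lam"
      using m \<gamma> lam by (intro divide_left_mono) auto
    also have "\<dots> \<le> (\<eta> * mass lam + L * ?W) / mass lam"
      using m by (intro divide_right_mono a) auto
    also have "\<dots> = \<eta> + L * ?W / mass lam"
      using m by (simp add: add_divide_distrib)
    finally show ?thesis .
  qed
  have "(lam *\<^sub>R Res lam h - h) x
      = (lam * R0 lam h x - h x) + lam * C_bar \<alpha> \<beta> \<gamma> m lam h * ell0 lam x"
    by (simp add: Res_apply[OF lam] algebra_simps)
  also have "norm \<dots> \<le> \<bar>lam * R0 lam h x - h x\<bar> + \<bar>lam * C_bar \<alpha> \<beta> \<gamma> m lam h\<bar> * \<bar>ell0 lam x\<bar>"
    unfolding abs_mult[of "lam * C_bar \<alpha> \<beta> \<gamma> m lam h", symmetric] real_norm_def by (rule abs_triangle_ineq)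
  also have "\<dots> \<le> (2 * \<eta> + 3 * K / ?s) + (\<eta> + L * ?W / mass lam)"
    using 1 2 ell0_nonneg[OF lam, of x] ell0_le_one[OF lam, of x]
    by (intro add_mono 1 order_trans[OF mult_left_le 2]) auto
  finally show "norm ((lam *\<^sub>R Res lam h - h) x) \<le> 3 * \<eta> + 3 * K / ?s + L * ?W / mass lam"
    by simp
qed

lemma uniform_modulus:
  fixes h :: "'k star_graph \<Rightarrow>\<^sub>C real"
  assumes \<eta>: "0 < \<eta>"
  obtains K where "0 \<le> K"
    "\<And>i x y. 0 \<le> x \<Longrightarrow> 0 \<le> y \<Longrightarrow> \<bar>edge h i y - edge h i x\<bar> \<le> \<eta> + K * \<bar>x - y\<bar>"
proof -
  have "\<exists>K\<ge>0. \<forall>x\<ge>0. \<forall>y\<ge>0. \<bar>edge h i y - edge h i x\<bar> \<le> \<eta> + K * \<bar>x - y\<bar>" for i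
    by (rule modulus_of_continuity_half_line[OF continuous_edge abs_edge_le edge_tendsto \<eta>, of h i]) blast
  then obtain K where K: "\<And>i. 0 \<le> K i"
    "\<And>i x y. 0 \<le> x \<Longrightarrow> 0 \<le> y \<Longrightarrow> \<bar>edge h i y - edge h i x\<bar> \<le> \<eta> + K i * \<bar>x - y\<bar>"
    by metis
  show thesis
  proof (rule that[of "\<Sum>i\<in>UNIV. K i"])
    show "0 \<le> (\<Sum>i\<in>UNIV. K i)" by (intro sum_nonneg K)
    fix i and x y :: real assume "0 \<le> x" "0 \<le> y"
    then have "\<bar>edge h i y - edge h i x\<bar> \<le> \<eta> + K i * \<bar>x - y\<bar>" by (rule K)
    also have "\<dots> \<le> \<eta> + (\<Sum>i\<in>UNIV. K i) * \<bar>x - y\<bar>"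
      by (intro add_left_mono mult_right_mono member_le_sum K) auto
    finally show "\<bar>edge h i y - edge h i x\<bar> \<le> \<eta> + (\<Sum>i\<in>UNIV. K i) * \<bar>x - y\<bar>" .
  qed
qed

lemma one_minus_exp_ge: "0 \<le> y \<Longrightarrow> min 1 y \<le> 2 * (1 - exp (- y))" for y :: real
proof -
  assume y: "0 \<le> y"
  have "exp (- y) \<le> 1 / (1 + y)"
    using exp_ge_add_one_self[of y] y by (simp add: exp_minus inverse_eq_divide frac_le)
  then have "y / (1 + y) \<le> 1 - exp (- y)" using y by (simp add: field_simps)
  moreover have "min 1 y \<le> 2 * (y / (1 + y))"
    using y by (cases "y \<le> 1") (auto simp: min_def field_simps mult_left_le)
  ultimately show ?thesis by simp
qed

lemma Res_vanishing_tendsto: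
  assumes h0: "apply_bcontfun h center = 0"
  shows "((\<lambda>lam. lam *\<^sub>R Res lam h) \<longlongrightarrow> h) at_top"
  unfolding tendsto_iff
proof (intro allI impI)
  fix e :: real assume e: "0 < e"
  define \<eta> where "\<eta> = e / 6"
  have \<eta>: "0 < \<eta>" using e by (simp add: \<eta>_def)
  obtain K where K: "0 \<le> K"
    "\<And>i x y. 0 \<le> x \<Longrightarrow> 0 \<le> y \<Longrightarrow> \<bar>edge h i y - edge h i x\<bar> \<le> \<eta> + K * \<bar>x - y\<bar>"
    by (rule uniform_modulus[where h = h, OF \<eta>]) (erule that, assumption)
  define L where "L = 2 * (K + norm h)"
  have L: "0 \<le> L" using K by (simp add: L_def)
  have ramp: "\<bar>h x\<bar> \<le> \<eta> + L * ramp x" for x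
  proof (rule star_le)
    show "\<bar>h (star_pt i (ennreal y))\<bar> \<le> \<eta> + L * ramp (star_pt i (ennreal y))" if y: "0 \<le> y" for i y
    proof -
      have "\<bar>edge h i y\<bar> \<le> \<eta> + K * y"
        using K(2)[of 0 y i] y h0 by (simp add: edge_0)
      moreover have "\<bar>edge h i y\<bar> \<le> norm h" by (rule abs_edge_le)
      moreover have "0 \<le> norm h * y" using y by simp
      ultimately have "\<bar>edge h i y\<bar> \<le> \<eta> + (K + norm h) * min 1 y"
      proof (cases "y \<le> 1")
        case True
        then have "(K + norm h) * min 1 y = K * y + norm h * y"
          by (simp add: min_def distrib_right)
        then show ?thesis
          using \<open>\<bar>edge h i y\<bar> \<le> \<eta> + K * y\<close> \<open>0 \<le> norm h * y\<close> by linarith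
      next
        case False
        then have "(K + norm h) * min 1 y = K + norm h" by (simp add: min_def)
        then show ?thesis
          using \<open>\<bar>edge h i y\<bar> \<le> norm h\<close> K(1) \<eta> by linarith
      qed
      also have "\<dots> \<le> \<eta> + (K + norm h) * (2 * (1 - exp (- y)))"
        using K(1) y by (intro add_left_mono mult_left_mono one_minus_exp_ge) auto
      finally show ?thesis using y by (simp add: ramp_star_pt L_def edge_def algebra_simps)
    qed
  qed (intro continuous_intros continuous_on_apply_bcontfun)+
  let ?W = "(\<integral>x. ramp x \<partial>m) + (\<Sum>i\<in>UNIV. \<beta> i)"
  have s: "filterlim (\<lambda>lam::real. sqrt (2 * lam)) at_top at_top"
    by (intro filterlim_compose[OF sqrt_at_top] filterlim_tendsto_pos_mult_at_top[OF tendsto_const _ filterlim_ident]) simp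
  have "((\<lambda>lam. 3 * \<eta> + 3 * K / sqrt (2 * lam) + L * ?W / mass lam) \<longlongrightarrow> 3 * \<eta> + 0 + 0) at_top"
    by (intro tendsto_add tendsto_const real_tendsto_divide_at_top[OF tendsto_const] s mass_at_top)
  then have "\<forall>\<^sub>F lam in at_top. 3 * \<eta> + 3 * K / sqrt (2 * lam) + L * ?W / mass lam < e"
    by (rule order_tendstoD(2)) (use e in \<open>simp add: \<eta>_def\<close>)
  then show "\<forall>\<^sub>F lam in at_top. dist (lam *\<^sub>R Res lam h) h < e"
    using eventually_gt_at_top[of 0]
  proof eventually_elim
    case (elim lam)
    then show ?case
      using Res_vanishing_close[OF elim(2) K(1) L less_imp_le[OF \<eta>] K(2) h0 ramp] by (simp add: dist_norm)
  qed
qed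

lemma Res_one_tendsto: "((\<lambda>lam. lam *\<^sub>R Res lam (const_bcontfun 1)) \<longlongrightarrow> const_bcontfun 1) at_top"
proof -
  have "((\<lambda>lam. \<gamma> / mass lam) \<longlongrightarrow> 0) at_top"
    by (intro real_tendsto_divide_at_top[OF tendsto_const] mass_at_top)
  moreover have "\<forall>\<^sub>F lam in at_top.
      norm (lam *\<^sub>R Res lam (const_bcontfun 1) - const_bcontfun 1) \<le> \<gamma> / mass lam"
    using eventually_gt_at_top[of 0] by eventually_elim (rule Res_one_close)
  ultimately have "((\<lambda>lam. lam *\<^sub>R Res lam (const_bcontfun 1) - const_bcontfun 1) \<longlongrightarrow> 0) at_top"
    by (rule Lim_null_comparison[rotated])
  then show ?thesis by (rule Lim_null[THEN iffD2])
qed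

lemma Res_tendsto: "((\<lambda>lam. lam *\<^sub>R Res lam g) \<longlongrightarrow> g) at_top"
proof -
  define h where "h = g - g center *\<^sub>R const_bcontfun 1"
  have h0: "h center = 0" by (simp add: h_def)
  have g: "g = h + g center *\<^sub>R const_bcontfun 1" by (simp add: h_def)
  have "((\<lambda>lam. lam *\<^sub>R Res lam h + g center *\<^sub>R (lam *\<^sub>R Res lam (const_bcontfun 1)))
      \<longlongrightarrow> h + g center *\<^sub>R const_bcontfun 1) at_top"
    by (intro tendsto_add tendsto_scaleR tendsto_const Res_vanishing_tendsto Res_one_tendsto h0)
  moreover have "lam *\<^sub>R Res lam h + g center *\<^sub>R (lam *\<^sub>R Res lam (const_bcontfun 1)) = lam *\<^sub>R Res lam g" for lam
    by (simp add: h_def blinfun.bilinear_simps algebra_simps)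
  ultimately show ?thesis using g by simp
qed

sublocale contraction_resolvent "star_operator \<alpha> \<beta> \<gamma> m" Res
  by unfold_locales (rule is_resolvent_Res norm_Res Res_tendsto; assumption?)+

lemma T_nonneg:
  assumes f: "\<And>x. 0 \<le> apply_bcontfun f x" and t: "0 \<le> t"
  shows "0 \<le> T t f x"
proof -
  have "0 \<le> (blinfun_apply (J h) ^^ n) f x" if h: "0 < h" for h n x
  proof (induction n arbitrary: x)
    case (Suc n)
    then show ?case
      using h by (simp add: J_def blinfun.scaleR_left Res_nonneg)
  qed (simp add: f)
  then have "0 \<le> E k t f x" for k
    by (simp add: E_def)
  then show ?thesis
    by (intro LIMSEQ_le_const[OF tendsto_apply_bcontfun[OF T_lim[OF t]]]) auto
qed

lemma feller_semigroup_T: "feller_semigroup T"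
  using contraction_semigroup_T T_nonneg
  unfolding feller_semigroup_def contraction_semigroup_def by blast

lemma feller_generator_star_operator: "feller_generator (star_operator \<alpha> \<beta> \<gamma> m)"
  unfolding feller_generator_def using feller_semigroup_T generator_T by blast

lemma semigroup_of_star_operator:
  assumes "0 \<le> t"
  shows "semigroup_of (star_operator \<alpha> \<beta> \<gamma> m) t = T t"
  unfolding semigroup_of_def
proof (rule the_equality)
  show "\<exists>S. feller_semigroup S \<and> generator S = star_operator \<alpha> \<beta> \<gamma> m \<and> S t = T t"
    using feller_semigroup_T generator_T by blast
  fix B assume "\<exists>S. feller_semigroup S \<and> generator S = star_operator \<alpha> \<beta> \<gamma> m \<and> S t = B"
  then obtain S where S: "feller_semigroup S" "generator S = star_operator \<alpha> \<beta> \<gamma> m" "S t = B" by blast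
  then have "contraction_semigroup S"
    unfolding feller_semigroup_def contraction_semigroup_def by blast
  then show "B = T t"
    using semigroup_unique[OF _ S(2) assms] S(3) by simp
qed

lemma resolvent_star_operator:
  assumes lam: "0 < lam"
  shows "resolvent (star_operator \<alpha> \<beta> \<gamma> m) lam = Res lam"
  unfolding resolvent_def
proof (rule the_equality)
  show "is_resolvent (star_operator \<alpha> \<beta> \<gamma> m) lam (Res lam)"
    by (rule is_resolvent_Res[OF lam])
  fix R assume R: "is_resolvent (star_operator \<alpha> \<beta> \<gamma> m) lam R"
  show "R = Res lam"
  proof (rule blinfun_eqI)
    fix g
    have "(R g, lam *\<^sub>R R g - g) \<in> star_operator \<alpha> \<beta> \<gamma> m"
      using R unfolding is_resolvent_def by blast
    then show "R g = Res lam g"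
      using is_resolvent_Res[OF lam] unfolding is_resolvent_def by blast
  qed
qed

text \<open>Normalising the restricted measure and multiplying by its total mass again gives the
  restricted measure.\<close>
abbreviation cutoff :: "real \<Rightarrow> 'k star_graph measure" where
  "cutoff \<epsilon> \<equiv> density m (indicator (star_tail \<epsilon>))"

lemma scale_uniform_measure_tail:
  assumes \<epsilon>: "0 < \<epsilon>" and pos: "0 < emeasure m (star_tail \<epsilon>)"
  shows "scale_measure (emeasure m (star_tail \<epsilon>)) (uniform_measure m (star_tail \<epsilon>)) = cutoff \<epsilon>"
proof (rule measure_eqI)
  fix A assume "A \<in> sets (scale_measure (emeasure m (star_tail \<epsilon>)) (uniform_measure m (star_tail \<epsilon>)))"
  then have A: "A \<in> sets m" by simp
  have "emeasure m (star_tail \<epsilon>) * (emeasure m (star_tail \<epsilon> \<inter> A) / emeasure m (star_tail \<epsilon>))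
      = emeasure m (star_tail \<epsilon> \<inter> A)"
    unfolding ennreal_times_divide mult.commute[of "emeasure m (star_tail \<epsilon>)"]
    using pos emeasure_tail_finite[OF \<epsilon>] by (intro ennreal_mult_divide_eq) auto
  then show "emeasure (scale_measure (emeasure m (star_tail \<epsilon>)) (uniform_measure m (star_tail \<epsilon>))) A
      = emeasure (cutoff \<epsilon>) A"
    using A sets_tail[OF \<epsilon>] by (simp add: emeasure_restricted)
qed simp

lemma indicator_tail_measurable: "(indicator (star_tail \<epsilon>) :: _ \<Rightarrow> real) \<in> borel_measurable m"
proof -
  have "closed (star_tail \<epsilon> :: 'k star_graph set)"
    unfolding star_tail_def by (intro closed_Collect_le continuous_on_const continuous_star_norm)
  then have "(indicator (star_tail \<epsilon>) :: _ \<Rightarrow> real) \<in> borel_measurable (restrict_space borel (- {center :: 'k star_graph}))"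
    by (intro measurable_restrict_space1 borel_measurable_indicator borel_closed)
  then show ?thesis using measurable_cong_sets[OF sets_m refl] by blast
qed

lemma integral_cutoff:
  fixes f :: "'k star_graph \<Rightarrow> real"
  assumes "f \<in> borel_measurable m"
  shows "(\<integral>x. f x \<partial>cutoff \<epsilon>) = (\<integral>x. indicator (star_tail \<epsilon>) x * f x \<partial>m)"
  using integral_density[OF assms indicator_tail_measurable, of \<epsilon>]
  by (simp add: ennreal_indicator)

lemma integral_cutoff_tendsto:
  fixes f :: "'k star_graph \<Rightarrow> real"
  assumes f: "integrable m f"
  shows "((\<lambda>\<epsilon>. \<integral>x. f x \<partial>cutoff \<epsilon>) \<longlongrightarrow> (\<integral>x. f x \<partial>m)) (at_right 0)"
  unfolding filterlim_at_right_to_top integral_cutoff[OF borel_measurable_integrable[OF f]]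
proof (rule integral_dominated_convergence_at_top[where w = "\<lambda>x. \<bar>f x\<bar>"])
  show "(\<lambda>x. indicator (star_tail (inverse t)) x * f x) \<in> borel_measurable m" for t
    using indicator_tail_measurable borel_measurable_integrable[OF f] by (intro borel_measurable_times) auto
  show "AE x in m. ((\<lambda>t. indicator (star_tail (inverse t)) x * f x) \<longlongrightarrow> f x) at_top"
  proof (rule AE_I2)
    fix x assume "x \<in> space m"
    then have x: "x \<noteq> center" by (simp add: space_m)
    have "\<exists>y>0. x \<in> star_tail y"
    proof (cases x rule: star_cases)
      case (1 i y)
      then have "0 < y" using x by (cases "y = 0") auto
      then show ?thesis using 1 by (auto simp: star_tail_def)
    next
      case (2 i)
      then show ?thesis by (auto simp: star_tail_def intro: exI[of _ 1])
    qed
    then obtain y where y: "0 < y" "x \<in> star_tail y" by blast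
    have "\<forall>\<^sub>F t in at_top. indicator (star_tail (inverse t)) x * f x = f x"
      using eventually_ge_at_top[of "inverse y"]
    proof eventually_elim
      case (elim t)
      then have "inverse t \<le> y"
        using y(1) le_imp_inverse_le[OF elim] by simp
      then have "x \<in> star_tail (inverse t)"
        using y(2) by (auto simp: star_tail_def intro: order_trans[OF ennreal_leI])
      then show ?case by simp
    qed
    then show "((\<lambda>t. indicator (star_tail (inverse t)) x * f x) \<longlongrightarrow> f x) at_top"
      by (rule tendsto_eventually)
  qed
  show "\<forall>\<^sub>F t in at_top. AE x in m. norm (indicator (star_tail (inverse t)) x * f x) \<le> \<bar>f x\<bar>"
    by (auto split: split_indicator)
qed (use f in auto)

lemma star_boundary_cutoff:
  assumes "\<And>i. 0 < \<beta>' i"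
  shows "star_boundary \<alpha> \<gamma> \<beta>' (cutoff \<epsilon>)"
proof
  show "sets (cutoff \<epsilon>) = sets (restrict_space borel (- {center}))"
    by (simp add: sets_m)
  have "(indicator (star_tail \<epsilon>) :: _ \<Rightarrow> ennreal) \<in> borel_measurable m"
    using measurable_compose[OF indicator_tail_measurable measurable_ennreal, of \<epsilon>]
    by (simp add: ennreal_indicator)
  moreover have "(\<lambda>x. min 1 (star_norm x)) \<in> borel_measurable m"
    by (intro measurable_continuous continuous_on_min continuous_on_const continuous_star_norm)
  ultimately have "(\<integral>\<^sup>+ x. min 1 (star_norm x) \<partial>cutoff \<epsilon>)
      = (\<integral>\<^sup>+ x. indicator (star_tail \<epsilon>) x * min 1 (star_norm x) \<partial>m)"
    by (rule nn_integral_density)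
  also have "\<dots> \<le> (\<integral>\<^sup>+ x. min 1 (star_norm x) \<partial>m)"
    by (intro nn_integral_mono) (auto split: split_indicator)
  finally show "(\<integral>\<^sup>+ x. min 1 (star_norm x) \<partial>cutoff \<epsilon>) < \<infinity>"
    using finite_m by (rule le_less_trans)
  show "emeasure (cutoff \<epsilon>) (space (cutoff \<epsilon>)) = \<infinity> \<or> (\<exists>i. 0 < \<beta>' i)"
    using assms by blast
  show "0 \<le> \<beta>' i" for i using assms less_imp_le by blast
qed (rule \<alpha> \<gamma>)+

lemma C_bar_cutoff_tendsto:
  assumes lam: "0 < lam" and b: "\<And>i. ((\<lambda>\<epsilon>. b \<epsilon> i) \<longlongrightarrow> \<beta> i) (at_right 0)"
  shows "((\<lambda>\<epsilon>. C_bar \<alpha> (b \<epsilon>) \<gamma> (cutoff \<epsilon>) lam g) \<longlongrightarrow> C_bar \<alpha> \<beta> \<gamma> m lam g) (at_right 0)"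
proof -
  have C: "((\<lambda>\<epsilon>. C_total \<alpha> (b \<epsilon>) lam g) \<longlongrightarrow> C_total \<alpha> \<beta> lam g) (at_right 0)" for g
    unfolding C_total_def by (intro tendsto_intros b)
  have "\<gamma> + lam * (\<integral>x. R0 lam (const_bcontfun 1) x \<partial>m) + lam * C_total \<alpha> \<beta> lam (const_bcontfun 1) \<noteq> 0"
    using denominator_pos[OF lam] lam_boundary_fun_one[OF lam] by (simp add: boundary_fun_def distrib_left add.assoc)
  then show ?thesis
    unfolding C_bar_def
    by (intro tendsto_divide tendsto_add tendsto_mult tendsto_const integral_cutoff_tendsto integrable_R0 lam C)
qed

end

text \<open>Resolvents with different data share the term \<open>R0 lam g\<close>, so only the scalars \<open>C_bar\<close> differ.\<close>
lemma norm_Res_diff_le: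
  assumes A: "star_boundary \<alpha> \<gamma> \<beta> m" and B: "star_boundary \<alpha>' \<gamma>' \<beta>' m'" and lam: "0 < lam"
  shows "norm (star_boundary.Res \<alpha> \<gamma> \<beta> m lam g - star_boundary.Res \<alpha>' \<gamma>' \<beta>' m' lam g)
    \<le> \<bar>C_bar \<alpha> \<beta> \<gamma> m lam g - C_bar \<alpha>' \<beta>' \<gamma>' m' lam g\<bar>"
proof (rule norm_bound)
  fix x
  have "star_boundary.Res \<alpha> \<gamma> \<beta> m lam g x - star_boundary.Res \<alpha>' \<gamma>' \<beta>' m' lam g x
      = (C_bar \<alpha> \<beta> \<gamma> m lam g - C_bar \<alpha>' \<beta>' \<gamma>' m' lam g) * ell0 lam x"
    by (simp add: star_boundary.Res_apply[OF A lam] star_boundary.Res_apply[OF B lam] left_diff_distrib)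
  then show "norm ((star_boundary.Res \<alpha> \<gamma> \<beta> m lam g - star_boundary.Res \<alpha>' \<gamma>' \<beta>' m' lam g) x)
      \<le> \<bar>C_bar \<alpha> \<beta> \<gamma> m lam g - C_bar \<alpha>' \<beta>' \<gamma>' m' lam g\<bar>"
    using ell0_nonneg[OF lam, of x] ell0_le_one[OF lam, of x] by (simp add: abs_mult mult_left_le)
qed

section \<open>Generation and approximation\<close>

theorem theorem7p2:
  fixes m :: "'k::finite star_graph measure"
    and \<alpha> \<gamma> :: real and \<beta> :: "'k \<Rightarrow> real" and b :: "real \<Rightarrow> 'k \<Rightarrow> real"
  assumes "2 \<le> CARD('k)"
    and "sets m = sets (restrict_space borel (- {center}))"
    and "emeasure m (space m) = \<infinity>"
    and "\<forall>i. emeasure m {star_pt i \<infinity>} = 0"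
    and "(\<integral>\<^sup>+ x. min 1 (star_norm x) \<partial>m) < \<infinity>"
    and "0 \<le> \<alpha>" and "0 \<le> \<gamma>" and "\<forall>i. 0 \<le> \<beta> i"
    and "\<forall>\<epsilon>>0. 0 < emeasure m (star_tail \<epsilon>) \<longrightarrow> (\<forall>i. 0 < b \<epsilon> i)"
    and "\<forall>i. ((\<lambda>\<epsilon>. b \<epsilon> i) \<longlongrightarrow> \<beta> i) (at_right 0)"
  shows "feller_generator (star_operator \<alpha> \<beta> \<gamma> m) \<and>
    (\<forall>lam>0. lam \<in> resolvent_set (star_operator \<alpha> \<beta> \<gamma> m) \<and>
       (\<forall>g x. blinfun_apply (resolvent (star_operator \<alpha> \<beta> \<gamma> m) lam) g x
              = R0 lam g x + C_bar \<alpha> \<beta> \<gamma> m lam g * ell0 lam x)) \<and>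
    (\<forall>f. \<forall>s\<ge>0. \<forall>t\<ge>s. uniform_limit {s..t}
       (\<lambda>\<epsilon> r. semigroup_of (approx_operator \<alpha> b \<gamma> m \<epsilon>) r f)
       (\<lambda>r. semigroup_of (star_operator \<alpha> \<beta> \<gamma> m) r f)
       (at_right 0))"
proof (intro conjI)
  interpret star_boundary \<alpha> \<gamma> \<beta> m
    using assms by unfold_locales auto
  show "feller_generator (star_operator \<alpha> \<beta> \<gamma> m)"
    by (rule feller_generator_star_operator)
  show "\<forall>lam>0. lam \<in> resolvent_set (star_operator \<alpha> \<beta> \<gamma> m) \<and>
       (\<forall>g x. blinfun_apply (resolvent (star_operator \<alpha> \<beta> \<gamma> m) lam) g x
              = R0 lam g x + C_bar \<alpha> \<beta> \<gamma> m lam g * ell0 lam x)"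
    using is_resolvent_Res by (auto simp: resolvent_set_def resolvent_star_operator Res_apply)
  define Re where "Re = (\<lambda>\<epsilon>. star_boundary.Res \<alpha> \<gamma> (b \<epsilon>) (cutoff \<epsilon>))"
  define Te where "Te = (\<lambda>\<epsilon>. contraction_resolvent.T (Re \<epsilon>))"
  \<comment> \<open>a restricted measure can be normalised only if it is not zero\<close>
  have "\<forall>\<^sub>F \<epsilon> in at_right 0. 0 < emeasure m (star_tail \<epsilon>)"
  proof -
    obtain \<epsilon>0 where \<epsilon>0: "0 < \<epsilon>0" "ennreal 0 < emeasure m (star_tail \<epsilon>0)"
      by (rule tail_large[OF assms(3)])
    have "\<forall>\<^sub>F \<epsilon> in at_right 0. \<epsilon> \<in> {0<..<\<epsilon>0}"
      by (rule eventually_at_right_real[OF \<epsilon>0(1)])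
    then show ?thesis
    proof eventually_elim
      case (elim \<epsilon>)
      then have "star_tail \<epsilon>0 \<subseteq> (star_tail \<epsilon> :: 'k star_graph set)"
        using order_trans[OF ennreal_leI[of \<epsilon> \<epsilon>0]] by (auto simp: star_tail_def)
      then have "emeasure m (star_tail \<epsilon>0) \<le> emeasure m (star_tail \<epsilon>)"
        using elim by (intro emeasure_mono sets_tail) auto
      then show ?case using \<epsilon>0(2) by simp
    qed
  qed
  then have ev: "\<forall>\<^sub>F \<epsilon> in at_right 0. star_boundary \<alpha> \<gamma> (b \<epsilon>) (cutoff \<epsilon>) \<and>
      approx_operator \<alpha> b \<gamma> m \<epsilon> = star_operator \<alpha> (b \<epsilon>) \<gamma> (cutoff \<epsilon>)"
    using eventually_at_right_less[of 0]
  proof eventually_elim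
    case (elim \<epsilon>)
    then show ?case
      using assms(9) unfolding approx_operator_def
      by (intro conjI star_boundary_cutoff) (auto simp: scale_uniform_measure_tail)
  qed
  show "\<forall>f. \<forall>s\<ge>0. \<forall>t\<ge>s. uniform_limit {s..t}
       (\<lambda>\<epsilon> r. semigroup_of (approx_operator \<alpha> b \<gamma> m \<epsilon>) r f)
       (\<lambda>r. semigroup_of (star_operator \<alpha> \<beta> \<gamma> m) r f) (at_right 0)"
  proof (intro allI impI)
    fix f :: "'k star_graph \<Rightarrow>\<^sub>C real" and s t :: real
    assume st: "0 \<le> s" "s \<le> t"
    have lim: "((\<lambda>\<epsilon>. Re \<epsilon> lam g) \<longlongrightarrow> Res lam g) (at_right 0)" if lam: "0 < lam" for lam g
    proof -
      have "((\<lambda>\<epsilon>. \<bar>C_bar \<alpha> (b \<epsilon>) \<gamma> (cutoff \<epsilon>) lam g - C_bar \<alpha> \<beta> \<gamma> m lam g\<bar>) \<longlongrightarrow> 0) (at_right 0)"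
        using assms(10) by (intro tendsto_rabs_zero LIM_zero C_bar_cutoff_tendsto lam) auto
      moreover have "\<forall>\<^sub>F \<epsilon> in at_right 0. norm (Re \<epsilon> lam g - Res lam g)
          \<le> \<bar>C_bar \<alpha> (b \<epsilon>) \<gamma> (cutoff \<epsilon>) lam g - C_bar \<alpha> \<beta> \<gamma> m lam g\<bar>"
        using ev unfolding Re_def
        by eventually_elim (blast intro: norm_Res_diff_le star_boundary_axioms lam)
      ultimately have "((\<lambda>\<epsilon>. Re \<epsilon> lam g - Res lam g) \<longlongrightarrow> 0) (at_right 0)"
        by (rule Lim_null_comparison[rotated])
      then show ?thesis by (rule Lim_null[THEN iffD2])
    qed
    have ev': "\<forall>\<^sub>F \<epsilon> in at_right 0. contraction_resolvent (star_operator \<alpha> (b \<epsilon>) \<gamma> (cutoff \<epsilon>)) (Re \<epsilon>) \<and>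
        contraction_semigroup (Te \<epsilon>) \<and> generator (Te \<epsilon>) = star_operator \<alpha> (b \<epsilon>) \<gamma> (cutoff \<epsilon>)"
      using ev
    proof eventually_elim
      case (elim \<epsilon>)
      interpret C: star_boundary \<alpha> \<gamma> "b \<epsilon>" "cutoff \<epsilon>" using elim by blast
      show ?case
        unfolding Te_def Re_def
        using C.contraction_resolvent_axioms C.contraction_semigroup_T C.generator_T by blast
    qed
    have "uniform_limit {s..t} (\<lambda>\<epsilon> r. Te \<epsilon> r f) (\<lambda>r. T r f) (at_right 0)"
      by (rule trotter_kato[OF ev' contraction_resolvent_axioms contraction_semigroup_T generator_T lim st])
    moreover have "\<forall>\<^sub>F \<epsilon> in at_right 0. \<forall>r\<in>{s..t}. Te \<epsilon> r f = semigroup_of (approx_operator \<alpha> b \<gamma> m \<epsilon>) r f"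
      using ev
    proof eventually_elim
      case (elim \<epsilon>)
      interpret C: star_boundary \<alpha> \<gamma> "b \<epsilon>" "cutoff \<epsilon>" using elim by blast
      show ?case
        using st elim by (auto simp: Te_def Re_def C.semigroup_of_star_operator)
    qed
    ultimately show "uniform_limit {s..t}
       (\<lambda>\<epsilon> r. semigroup_of (approx_operator \<alpha> b \<gamma> m \<epsilon>) r f)
       (\<lambda>r. semigroup_of (star_operator \<alpha> \<beta> \<gamma> m) r f) (at_right 0)"
      using st by (subst uniform_limit_cong[symmetric]) (auto simp: semigroup_of_star_operator)
  qed
qed

end
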